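(* Let $\overline{\mathfrak H}\subseteq(0,1]^d$ (compact or finite) and $\overline{\mathfrak P}\subseteq\mathfrak P$ be arbitrary subsets such that $\overline{\mathfrak H}[\overline{\mathfrak P}]$ is non-empty. Then for any $0<\mathbf f<+\infty$, any $q\ge 1$ and any integer $n\ge 3$, $$\mathcal R_n^{(q)}[\widehat f_n,f]\le \alpha_1\,\mathfrak R_n(f)+\alpha_2\,[nV_{\max}]^{-1/2}\qquad\forall f\in\mathbb F_d[\mathbf f,\overline{\mathfrak P}],$$ where $\widehat f_n(x_0)$ is the estimator given by the selection rule described in the context, and $\alpha_1=\alpha_1(q,d,\mathbf K,\mathbf f)$, $\alpha_2=\alpha_2(q,d,\mathbf K,\mathbf f)$ are constants depending only on $q,d,\mathbf K,\mathbf f$ (and on the fixed tuning parameters $\mathfrak z$ and $\tau(\cdot)$ of the selection rule).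
   Context: **Setting.** $X_1,X_2,\dots$ are i.i.d. $\mathbb R^d$-valued random vectors, $X_i=(X_{i,1},\dots,X_{i,d})$, with density $f$ with respect to Lebesgue measure; $X^{(n)}=(X_1,\dots,X_n)$, $\mathbb P_f^{(n)}$ is its law and $\mathbb E_f^{(n)}$ the expectation. The point $x_0\in\mathbb R^d$ is fixed. For an estimator (an $X^{(n)}$-measurable map) $\widehat f$, $\mathcal R_n^{(q)}[\widehat f,f]=(\mathbb E_f^{(n)}|\widehat f(x_0)-f(x_0)|^q)^{1/q}$. $a\vee b$, $a\wedge b$ denote max and min (coordinatewise for vectors), $[a]_+=a\vee 0$; products of vectors are coordinatewise; an infimum over the empty set is $+\infty$, a supremum over the empty set is $0$. **Partitions.** $\mathcal I_d$ is the set of (non-empty) subsets of $\{1,\dots,d\}$, $\mathfrak P$ the set of all partitions of $\{1,\dots,d\}$. For $I\in\mathcal I_d$: $x_I=(x_i)_{i\in I}$, $\overline I=\{1,\dots,d\}\setminus I$, $f_I(x_I)=\int_{\mathbb R^{|\overline I|}}f(x)\,dx_{\overline I}$ (marginal density). $\mathfrak P(f)=\{\mathcal P\in\mathfrak P: f(x)=\prod_{I\in\mathcal P}f_I(x_I)\ \forall x\in\mathbb R^d\}$. For $\mathcal P,\mathcal P'\in\mathfrak P$, $\mathcal P\circ\mathcal P'=\{I\cap I'\ne\varnothing: I\in\mathcal P,I'\in\mathcal P'\}\in\mathfrak P$. **Kernel.** $\mathbf K:\mathbb R\to\mathbb R$ is a fixed symmetric bounded function with $\int\mathbf K=1$, $\mathrm{supp}(\mathbf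 K)\subseteq[-1/2,1/2]$ and $|\mathbf K(x)-\mathbf K(y)|\le L_{\mathbf K}|x-y|$ for all $x,y$, for some $L_{\mathbf K}>0$. For $I\in\mathcal I_d$, $h\in(0,1]^d$: $K^{(I)}(x_I)=\prod_{i\in I}\mathbf K(x_i)$, $V_{h_I}=\prod_{i\in I}h_i$, $K^{(I)}_{h_I}(x_I)=V_{h_I}^{-1}\prod_{i\in I}\mathbf K(x_i/h_i)$, $\widehat f^{(n)}_{h_I}(x_{0,I})=n^{-1}\sum_{i=1}^nK^{(I)}_{h_I}(X_{i,I}-x_{0,I})$, and $\widehat f^{(n)}_{(h,\mathcal P)}(x_0)=\prod_{I\in\mathcal P}\widehat f^{(n)}_{h_I}(x_{0,I})$. **Auxiliary estimators.** $\widetilde G_{h_I}(x_{0,I})=1\vee[n^{-1}\sum_{i=1}^n|K^{(I)}_{h_I}(X_{i,I}-x_{0,I})|]$; $\widehat f^{(n)}_{h_I,\eta_I}(x_{0,I})=n^{-1}\sum_{i=1}^nK^{(I)}_{h_I\vee\eta_I}(X_{i,I}-x_{0,I})$; $\widehat f^{(n)}_{(h,\mathcal P),(\eta,\mathcal P')}(x_0)=\prod_{I\in\mathcal P\circ\mathcal P'}\widehat f^{(n)}_{h_I,\eta_I}(x_{0,I})$. **Constants.** Fixed tuning parameters: $\mathfrak z>0$, $\tau(s)\in(0,1]$ ($s=1,\dots,d$), and multibandwidths $\mathfrak h^{(I)}_I=(\mathfrak h^{(I)}_i)_{i\in I}\in(0,1]^{|I|}$, $I\in\mathcal I_d$; for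 $J\subseteq I$, $\mathfrak h^{(I)}_J=(\mathfrak h^{(I)}_i)_{i\in J}$. Put $\underline\tau=\inf_{I\in\mathcal I_d}\tau(|I|)$. Let $\delta_*$ be the smallest solution of $8\pi^2\delta(1+[\ln\delta]^2)=1$, $s^*(\delta)=\frac{6/\pi^2}{1+[\ln\delta]^2}$, $$C_s=s\sup_{\delta>\delta_*}\delta^{-2}\Big[1+\ln\tfrac{9216(s+1)\delta^2}{[s^*(\delta)]^2}\Big]_++s\sup_{\delta>\delta_*}\delta^{-2}\Big[1+\ln\tfrac{9216(s+1)\delta}{s^*(\delta)}\Big]_+,$$ $C^{(q)}_{s,1}=[144s\delta_*^{-2}+5q+3+36C_s]\vee1$, $$\lambda_s^{(q)}=\Big\{\Big(10se^s+\tfrac{10seL_{\mathbf K}}{\|\mathbf K\|_\infty}\Big)\vee(48e)\Big\}\Big[\sqrt7+7\sqrt{(1+q)\|\mathbf K\|_\infty^s}\Big]C^{(q)}_{s,1}\|\mathbf K\|^s_\infty,$$ $\lambda_s^{(q)}[\mathbf K,\mathfrak z]=\{3q+sq[1\vee\mathfrak z](1+1/\underline\tau)\}^{1/2}\lambda_s^{(q)}$. Set $\lambda=\sup_{I\in\mathcal I_d}\{1\vee\lambda^{(2q)}_{|I|}[\mathbf K,\mathfrak z]\}$ and $a=\{2\lambda\sqrt{1+2q}\}^{-2}$. **Parameter set.** $V_{\max}=\sup_{\mathcal P\in\overline{\mathfrak P}}\inf_{I\in\mathcal P}V_{\mathfrak h^{(I)}_I}$. For $I\in\mathcal I_d$,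 $v^{(I)}_m=2^{-m\tau(|I|)}$ and, for integers $m\ge1$, $$\mathfrak H^{(I)}_{m,1}=\{h_I\in(0,1]^{|I|}: v^{(I)}_mV_{\mathfrak h^{(I)}_I}\le V_{h_I}\le v^{(I)}_{m-1}V_{\mathfrak h^{(I)}_I}\}\cap\prod_{i\in I}\big[\tfrac1n,(v^{(I)}_m)^{-\mathfrak z}\mathfrak h^{(I)}_i\big],$$ $$\mathfrak H^{(I)}_{m,2}=\{h_I\in(0,1]^{|I|}: v^{(I)}_mV_{\max}\le V_{h_I}\le v^{(I)}_{m-1}V_{\max}\}\cap\prod_{i\in I}\big[\tfrac1n,(v^{(I)}_m)^{-\mathfrak z}\mathfrak h^{(I)}_i\big],$$ $\mathfrak H^{(I)}=\bigcup_{m=1}^{M_n(I)}(\mathfrak H^{(I)}_{m,1}\cup\mathfrak H^{(I)}_{m,2})$, where $M_n(I)$ is the largest integer with $v^{(I)}_{M_n(I)}[V_{\mathfrak h^{(I)}_I}\wedge V_{\max}]\ge\frac{\ln n}{an}$ and $M_n(I)\le\log_2n$. Put $\mathfrak H[\mathfrak P]=\{(h,\mathcal P)\in(0,1]^d\times\mathfrak P: h_I\in\mathfrak H^{(I)}\ \forall I\in\mathcal P\}$ and $\overline{\mathfrak H}[\overline{\mathfrak P}]=(\overline{\mathfrak H}\times\overline{\mathfrak P})\cap\mathfrak H[\mathfrak P]$. **Further quantities.** $\overline G_n(x_0)=\sup_{(h,\mathcal P)\in\overline{\mathfrak H}[\overline{\mathfrak P}]}\sup_{(\eta,\mathcal P')\in\overline{\mathfrak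 H}[\overline{\mathfrak P}]}\sup_{I\in\mathcal P\circ\mathcal P'}[2\widetilde G_{h_I\vee\eta_I}(x_{0,I})]$; $\Lambda_n(x_0)=3\lambda d^2[2\overline G_n(x_0)]^{d^2-1}$; $V(h,\mathcal P)=\inf_{I\in\mathcal P}V_{h_I}$; $$\delta(h,\mathcal P)=\sup_{\mathcal P'\in\overline{\mathfrak P}}\ \sup_{I\cap I'\in\mathcal P\circ\mathcal P'}\Big[\frac{V_{\mathfrak h^{(I)}_{I\cap I'}\vee\mathfrak h^{(I')}_{I\cap I'}}}{V_{h_{I\cap I'}}}\Big]\vee\Big[\frac{V_{\max}}{\inf_{I\in\mathcal P}V_{\mathfrak h^{(I)}_I}}\Big]$$ (with $I\in\mathcal P$, $I'\in\mathcal P'$); $\widehat{\mathcal U}_{(h,\mathcal P)}(x_0)=\sqrt{\frac{[\overline G_n(x_0)]^2\{1\vee\ln\delta(h,\mathcal P)\}}{nV(h,\mathcal P)}}$. **Selection rule.** $$\widehat\Delta_{(h,\mathcal P)}(x_0)=\sup_{(\eta,\mathcal P')\in\overline{\mathfrak H}[\overline{\mathfrak P}]}\Big[\big|\widehat f^{(n)}_{(h,\mathcal P),(\eta,\mathcal P')}(x_0)-\widehat f^{(n)}_{(\eta,\mathcal P')}(x_0)\big|-\Lambda_n(x_0)\{\widehat{\mathcal U}_{(\eta,\mathcal P')}(x_0)+\widehat{\mathcal U}_{(h,\mathcal P)}(x_0)\}\Big]_+,$$ and $(\widehat h,\widehat{\mathcal P})\in\overline{\mathfrak H}[\overline{\mathfrak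 P}]$ is an $X^{(n)}$-measurable element minimizing $\widehat\Delta_{(h,\mathcal P)}(x_0)+2\Lambda_n(x_0)\widehat{\mathcal U}_{(h,\mathcal P)}(x_0)$ over $(h,\mathcal P)\in\overline{\mathfrak H}[\overline{\mathfrak P}]$. The selected estimator is $\widehat f_n(x_0)=\widehat f^{(n)}_{(\widehat h,\widehat{\mathcal P})}(x_0)$. **Density class and oracle risk.** $\mathbb F_d[\mathbf f,\overline{\mathfrak P}]$ is the set of densities $f$ on $\mathbb R^d$ with $\sup_{\mathcal P,\mathcal P'\in\overline{\mathfrak P}}\sup_{I\in\mathcal P\circ\mathcal P'}\|f_I\|_\infty\le\mathbf f$ and $\mathfrak P(f)\cap\overline{\mathfrak P}\ne\varnothing$. For $I\in\mathcal I_d$, $(h,\eta)\in(0,1]^d\times[0,1]^d$, $$\mathcal B_{h_I,\eta_I}(x_{0,I})=\int_{\mathbb R^{|I|}}K^{(I)}(u)\big[f_I(x_{0,I}+(h_I\vee\eta_I)u)-f_I(x_{0,I}+\eta_Iu)\big]du,$$ $\mathcal B_{(h,\mathcal P)}(x_0)=\sup_{\mathcal P'\in\overline{\mathfrak P}}\sup_{I\in\mathcal P\circ\mathcal P'}\sup_{\eta\in[0,1]^d}|\mathcal B_{h_I,\eta_I}(x_{0,I})|$, and $$\mathfrak R_n(f)=\inf_{(h,\mathcal P)\in\overline{\mathfrak H}[\overline{\mathfrak P}]:\ \mathcal P\in\mathfrak P(f)}\Big[\mathcal B_{(h,\mathcal P)}(x_0)+\sqrt{\tfrac{1\vee\ln\delta(h,\mathcal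 P)}{nV(h,\mathcal P)}}\Big].$$ *)

theory Defs
  imports "HOL-Probability.Probability"
begin

section \<open>Kernel and numerical constants\<close>

definition kde_kernel :: "(real \<Rightarrow> real) \<Rightarrow> real \<Rightarrow> bool" where
  "kde_kernel K L \<longleftrightarrow>
     (\<forall>x. K (- x) = K x) \<and> bounded (range K) \<and>
     has_bochner_integral lborel K 1 \<and>
     closure {x. K x \<noteq> 0} \<subseteq> {-1/2..1/2} \<and>
     0 < L \<and> L-lipschitz_on UNIV K"

definition kernel_sup :: "(real \<Rightarrow> real) \<Rightarrow> real" where
  "kernel_sup K = (SUP x. \<bar>K x\<bar>)"

text \<open>The constraint \<open>0 < \<delta>\<close> is essential: the total function \<^const>\<open>ln\<close> has junk values off the
  positive half-line.\<close>

definition delta_star :: real where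
  "delta_star = (LEAST \<delta>::real. 0 < \<delta> \<and> 8 * pi\<^sup>2 * \<delta> * (1 + (ln \<delta>)\<^sup>2) = 1)"

definition s_star :: "real \<Rightarrow> real" where
  "s_star \<delta> = (6 / pi\<^sup>2) / (1 + (ln \<delta>)\<^sup>2)"

definition C_entropy :: "nat \<Rightarrow> real" where
  "C_entropy s =
     real s * (SUP \<delta>\<in>{delta_star<..}.
       max 0 (1 + ln (9216 * (real s + 1) * \<delta>\<^sup>2 / (s_star \<delta>)\<^sup>2)) / \<delta>\<^sup>2) +
     real s * (SUP \<delta>\<in>{delta_star<..}.
       max 0 (1 + ln (9216 * (real s + 1) * \<delta> / s_star \<delta>)) / \<delta>\<^sup>2)"

definition C_one :: "real \<Rightarrow> nat \<Rightarrow> real" where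
  "C_one q s = max 1 (144 * real s / delta_star\<^sup>2 + 5 * q + 3 + 36 * C_entropy s)"

definition lam_base :: "(real \<Rightarrow> real) \<Rightarrow> real \<Rightarrow> real \<Rightarrow> nat \<Rightarrow> real" where
  "lam_base K L q s =
     max (10 * real s * exp (real s) + 10 * real s * exp 1 * L / kernel_sup K) (48 * exp 1) *
     (sqrt 7 + 7 * sqrt ((1 + q) * kernel_sup K ^ s)) * C_one q s * kernel_sup K ^ s"

text \<open>In the next three definitions \<open>d\<close> is the dimension; a quantity depending on a non-empty
  \<open>I \<subseteq> {1,\<dots>,d}\<close> only through its size is indexed by \<open>s = |I| \<in> {1..d}\<close>.\<close>

definition lam_dim :: "(real \<Rightarrow> real) \<Rightarrow> real \<Rightarrow> real \<Rightarrow> (nat \<Rightarrow> real) \<Rightarrow> nat \<Rightarrow> real \<Rightarrow> nat \<Rightarrow> real" where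
  "lam_dim K L \<zz> \<tau> d q s =
     sqrt (3 * q + real s * q * max 1 \<zz> * (1 + 1 / (INF r\<in>{1..d}. \<tau> r))) * lam_base K L q s"

definition lam :: "(real \<Rightarrow> real) \<Rightarrow> real \<Rightarrow> real \<Rightarrow> (nat \<Rightarrow> real) \<Rightarrow> nat \<Rightarrow> real \<Rightarrow> real" where
  "lam K L \<zz> \<tau> d q = (SUP s\<in>{1..d}. max 1 (lam_dim K L \<zz> \<tau> d (2 * q) s))"

definition a_const :: "(real \<Rightarrow> real) \<Rightarrow> real \<Rightarrow> real \<Rightarrow> (nat \<Rightarrow> real) \<Rightarrow> nat \<Rightarrow> real \<Rightarrow> real" where
  "a_const K L \<zz> \<tau> d q = 1 / (2 * lam K L \<zz> \<tau> d q * sqrt (1 + 2 * q))\<^sup>2"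


section \<open>Partitions, marginals and the density class\<close>

text \<open>Coordinates are indexed by a finite type \<open>'d\<close>, so that \<open>d = CARD('d)\<close>. A partial vector
  \<open>x\<^sub>I\<close> is represented by any full vector \<open>x :: real ^ 'd\<close> with these coordinates: every
  definition below that takes \<open>I\<close> and a vector reads only the coordinates in \<open>I\<close>.\<close>

definition vol :: "real ^ 'd::finite \<Rightarrow> 'd set \<Rightarrow> real" where
  "vol h I = (\<Prod>i\<in>I. h $ i)"

definition unit_box :: "(real ^ 'd::finite) set" where
  "unit_box = {h. \<forall>i. 0 < h $ i \<and> h $ i \<le> 1}"

definition closed_unit_box :: "(real ^ 'd::finite) set" where
  "closed_unit_box = {h. \<forall>i. 0 \<le> h $ i \<and> h $ i \<le> 1}"

definition meet :: "'d set set \<Rightarrow> 'd set set \<Rightarrow> 'd set set" where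
  "meet P P' = {I \<inter> I' | I I'. I \<in> P \<and> I' \<in> P' \<and> I \<inter> I' \<noteq> {}}"

definition is_density :: "(real ^ 'd::finite \<Rightarrow> real) \<Rightarrow> bool" where
  "is_density f \<longleftrightarrow>
     f \<in> borel_measurable borel \<and> (\<forall>x. 0 \<le> f x) \<and> (\<integral>\<^sup>+x. ennreal (f x) \<partial>lborel) = 1"

text \<open>The marginal is \<^typ>\<open>ennreal\<close>-valued because the integral of a fixed version of a density
  over a section may be infinite.\<close>

definition marginal :: "(real ^ 'd::finite \<Rightarrow> real) \<Rightarrow> 'd set \<Rightarrow> real ^ 'd \<Rightarrow> ennreal" where
  "marginal f I x =
     (\<integral>\<^sup>+y. ennreal (f (\<chi> i. if i \<in> I then x $ i else y i)) \<partial>(\<Pi>\<^sub>M i\<in>-I. lborel))"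

definition indep_partitions :: "(real ^ 'd::finite \<Rightarrow> real) \<Rightarrow> 'd set set set" where
  "indep_partitions f =
     {P. partition_on UNIV P \<and> (\<forall>x. ennreal (f x) = (\<Prod>I\<in>P. marginal f I x))}"

text \<open>\<open>\<parallel>f\<^sub>I\<parallel>\<^sub>\<infinity>\<close> is the pointwise supremum, not the essential one: values of densities at
  individual points matter throughout.\<close>

definition density_class ::
  "real \<Rightarrow> 'd set set set \<Rightarrow> (real ^ 'd::finite \<Rightarrow> real) set" where
  "density_class F \<PP> =
     {f. is_density f \<and>
         (SUP P\<in>\<PP>. SUP P'\<in>\<PP>. SUP I\<in>meet P P'. SUP x. marginal f I x) \<le> ennreal F \<and>
         indep_partitions f \<inter> \<PP> \<noteq> {}}"


section \<open>Samples and risk\<close>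

text \<open>A sample is a function on \<open>{1..n}\<close>; an estimator at \<open>x0\<close> is a real function of the sample.\<close>

definition sample_law :: "(real ^ 'd::finite \<Rightarrow> real) \<Rightarrow> nat \<Rightarrow> (nat \<Rightarrow> real ^ 'd) measure" where
  "sample_law f n = (\<Pi>\<^sub>M i\<in>{1..n}. density lborel (\<lambda>x. ennreal (f x)))"

definition risk ::
  "real \<Rightarrow> nat \<Rightarrow> real ^ 'd::finite \<Rightarrow> (real ^ 'd \<Rightarrow> real) \<Rightarrow> ((nat \<Rightarrow> real ^ 'd) \<Rightarrow> real) \<Rightarrow> ennreal" where
  "risk q n x0 f est =
     (if integrable (sample_law f n) (\<lambda>X. \<bar>est X - f x0\<bar> powr q)
      then ennreal ((\<integral>X. \<bar>est X - f x0\<bar> powr q \<partial>sample_law f n) powr (1 / q))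
      else \<infinity>)"


section \<open>The selection rule\<close>

text \<open>\<open>\<hh> I\<close> is the multibandwidth attached to \<open>I\<close> (only coordinates in \<open>I\<close> are used);
  \<open>\<HH>\<close> and \<open>\<PP>\<close> are the given sets of multibandwidths and of partitions. Real-valued
  suprema below are over non-empty bounded sets once the set \<open>params\<close> is non-empty, because
  bandwidths in it are at least \<open>1/n\<close>.\<close>

locale selection_rule =
  fixes K :: "real \<Rightarrow> real" and L \<zz> :: real and \<tau> :: "nat \<Rightarrow> real" and q :: real
    and \<hh> :: "'d::finite set \<Rightarrow> real ^ 'd" and x0 :: "real ^ 'd" and n :: nat
    and \<HH> :: "(real ^ 'd) set" and \<PP> :: "'d set set set"
begin

definition kernel_scaled :: "'d set \<Rightarrow> real ^ 'd \<Rightarrow> real ^ 'd \<Rightarrow> real" where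
  "kernel_scaled I h x = (\<Prod>i\<in>I. K (x $ i / h $ i)) / vol h I"

definition kde :: "'d set \<Rightarrow> real ^ 'd \<Rightarrow> (nat \<Rightarrow> real ^ 'd) \<Rightarrow> real" where
  "kde I h X = (\<Sum>i=1..n. kernel_scaled I h (X i - x0)) / real n"

definition estimator :: "real ^ 'd \<Rightarrow> 'd set set \<Rightarrow> (nat \<Rightarrow> real ^ 'd) \<Rightarrow> real" where
  "estimator h P X = (\<Prod>I\<in>P. kde I h X)"

text \<open>On \<^typ>\<open>real ^ 'd\<close>, \<^const>\<open>sup\<close> is the coordinatewise maximum.\<close>

definition estimator_aux ::
  "real ^ 'd \<Rightarrow> 'd set set \<Rightarrow> real ^ 'd \<Rightarrow> 'd set set \<Rightarrow> (nat \<Rightarrow> real ^ 'd) \<Rightarrow> real" where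
  "estimator_aux h P \<eta> P' X = (\<Prod>I\<in>meet P P'. kde I (sup h \<eta>) X)"

definition G_tilde :: "'d set \<Rightarrow> real ^ 'd \<Rightarrow> (nat \<Rightarrow> real ^ 'd) \<Rightarrow> real" where
  "G_tilde I h X = max 1 ((\<Sum>i=1..n. \<bar>kernel_scaled I h (X i - x0)\<bar>) / real n)"

definition V_max :: real where
  "V_max = (SUP P\<in>\<PP>. INF I\<in>P. vol (\<hh> I) I)"

definition v :: "'d set \<Rightarrow> int \<Rightarrow> real" where
  "v I m = 2 powr (- (of_int m * \<tau> (card I)))"

text \<open>\<open>band I m W\<close> is \<open>\<HH>\<^bsub>m,1\<^esub>\<close> for \<open>W = vol (\<hh> I) I\<close> and \<open>\<HH>\<^bsub>m,2\<^esub>\<close>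
  for \<open>W = V_max\<close>.\<close>

definition band :: "'d set \<Rightarrow> int \<Rightarrow> real \<Rightarrow> (real ^ 'd) set" where
  "band I m W =
     {h. (\<forall>i\<in>I. 0 < h $ i \<and> h $ i \<le> 1) \<and>
         v I m * W \<le> vol h I \<and> vol h I \<le> v I (m - 1) * W \<and>
         (\<forall>i\<in>I. 1 / real n \<le> h $ i \<and> h $ i \<le> v I m powr (- \<zz>) * \<hh> I $ i)}"

text \<open>The integer \<open>M I\<close> may be non-positive, in which case \<open>bandwidths I\<close> is empty.\<close>

definition M :: "'d set \<Rightarrow> int" where
  "M I = (GREATEST m::int.
     v I m * min (vol (\<hh> I) I) V_max \<ge> ln (real n) / (a_const K L \<zz> \<tau> CARD('d) q * real n) \<and>
     of_int m \<le> log 2 (real n))"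

definition bandwidths :: "'d set \<Rightarrow> (real ^ 'd) set" where
  "bandwidths I = (\<Union>m\<in>{1..M I}. band I m (vol (\<hh> I) I) \<union> band I m V_max)"

definition all_params :: "((real ^ 'd) \<times> 'd set set) set" where
  "all_params = {(h, P). h \<in> unit_box \<and> partition_on UNIV P \<and> (\<forall>I\<in>P. h \<in> bandwidths I)}"

definition params :: "((real ^ 'd) \<times> 'd set set) set" where
  "params = (\<HH> \<times> \<PP>) \<inter> all_params"

definition G_bar :: "(nat \<Rightarrow> real ^ 'd) \<Rightarrow> real" where
  "G_bar X = (SUP (h, P)\<in>params. SUP (\<eta>, P')\<in>params. SUP I\<in>meet P P'. 2 * G_tilde I (sup h \<eta>) X)"

definition Lambda :: "(nat \<Rightarrow> real ^ 'd) \<Rightarrow> real" where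
  "Lambda X = 3 * lam K L \<zz> \<tau> CARD('d) q * (real CARD('d))\<^sup>2 * (2 * G_bar X) ^ ((CARD('d))\<^sup>2 - 1)"

definition V :: "real ^ 'd \<Rightarrow> 'd set set \<Rightarrow> real" where
  "V h P = (INF I\<in>P. vol h I)"

definition delta :: "real ^ 'd \<Rightarrow> 'd set set \<Rightarrow> real" where
  "delta h P =
     (SUP (P', I, I')\<in>{(P', I, I'). P' \<in> \<PP> \<and> I \<in> P \<and> I' \<in> P' \<and> I \<inter> I' \<noteq> {}}.
        max (vol (sup (\<hh> I) (\<hh> I')) (I \<inter> I') / vol h (I \<inter> I'))
            (V_max / (INF J\<in>P. vol (\<hh> J) J)))"

definition U_hat :: "real ^ 'd \<Rightarrow> 'd set set \<Rightarrow> (nat \<Rightarrow> real ^ 'd) \<Rightarrow> real" where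
  "U_hat h P X = sqrt ((G_bar X)\<^sup>2 * max 1 (ln (delta h P)) / (real n * V h P))"

definition Delta_hat :: "real ^ 'd \<Rightarrow> 'd set set \<Rightarrow> (nat \<Rightarrow> real ^ 'd) \<Rightarrow> real" where
  "Delta_hat h P X =
     (SUP (\<eta>, P')\<in>params.
        max 0 (\<bar>estimator_aux h P \<eta> P' X - estimator \<eta> P' X\<bar>
               - Lambda X * (U_hat \<eta> P' X + U_hat h P X)))"

definition criterion :: "real ^ 'd \<Rightarrow> 'd set set \<Rightarrow> (nat \<Rightarrow> real ^ 'd) \<Rightarrow> real" where
  "criterion h P X = Delta_hat h P X + 2 * Lambda X * U_hat h P X"

definition selector :: "((nat \<Rightarrow> real ^ 'd) \<Rightarrow> (real ^ 'd) \<times> 'd set set) \<Rightarrow> bool" where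
  "selector sel \<longleftrightarrow>
     sel \<in> (\<Pi>\<^sub>M i\<in>{1..n}. borel) \<rightarrow>\<^sub>M borel \<Otimes>\<^sub>M count_space UNIV \<and>
     (\<forall>X\<in>space (\<Pi>\<^sub>M i\<in>{1..n}. borel).
        sel X \<in> params \<and>
        (\<forall>(h, P)\<in>params. criterion (fst (sel X)) (snd (sel X)) X \<le> criterion h P X))"

definition selected_estimator ::
  "((nat \<Rightarrow> real ^ 'd) \<Rightarrow> (real ^ 'd) \<times> 'd set set) \<Rightarrow> (nat \<Rightarrow> real ^ 'd) \<Rightarrow> real" where
  "selected_estimator sel X = estimator (fst (sel X)) (snd (sel X)) X"


subsection \<open>The oracle risk\<close>

definition bias :: "(real ^ 'd \<Rightarrow> real) \<Rightarrow> 'd set \<Rightarrow> real ^ 'd \<Rightarrow> real ^ 'd \<Rightarrow> real" where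
  "bias f I h \<eta> =
     (\<integral>u. (\<Prod>i\<in>I. K (u i)) *
         (enn2real (marginal f I (\<chi> i. x0 $ i + sup h \<eta> $ i * u i)) -
          enn2real (marginal f I (\<chi> i. x0 $ i + \<eta> $ i * u i)))
      \<partial>(\<Pi>\<^sub>M i\<in>I. lborel))"

definition bias_sup :: "(real ^ 'd \<Rightarrow> real) \<Rightarrow> real ^ 'd \<Rightarrow> 'd set set \<Rightarrow> ennreal" where
  "bias_sup f h P =
     (SUP P'\<in>\<PP>. SUP I\<in>meet P P'. SUP \<eta>\<in>closed_unit_box. ennreal \<bar>bias f I h \<eta>\<bar>)"

text \<open>In \<^typ>\<open>ennreal\<close> the infimum over the empty set is \<open>\<infinity>\<close>.\<close>

definition oracle_risk :: "(real ^ 'd \<Rightarrow> real) \<Rightarrow> ennreal" where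
  "oracle_risk f =
     (INF (h, P)\<in>{(h, P)\<in>params. P \<in> indep_partitions f}.
        bias_sup f h P + ennreal (sqrt (max 1 (ln (delta h P)) / (real n * V h P))))"

end

end

theory Submission
  imports Defs
begin

text \<open>On a sample where all empirical errors are controlled, comparing the selected estimator with
  any admissible one through the auxiliary estimators, which are symmetric in the two parameters,
  bounds its error by twice the selection criterion plus the error of the competitor; independence
  of the blocks turns the bias of the auxiliary estimators into a sum of terms
  \<open>bias f J h \<eta>\<close>.

  What remains is a deviation bound, uniform over the bandwidths \<open>w = sup h \<eta>\<close>, at the
  level \<open>sqrt (l / (n * vol w J))\<close>, where \<open>l\<close> is the larger of the two logarithmic costs
  \<open>1 \<or> ln \<delta>\<close>. The constraints defining the parameter set confine the bandwidths of cost at most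
  \<open>l\<close> to polynomially many (in \<open>l\<close>) cells of bounded logarithmic size. On each cell
  chaining bounds the moment of order \<open>A * l\<close> of the supremum, so beyond the threshold the
  contribution is \<open>exp (- A * l)\<close>, which beats both the number of cells and the loss
  \<open>exp (2 * l)\<close> in replacing \<open>vol w J\<close> by \<open>V_max\<close>. The numerical constants in
  \<open>lam\<close> are far larger than what this crude chaining needs. The same bound for the absolute
  kernel shows that \<open>G_bar\<close> is comparable with its deterministic counterpart outside an event of
  probability \<open>n powr (- A)\<close> up to logarithms, on which the trivial bound
  \<open>n ^ d\<close> for the error suffices.\<close>

section \<open>Moments and chaining for empirical means\<close>

text \<open>The suprema run over uncountable sets of bandwidths. Every uniform bound is therefore
  stated as the existence of a measurable majorant with small integral, and moments are used instead
  of tail probabilities: sums of majorants over cells and levels are majorants again. The lower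
  bound ln n / (a n) on volumes, built into the parameter set, keeps moments of order
  \<open>A * l\<close> in the Gaussian regime of Bernstein's inequality. The summands of
  \<open>A\<close> have separate tasks: \<open>8 * d\<close> outweighs the entropy of the chaining,
  the part proportional to \<open>q\<close> pays for the power of n lost on the exceptional event
  and for replacing volumes by \<open>V_max\<close>, and the final 2 pays for the number of cells
  and the summation over l. The threshold is three times the chaining bound; exp (- A l) arises as a
  bound for (1 / 3)^(A l). Bandwidths, n and f must not enter the final constants, so every
  data-dependent or f-dependent level is eventually replaced by a bound in \<open>F\<close>,
  \<open>B\<close> and \<open>d\<close>.\<close>

lemma exp_le_one_plus_square:
  fixes x :: real
  assumes "\<bar>x\<bar> \<le> 1"
  shows "exp x \<le> 1 + x + x\<^sup>2"
proof (cases "0 \<le> x")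
  case True
  then show ?thesis using assms exp_bound[of x] by simp
next
  case False
  define y where "y = - x"
  have y: "0 < y" "y \<le> 1" using False assms by (auto simp: y_def)
  have "exp x = 1 / exp y" by (simp add: y_def exp_minus inverse_eq_divide)
  also have "\<dots> \<le> 1 / (1 + y)"
    using y exp_ge_add_one_self[of y] by (intro divide_left_mono) auto
  also have "\<dots> \<le> 1 - y + y\<^sup>2"
  proof -
    have "1 \<le> (1 - y + y\<^sup>2) * (1 + y)"
      using y by (simp add: algebra_simps power2_eq_square)
    then show ?thesis using y by (simp add: pos_divide_le_eq)
  qed
  finally show ?thesis by (simp add: y_def)
qed

lemma (in prob_space) integrable_of_bounded:
  fixes g :: "'a \<Rightarrow> real"
  assumes "g \<in> borel_measurable M" "\<And>x. \<bar>g x\<bar> \<le> b"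
  shows "integrable M g"
  by (rule integrable_const_bound[where B = b]) (use assms in auto)

text \<open>The mean is bounded by \<open>b\<close> too, so the centred variable is at most
  \<open>2 * b\<close> and the condition on \<theta> keeps the exponent in [-1, 1], where exp x is
  at most 1 + x + x^2. The linear term integrates to zero; dropping the squared mean leaves the
  second moment, which is easily bounded by a sup norm times an L1 norm.\<close>

lemma (in prob_space) centered_mgf_bound:
  fixes g :: "'a \<Rightarrow> real"
  assumes [measurable]: "g \<in> borel_measurable M"
    and bnd: "\<And>x. \<bar>g x\<bar> \<le> b" and v: "(\<integral>x. (g x)\<^sup>2 \<partial>M) \<le> v"
    and \<theta>: "\<bar>\<theta>\<bar> * (2 * b) \<le> 1"
  shows "(\<integral>\<^sup>+x. ennreal (exp (\<theta> * (g x - (\<integral>y. g y \<partial>M)))) \<partial>M) \<le> ennreal (exp (\<theta>\<^sup>2 * v))"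
proof -
  define m where "m = (\<integral>y. g y \<partial>M)"
  have ig: "integrable M g" by (rule integrable_of_bounded[OF _ bnd]) simp
  have b0: "0 \<le> b" using bnd[of undefined] by linarith
  have ig2: "integrable M (\<lambda>x. (g x)\<^sup>2)"
    by (rule integrable_of_bounded[where b = "b\<^sup>2"]) (use bnd in \<open>auto simp: abs_le_square_iff[symmetric] b0\<close>)
  have mb: "\<bar>m\<bar> \<le> b"
  proof -
    have "\<bar>m\<bar> \<le> (\<integral>y. \<bar>g y\<bar> \<partial>M)" unfolding m_def by (rule integral_abs_bound)
    also have "\<dots> \<le> (\<integral>y. b \<partial>M)" using ig bnd by (intro integral_mono) auto
    finally show ?thesis by (simp add: prob_space)
  qed
  have Yb: "\<bar>\<theta> * (g x - m)\<bar> \<le> 1" for x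
  proof -
    have "\<bar>\<theta> * (g x - m)\<bar> = \<bar>\<theta>\<bar> * \<bar>g x - m\<bar>" by (simp add: abs_mult)
    also have "\<dots> \<le> \<bar>\<theta>\<bar> * (2 * b)" using bnd[of x] mb by (intro mult_left_mono) linarith+
    finally show ?thesis using \<theta> by simp
  qed
  have ie: "integrable M (\<lambda>x. exp (\<theta> * (g x - m)))"
    by (rule integrable_of_bounded[where b = "exp 1"]) (use Yb in \<open>auto simp: abs_le_iff\<close>)
  have "(\<integral>x. exp (\<theta> * (g x - m)) \<partial>M)
      \<le> (\<integral>x. 1 + \<theta> * (g x - m) + \<theta>\<^sup>2 * ((g x)\<^sup>2 - 2 * m * g x + m\<^sup>2) \<partial>M)"
  proof (rule integral_mono[OF ie])
    show "integrable M (\<lambda>x. 1 + \<theta> * (g x - m) + \<theta>\<^sup>2 * ((g x)\<^sup>2 - 2 * m * g x + m\<^sup>2))"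
      using ig ig2 by simp
    show "exp (\<theta> * (g x - m)) \<le> 1 + \<theta> * (g x - m) + \<theta>\<^sup>2 * ((g x)\<^sup>2 - 2 * m * g x + m\<^sup>2)" for x
    proof -
      have "(\<theta> * (g x - m))\<^sup>2 = \<theta>\<^sup>2 * ((g x)\<^sup>2 - 2 * m * g x + m\<^sup>2)"
        by (simp add: power2_eq_square algebra_simps)
      then show ?thesis using exp_le_one_plus_square[OF Yb[of x]] by simp
    qed
  qed
  also have "\<dots> = 1 + \<theta>\<^sup>2 * ((\<integral>x. (g x)\<^sup>2 \<partial>M) - m\<^sup>2)"
    using ig ig2 by (simp add: prob_space m_def power2_eq_square)
  also have "\<dots> \<le> 1 + \<theta>\<^sup>2 * v"
    using v by (intro add_left_mono mult_left_mono) (auto intro: order_trans[rotated])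
  also have "\<dots> \<le> exp (\<theta>\<^sup>2 * v)" by (rule exp_ge_add_one_self)
  finally have "(\<integral>x. exp (\<theta> * (g x - m)) \<partial>M) \<le> exp (\<theta>\<^sup>2 * v)" .
  then show ?thesis
    unfolding m_def[symmetric] by (subst nn_integral_eq_integral[OF ie]) auto
qed

text \<open>A single term of the exponential series, combined with
  \<open>fact p \<le> p ^ p\<close>; it converts exponential moments into power moments.\<close>

lemma power_le_power_mult_exp:
  fixes x :: real
  assumes "0 \<le> x" "1 \<le> p"
  shows "x ^ p \<le> real p ^ p * exp x"
proof -
  have "x ^ p / fact p \<le> exp x"
  proof -
    have "(\<Sum>k\<in>{p}. x ^ k / fact k) \<le> (\<Sum>k. x ^ k / fact k)"
      using assms summable_exp[of x] by (intro sum_le_suminf) (auto simp: divide_inverse mult.commute)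
    then show ?thesis by (simp add: exp_def divide_inverse scaleR_conv_of_real mult.commute)
  qed
  then have "x ^ p \<le> fact p * exp x" by (simp add: pos_divide_le_eq mult.commute)
  also have "\<dots> \<le> real p ^ p * exp x"
  proof (rule mult_right_mono)
    show "(fact p :: real) \<le> real p ^ p" using fact_le_power[of p, where 'a = real] by simp
  qed simp
  finally show ?thesis .
qed

definition emp_dev :: "'a measure \<Rightarrow> nat \<Rightarrow> ('a \<Rightarrow> real) \<Rightarrow> (nat \<Rightarrow> 'a) \<Rightarrow> real" where
  "emp_dev \<mu> n g X = (\<Sum>i=1..n. g (X i)) / real n - (\<integral>x. g x \<partial>\<mu>)"

lemma emp_dev_measurable [measurable (raw)]:
  assumes [measurable]: "g \<in> borel_measurable \<mu>"
  shows "emp_dev \<mu> n g \<in> borel_measurable (\<Pi>\<^sub>M i\<in>{1..n}. \<mu>)"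
  unfolding emp_dev_def[abs_def] by measurable

lemma emp_dev_mgf:
  fixes g :: "'a \<Rightarrow> real"
  assumes \<mu>: "prob_space \<mu>" and [measurable]: "g \<in> borel_measurable \<mu>"
    and bnd: "\<And>x. \<bar>g x\<bar> \<le> b" and v: "(\<integral>x. (g x)\<^sup>2 \<partial>\<mu>) \<le> v"
    and \<theta>: "\<bar>\<theta>\<bar> * (2 * b) \<le> 1" and n: "1 \<le> n"
  shows "(\<integral>\<^sup>+X. ennreal (exp (\<theta> * (real n * emp_dev \<mu> n g X))) \<partial>(\<Pi>\<^sub>M i\<in>{1..n}. \<mu>))
     \<le> ennreal (exp (real n * (\<theta>\<^sup>2 * v)))"
proof -
  interpret prob_space \<mu> by fact
  interpret P: product_sigma_finite "\<lambda>_::nat. \<mu>" by unfold_locales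
  have eq: "ennreal (exp (\<theta> * (real n * emp_dev \<mu> n g X)))
      = (\<Prod>i\<in>{1..n}. ennreal (exp (\<theta> * (g (X i) - (\<integral>y. g y \<partial>\<mu>)))))" for X
  proof -
    have "\<theta> * (real n * emp_dev \<mu> n g X) = (\<Sum>i\<in>{1..n}. \<theta> * (g (X i) - (\<integral>y. g y \<partial>\<mu>)))"
      using n by (simp add: emp_dev_def sum_subtractf sum_distrib_left[symmetric] algebra_simps)
    then show ?thesis by (simp add: exp_sum prod_ennreal)
  qed
  have "(\<integral>\<^sup>+X. ennreal (exp (\<theta> * (real n * emp_dev \<mu> n g X))) \<partial>(\<Pi>\<^sub>M i\<in>{1..n}. \<mu>))
     = (\<Prod>i\<in>{1..n}. \<integral>\<^sup>+x. ennreal (exp (\<theta> * (g x - (\<integral>y. g y \<partial>\<mu>)))) \<partial>\<mu>)"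
    unfolding eq by (subst P.product_nn_integral_prod) auto
  also have "\<dots> \<le> (\<Prod>i\<in>{1..n}. ennreal (exp (\<theta>\<^sup>2 * v)))"
    by (intro prod_mono_ennreal centered_mgf_bound[OF _ bnd v \<theta>]) simp
  also have "\<dots> = ennreal (exp (real n * (\<theta>\<^sup>2 * v)))"
    by (simp add: prod_ennreal exp_of_nat_mult ennreal_power)
  finally show ?thesis .
qed

text \<open>Bernstein's inequality in moment form: \<open>power_le_power_mult_exp\<close> is applied
  to \<theta> n |emp_dev|, and the exponential of an absolute value is at most the sum over both
  signs.\<close>

lemma emp_dev_moment:
  fixes g :: "'a \<Rightarrow> real"
  assumes \<mu>: "prob_space \<mu>" and [measurable]: "g \<in> borel_measurable \<mu>"
    and bnd: "\<And>x. \<bar>g x\<bar> \<le> b" and v: "(\<integral>x. (g x)\<^sup>2 \<partial>\<mu>) \<le> v"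
    and b: "0 < b" and n: "1 \<le> n" and p: "1 \<le> p"
  shows "(\<integral>\<^sup>+X. ennreal (\<bar>emp_dev \<mu> n g X\<bar> ^ p) \<partial>(\<Pi>\<^sub>M i\<in>{1..n}. \<mu>))
     \<le> ennreal ((6 * (sqrt (real p * v / real n) + 2 * real p * b / real n)) ^ p)"
proof -
  have v0: "0 \<le> v" using v by (rule order_trans[rotated]) simp
  \<comment> \<open>The two summands enforce the two constraints on \<theta> = 1 / D: the first
    gives n \<theta>^2 v \<le> p, so the exponential moments are at most exp p, and the second gives
    2 b \<theta> \<le> 1. Moreover p / (\<theta> n) is exactly the sum of the Gaussian and the
    linear term in the claim.\<close>
  define D where "D = sqrt (real n * v / real p) + 2 * b"
  define \<theta> where "\<theta> = 1 / D"
  have D: "0 < D" unfolding D_def using b v0 by (simp add: add_nonneg_pos)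
  have \<theta>0: "0 < \<theta>" using D by (simp add: \<theta>_def)
  have \<theta>b: "\<theta> * (2 * b) \<le> 1"
  proof -
    have "2 * b \<le> D" using v0 by (simp add: D_def)
    then show ?thesis using D by (simp add: \<theta>_def)
  qed
  have \<theta>v: "real n * (\<theta>\<^sup>2 * v) \<le> real p"
  proof -
    have "real n * v / real p = (sqrt (real n * v / real p))\<^sup>2" using v0 by simp
    also have "\<dots> \<le> D\<^sup>2" unfolding D_def using b v0 by (intro power_mono) auto
    finally have "real n * v \<le> real p * D\<^sup>2" using p by (simp add: pos_divide_le_eq mult.commute)
    then show ?thesis using D by (simp add: \<theta>_def power_divide pos_divide_le_eq)
  qed
  have pt: "ennreal (\<bar>emp_dev \<mu> n g X\<bar> ^ p) \<le> ennreal ((real p / (\<theta> * real n)) ^ p) *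
       (ennreal (exp (\<theta> * (real n * emp_dev \<mu> n g X))) + ennreal (exp ((-\<theta>) * (real n * emp_dev \<mu> n g X))))" for X
  proof -
    let ?z = "emp_dev \<mu> n g X"
    have "(\<theta> * real n * \<bar>?z\<bar>) ^ p \<le> real p ^ p * exp (\<theta> * real n * \<bar>?z\<bar>)"
      using p \<theta>0 by (intro power_le_power_mult_exp) auto
    also have "\<dots> \<le> real p ^ p * (exp (\<theta> * (real n * ?z)) + exp ((-\<theta>) * (real n * ?z)))"
      by (intro mult_left_mono) (cases "0 \<le> ?z"; simp add: mult.assoc)+
    finally have "\<bar>?z\<bar> ^ p * (\<theta> * real n) ^ p \<le> real p ^ p * (exp (\<theta> * (real n * ?z)) + exp ((-\<theta>) * (real n * ?z)))"
      by (simp add: power_mult_distrib mult_ac)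
    moreover have "0 < (\<theta> * real n) ^ p" using \<theta>0 n by simp
    ultimately have "\<bar>?z\<bar> ^ p \<le> real p ^ p * (exp (\<theta> * (real n * ?z)) + exp ((-\<theta>) * (real n * ?z))) / (\<theta> * real n) ^ p"
      by (simp only: pos_le_divide_eq)
    also have "\<dots> = (real p / (\<theta> * real n)) ^ p * (exp (\<theta> * (real n * ?z)) + exp ((-\<theta>) * (real n * ?z)))"
      by (simp add: power_divide)
    finally show ?thesis
      using \<theta>0 by (simp add: ennreal_plus[symmetric] ennreal_mult[symmetric] ennreal_leI del: ennreal_plus)
  qed
  have "(\<integral>\<^sup>+X. ennreal (\<bar>emp_dev \<mu> n g X\<bar> ^ p) \<partial>(\<Pi>\<^sub>M i\<in>{1..n}. \<mu>))
     \<le> (\<integral>\<^sup>+X. ennreal ((real p / (\<theta> * real n)) ^ p) *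
       (ennreal (exp (\<theta> * (real n * emp_dev \<mu> n g X))) + ennreal (exp ((-\<theta>) * (real n * emp_dev \<mu> n g X)))) \<partial>(\<Pi>\<^sub>M i\<in>{1..n}. \<mu>))"
    by (intro nn_integral_mono pt)
  also have "\<dots> = ennreal ((real p / (\<theta> * real n)) ^ p) *
     ((\<integral>\<^sup>+X. ennreal (exp (\<theta> * (real n * emp_dev \<mu> n g X))) \<partial>(\<Pi>\<^sub>M i\<in>{1..n}. \<mu>)) +
      (\<integral>\<^sup>+X. ennreal (exp ((-\<theta>) * (real n * emp_dev \<mu> n g X))) \<partial>(\<Pi>\<^sub>M i\<in>{1..n}. \<mu>)))"
  proof -
    have "(\<lambda>X. ennreal (exp (c * (real n * emp_dev \<mu> n g X)))) \<in> borel_measurable (\<Pi>\<^sub>M i\<in>{1..n}. \<mu>)" for c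
      by measurable
    from this[of \<theta>] this[of "-\<theta>"] show ?thesis
      by (subst nn_integral_cmult) (auto simp: nn_integral_add)
  qed
  also have "\<dots> \<le> ennreal ((real p / (\<theta> * real n)) ^ p) * (ennreal (exp (real p)) + ennreal (exp (real p)))"
  proof (intro mult_left_mono add_mono)
    have *: "ennreal (exp (real n * (\<theta>\<^sup>2 * v))) \<le> ennreal (exp (real p))" using \<theta>v by (intro ennreal_leI) simp
    show "(\<integral>\<^sup>+X. ennreal (exp (\<theta> * (real n * emp_dev \<mu> n g X))) \<partial>(\<Pi>\<^sub>M i\<in>{1..n}. \<mu>)) \<le> ennreal (exp (real p))"
      by (rule order_trans[OF emp_dev_mgf[OF \<mu> _ bnd v] *]) (use \<theta>b \<theta>0 n in auto)
    have "(\<integral>\<^sup>+X. ennreal (exp ((-\<theta>) * (real n * emp_dev \<mu> n g X))) \<partial>(\<Pi>\<^sub>M i\<in>{1..n}. \<mu>)) \<le> ennreal (exp (real n * ((-\<theta>)\<^sup>2 * v)))"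
      by (rule emp_dev_mgf[OF \<mu> _ bnd v]) (use \<theta>b \<theta>0 n in auto)
    with * show "(\<integral>\<^sup>+X. ennreal (exp ((-\<theta>) * (real n * emp_dev \<mu> n g X))) \<partial>(\<Pi>\<^sub>M i\<in>{1..n}. \<mu>)) \<le> ennreal (exp (real p))"
      by (simp add: order_trans)
  qed simp
  also have "\<dots> = ennreal (2 * exp (real p) * (real p / (\<theta> * real n)) ^ p)"
    using \<theta>0 by (simp add: ennreal_plus[symmetric] ennreal_mult[symmetric] del: ennreal_plus)
  also have "\<dots> \<le> ennreal ((6 * (sqrt (real p * v / real n) + 2 * real p * b / real n)) ^ p)"
  proof (rule ennreal_leI)
    \<comment> \<open>The constant 6 is 2 * 3: the two signs, with \<open>2 \<le> 2 ^ p\<close>, and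
      the base of exp p.\<close>
    have e3: "exp (1::real) \<le> 3" by (rule exp_le)
    have "2 * exp (real p) = 2 * exp 1 ^ p" by (simp add: exp_of_nat_mult[symmetric])
    also have "\<dots> \<le> 2 ^ p * 3 ^ p"
      using p e3 self_le_power[of "2::real" p] by (intro mult_mono power_mono) auto
    also have "\<dots> = 6 ^ p" by (simp add: power_mult_distrib[symmetric])
    finally have 1: "2 * exp (real p) \<le> 6 ^ p" .
    have "real p / (\<theta> * real n) = real p / real n * sqrt (real n * v / real p) + 2 * real p * b / real n"
      using D n by (simp add: \<theta>_def D_def field_simps)
    also have "real p / real n * sqrt (real n * v / real p) = sqrt ((real p / real n)\<^sup>2 * (real n * v / real p))"
      by (subst real_sqrt_mult) simp
    also have "(real p / real n)\<^sup>2 * (real n * v / real p) = real p * v / real n"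
      using n p by (simp add: power2_eq_square)
    finally have 2: "real p / (\<theta> * real n) = sqrt (real p * v / real n) + 2 * real p * b / real n" .
    show "2 * exp (real p) * (real p / (\<theta> * real n)) ^ p \<le> (6 * (sqrt (real p * v / real n) + 2 * real p * b / real n)) ^ p"
      unfolding 2 power_mult_distrib[of 6] using 1 v0 b by (intro mult_right_mono) auto
  qed
  finally show ?thesis .
qed

lemma emp_dev_diff:
  assumes "integrable \<mu> g" "integrable \<mu> g'"
  shows "emp_dev \<mu> n (\<lambda>x. g x - g' x) X = emp_dev \<mu> n g X - emp_dev \<mu> n g' X"
  using assms by (simp add: emp_dev_def sum_subtractf diff_divide_distrib)

lemma emp_dev_abs_le:
  assumes \<mu>: "prob_space \<mu>" and g: "g \<in> borel_measurable \<mu>" and bnd: "\<And>x. \<bar>g x\<bar> \<le> b"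
  shows "\<bar>emp_dev \<mu> n g X\<bar> \<le> 2 * b"
proof -
  interpret prob_space \<mu> by fact
  have ig: "integrable \<mu> g" by (rule integrable_of_bounded[OF g bnd])
  have b0: "0 \<le> b" using bnd[of undefined] by linarith
  have "\<bar>\<integral>x. g x \<partial>\<mu>\<bar> \<le> (\<integral>y. \<bar>g y\<bar> \<partial>\<mu>)" by (rule integral_abs_bound)
  also have "\<dots> \<le> (\<integral>y. b \<partial>\<mu>)" using ig bnd by (intro integral_mono) auto
  finally have 1: "\<bar>\<integral>x. g x \<partial>\<mu>\<bar> \<le> b" by (simp add: prob_space)
  have "\<bar>(\<Sum>i=1..n. g (X i))\<bar> \<le> (\<Sum>i=1..n. b)"
    by (rule order_trans[OF sum_abs]) (intro sum_mono bnd)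
  then have 2: "\<bar>(\<Sum>i=1..n. g (X i)) / real n\<bar> \<le> b"
    using b0 by (cases "n = 0") (auto simp: field_simps)
  show ?thesis unfolding emp_dev_def using 1 2 by linarith
qed

text \<open>Generic chaining over \<open>16\<close>-adic cells. Representatives are taken inside \<open>T\<close>, so that only
  functions of the family enter and \<open>G\<close> need not control anything outside \<open>T\<close>; the variance of an
  increment is estimated by its supremum norm times \<open>2 * G\<close>.\<close>

lemma emp_dev_chaining:
  fixes \<mu> :: "'a measure" and g :: "'b \<Rightarrow> 'a \<Rightarrow> real" and e :: "'b \<Rightarrow> 'd::finite \<Rightarrow> real"
  assumes \<mu>: "prob_space \<mu>"
    and meas: "\<And>t. t \<in> T \<Longrightarrow> g t \<in> borel_measurable \<mu>"
    and e: "\<And>t i. t \<in> T \<Longrightarrow> 0 \<le> e t i \<and> e t i < 1"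
    and bnd: "\<And>t x. t \<in> T \<Longrightarrow> \<bar>g t x\<bar> \<le> \<beta>"
    and lip: "\<And>t t' r x. t \<in> T \<Longrightarrow> t' \<in> T \<Longrightarrow> (\<And>i. \<bar>e t i - e t' i\<bar> \<le> r) \<Longrightarrow> \<bar>g t x - g t' x\<bar> \<le> \<beta> * D * r"
    and G: "\<And>t. t \<in> T \<Longrightarrow> (\<integral>x. \<bar>g t x\<bar> \<partial>\<mu>) \<le> G"
    and \<beta>: "0 < \<beta>" and G1: "1 \<le> G" and D1: "1 \<le> D" and n: "1 \<le> n"
    and p: "8 * CARD('d) \<le> p" and pn: "real p * \<beta> \<le> real n"
  shows "\<exists>R. R \<in> borel_measurable (\<Pi>\<^sub>M i\<in>{1..n}. \<mu>) \<and>
      (\<forall>X. \<forall>t\<in>T. ennreal (\<bar>emp_dev \<mu> n (g t) X\<bar> ^ p) \<le> R X) \<and>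
      (\<integral>\<^sup>+X. R X \<partial>(\<Pi>\<^sub>M i\<in>{1..n}. \<mu>)) \<le> ennreal ((132 * D * sqrt (real p * G * \<beta> / real n)) ^ p)"
proof (cases "T = {}")
  case True
  then show ?thesis by (intro exI[of _ "\<lambda>_. 0"]) auto
next
  case False
  interpret prob_space \<mu> by fact
  let ?P = "\<Pi>\<^sub>M i\<in>{1..n}. \<mu>"
  let ?d = "CARD('d)"
  have d1: "1 \<le> ?d" by (simp add: Suc_leI)
  have p1: "1 \<le> p" using p d1 by linarith
  define cell where "cell k t = (\<lambda>i. nat \<lfloor>16 ^ k * e t i\<rfloor>)" for k t
  define rep where "rep k c = (SOME t. t \<in> T \<and> cell k t = c)" for k c
  have rep: "rep k (cell k t) \<in> T" "cell k (rep k (cell k t)) = cell k t" if "t \<in> T" for k t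
  proof -
    have "\<exists>s. s \<in> T \<and> cell k s = cell k t" using that by auto
    then have "rep k (cell k t) \<in> T \<and> cell k (rep k (cell k t)) = cell k t"
      unfolding rep_def by (rule someI_ex)
    then show "rep k (cell k t) \<in> T" "cell k (rep k (cell k t)) = cell k t" by auto
  qed
  define a where "a k t = rep k (cell k t)" for k t
  \<comment> \<open>The cells are nested, so a link of the chain is determined by its finer cell and
    level k has at most 16^((k+1) d) links.\<close>
  have parent: "cell k t = cell k t'" if "cell (Suc k) t = cell (Suc k) t'" for k t t'
  proof -
    have *: "cell k s i = cell (Suc k) s i div 16" for s i
    proof -
      have "\<lfloor>16 ^ k * e s i\<rfloor> = \<lfloor>(16 ^ Suc k * e s i) / real_of_int 16\<rfloor>" by simp
      also have "\<dots> = \<lfloor>16 ^ Suc k * e s i\<rfloor> div 16" by (rule floor_divide_real_eq_div) simp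
      finally have "nat \<lfloor>16 ^ k * e s i\<rfloor> = nat (\<lfloor>16 ^ Suc k * e s i\<rfloor> div 16)" by (rule arg_cong)
      also have "\<dots> = nat \<lfloor>16 ^ Suc k * e s i\<rfloor> div nat 16"
        by (rule nat_div_distrib') simp
      finally show ?thesis unfolding cell_def by simp
    qed
    show ?thesis using * that by (metis ext)
  qed
  have close: "\<bar>e t i - e t' i\<bar> \<le> 1 / 16 ^ k" if "t \<in> T" "t' \<in> T" "cell k t = cell k t'" for k t t' i
  proof -
    have "nat \<lfloor>16 ^ k * e t i\<rfloor> = nat \<lfloor>16 ^ k * e t' i\<rfloor>"
      using that(3) unfolding cell_def by metis
    moreover have "0 \<le> 16 ^ k * e t i" "0 \<le> 16 ^ k * e t' i" using e that by auto
    ultimately have "\<lfloor>16 ^ k * e t i\<rfloor> = \<lfloor>16 ^ k * e t' i\<rfloor>" by (simp add: eq_nat_nat_iff)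
    then have "\<bar>16 ^ k * e t i - 16 ^ k * e t' i\<bar> \<le> 1" by linarith
    then have "16 ^ k * \<bar>e t i - e t' i\<bar> \<le> 1"
      by (simp add: abs_mult right_diff_distrib[symmetric])
    then show ?thesis by (simp add: field_simps)
  qed
  define C where "C k = cell (Suc k) ` T" for k
  have C_sub: "C k \<subseteq> (\<Pi>\<^sub>E i\<in>UNIV. {..<16 ^ Suc k})" for k
  proof
    fix c assume "c \<in> C k"
    then obtain t where t: "t \<in> T" "c = cell (Suc k) t" by (auto simp: C_def)
    have "c i < 16 ^ Suc k" for i
    proof -
      have "16 ^ Suc k * e t i < 16 ^ Suc k" "0 \<le> 16 ^ Suc k * e t i" using e[OF t(1), of i] by auto
      then have "\<lfloor>16 ^ Suc k * e t i\<rfloor> < 16 ^ Suc k" by (simp add: floor_less_iff)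
      moreover have "0 \<le> \<lfloor>16 ^ Suc k * e t i\<rfloor>" using e[OF t(1), of i] by simp
      ultimately have "nat \<lfloor>16 ^ Suc k * e t i\<rfloor> < 16 ^ Suc k" by (subst nat_less_iff) auto
      then show ?thesis by (simp add: t(2) cell_def)
    qed
    then show "c \<in> (\<Pi>\<^sub>E i\<in>UNIV. {..<16 ^ Suc k})" by auto
  qed
  have C_fin: "finite (C k)" for k
    by (rule finite_subset[OF C_sub]) (auto intro: finite_PiE)
  have C_card: "card (C k) \<le> (16 ^ Suc k) ^ ?d" for k
  proof -
    have "card (C k) \<le> card (\<Pi>\<^sub>E i\<in>(UNIV::'d set). {..<16 ^ Suc k :: nat})"
      by (rule card_mono[OF _ C_sub]) (auto intro: finite_PiE)
    then show ?thesis by (simp add: card_PiE)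
  qed
  define Q where "Q = sqrt (real p * G * \<beta> / real n)"
  have Q0: "0 < Q" unfolding Q_def using p1 G1 \<beta> n by (auto intro!: divide_pos_pos mult_pos_pos)
  \<comment> \<open>By \<open>pn\<close> the left side is at most 1, so its square is at most itself
    and, as G \<ge> 1, at most Q^2: the linear term of the moment bound is dominated by the Gaussian
    one.\<close>
  have pbQ: "real p * \<beta> / real n \<le> Q"
  proof -
    have r: "0 \<le> real p * \<beta> / real n" "real p * \<beta> / real n \<le> 1" using pn n \<beta> by auto
    have "x\<^sup>2 \<le> x" if "0 \<le> x" "x \<le> 1" for x :: real
      using that by (simp add: power2_eq_square mult_left_le_one_le)
    from this[OF r] have "(real p * \<beta> / real n)\<^sup>2 \<le> real p * \<beta> / real n" .
    also have "\<dots> \<le> G * (real p * \<beta> / real n)" using mult_right_mono[OF G1 r(1)] by simp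
    finally have "(real p * \<beta> / real n)\<^sup>2 \<le> real p * G * \<beta> / real n" by (simp add: mult_ac)
    then show ?thesis unfolding Q_def by (rule real_le_rsqrt)
  qed
  have ig: "integrable \<mu> (g t)" if "t \<in> T" for t
    by (rule integrable_of_bounded[OF meas[OF that] bnd[OF that]])
  obtain t0 where t0: "t0 \<in> T" using False by auto
  \<comment> \<open>All coordinates lie in [0, 1), so level 0 is a single cell and every chain
    starts at the same function.\<close>
  have cell0: "cell 0 t = cell 0 t0" if "t \<in> T" for t
    using e[OF that] e[OF t0] unfolding cell_def by (intro ext) (simp add: floor_eq_iff)
  define inc where "inc k c = (\<lambda>x. g (rep (Suc k) c) x - g (rep k (cell k (rep (Suc k) c))) x)" for k c
  have inc_T: "rep (Suc k) c \<in> T" "rep k (cell k (rep (Suc k) c)) \<in> T"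
    "cell k (rep (Suc k) c) = cell k (rep k (cell k (rep (Suc k) c)))" if "c \<in> C k" for k c
    using that rep by (auto simp: C_def)
  have inc_meas[measurable]: "inc k c \<in> borel_measurable \<mu>" if "c \<in> C k" for k c
    unfolding inc_def using inc_T[OF that] by (intro borel_measurable_diff meas)
  have inc_bnd: "\<bar>inc k c x\<bar> \<le> \<beta> * D / 16 ^ k" if "c \<in> C k" for k c x
    using lip[OF inc_T(1,2)[OF that], of "1 / 16 ^ k" x] close[OF inc_T(1,2,3)[OF that]]
    unfolding inc_def by simp
  have inc_sq: "(\<integral>x. (inc k c x)\<^sup>2 \<partial>\<mu>) \<le> \<beta> * D / 16 ^ k * (2 * G)" if "c \<in> C k" for k c
  proof -
    let ?s = "rep (Suc k) c" and ?s' = "rep k (cell k (rep (Suc k) c))"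
    note T = inc_T(1,2)[OF that]
    have "(\<integral>x. (inc k c x)\<^sup>2 \<partial>\<mu>) \<le> (\<integral>x. \<beta> * D / 16 ^ k * (\<bar>g ?s x\<bar> + \<bar>g ?s' x\<bar>) \<partial>\<mu>)"
    proof (rule integral_mono)
      show "integrable \<mu> (\<lambda>x. (inc k c x)\<^sup>2)"
      proof (rule integrable_of_bounded[where b = "(\<beta> * D / 16 ^ k)\<^sup>2"])
        show "(\<lambda>x. (inc k c x)\<^sup>2) \<in> borel_measurable \<mu>" using inc_meas[OF that] by measurable
        show "\<bar>(inc k c x)\<^sup>2\<bar> \<le> (\<beta> * D / 16 ^ k)\<^sup>2" for x
          using power_mono[OF inc_bnd[OF that, of x], of 2] by simp
      qed
      show "integrable \<mu> (\<lambda>x. \<beta> * D / 16 ^ k * (\<bar>g ?s x\<bar> + \<bar>g ?s' x\<bar>))"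
        using ig[OF T(1)] ig[OF T(2)] by simp
      fix x
      have "(inc k c x)\<^sup>2 = \<bar>inc k c x\<bar> * \<bar>inc k c x\<bar>" by (simp add: power2_eq_square)
      also have "\<dots> \<le> \<beta> * D / 16 ^ k * (\<bar>g ?s x\<bar> + \<bar>g ?s' x\<bar>)"
        using inc_bnd[OF that, of x] \<beta> D1 by (intro mult_mono) (auto simp: inc_def)
      finally show "(inc k c x)\<^sup>2 \<le> \<beta> * D / 16 ^ k * (\<bar>g ?s x\<bar> + \<bar>g ?s' x\<bar>)" .
    qed
    also have "\<dots> = \<beta> * D / 16 ^ k * ((\<integral>x. \<bar>g ?s x\<bar> \<partial>\<mu>) + (\<integral>x. \<bar>g ?s' x\<bar> \<partial>\<mu>))"
      using ig[OF T(1)] ig[OF T(2)] by simp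
    also have "\<dots> \<le> \<beta> * D / 16 ^ k * (2 * G)"
      using G[OF T(1)] G[OF T(2)] \<beta> D1 by (intro mult_left_mono) auto
    finally show ?thesis .
  qed
  \<comment> \<open>An increment at level k has sup norm of order 16^(-k), hence standard deviation
    of order 4^(-k). Allowing it the larger size 2^(-k) keeps the levels summable and leaves a
    factor (2^(-k))^p, which for \<open>p \<ge> 8 * d\<close> outweighs the number of links.\<close>
  define u where "u k = 24 * D * Q / 2 ^ k" for k :: nat
  have u0: "0 < u k" for k unfolding u_def using D1 Q0 by auto
  have scaled: "(\<integral>\<^sup>+X. ennreal ((\<bar>z X\<bar> / b) ^ p) \<partial>?P) \<le> ennreal ((b' / b) ^ p)"
    if "(\<integral>\<^sup>+X. ennreal (\<bar>z X\<bar> ^ p) \<partial>?P) \<le> ennreal (b' ^ p)" "0 < b" "0 \<le> b'" and [measurable]: "z \<in> borel_measurable ?P"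
    for z b b'
  proof -
    have "(\<integral>\<^sup>+X. ennreal ((\<bar>z X\<bar> / b) ^ p) \<partial>?P) = (\<integral>\<^sup>+X. ennreal (1 / b ^ p) * ennreal (\<bar>z X\<bar> ^ p) \<partial>?P)"
      using that by (intro nn_integral_cong) (simp add: power_divide ennreal_mult[symmetric])
    also have "\<dots> = ennreal (1 / b ^ p) * (\<integral>\<^sup>+X. ennreal (\<bar>z X\<bar> ^ p) \<partial>?P)"
      by (intro nn_integral_cmult) measurable
    also have "\<dots> \<le> ennreal (1 / b ^ p) * ennreal (b' ^ p)" using that by (intro mult_left_mono) auto
    also have "\<dots> = ennreal ((b' / b) ^ p)" using that by (simp add: power_divide ennreal_mult[symmetric])
    finally show ?thesis .
  qed
  have base_int: "(\<integral>\<^sup>+X. ennreal ((\<bar>emp_dev \<mu> n (g (a 0 t0)) X\<bar> / (18 * Q)) ^ p) \<partial>?P) \<le> 1"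
  proof -
    have T: "a 0 t0 \<in> T" using rep(1)[OF t0] by (simp add: a_def)
    have sq: "(\<integral>x. (g (a 0 t0) x)\<^sup>2 \<partial>\<mu>) \<le> \<beta> * G"
    proof -
      have "(\<integral>x. (g (a 0 t0) x)\<^sup>2 \<partial>\<mu>) \<le> (\<integral>x. \<beta> * \<bar>g (a 0 t0) x\<bar> \<partial>\<mu>)"
      proof (rule integral_mono)
        show "integrable \<mu> (\<lambda>x. (g (a 0 t0) x)\<^sup>2)"
        proof (rule integrable_of_bounded[where b = "\<beta>\<^sup>2"])
          show "(\<lambda>x. (g (a 0 t0) x)\<^sup>2) \<in> borel_measurable \<mu>" using meas[OF T] by measurable
          show "\<bar>(g (a 0 t0) x)\<^sup>2\<bar> \<le> \<beta>\<^sup>2" for x using power_mono[OF bnd[OF T, of x], of 2] by simp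
        qed
        show "integrable \<mu> (\<lambda>x. \<beta> * \<bar>g (a 0 t0) x\<bar>)" using ig[OF T] by simp
        fix x
        have "(g (a 0 t0) x)\<^sup>2 = \<bar>g (a 0 t0) x\<bar> * \<bar>g (a 0 t0) x\<bar>" by (simp add: power2_eq_square)
        also have "\<dots> \<le> \<beta> * \<bar>g (a 0 t0) x\<bar>" using bnd[OF T, of x] by (intro mult_right_mono) auto
        finally show "(g (a 0 t0) x)\<^sup>2 \<le> \<beta> * \<bar>g (a 0 t0) x\<bar>" .
      qed
      also have "\<dots> = \<beta> * (\<integral>x. \<bar>g (a 0 t0) x\<bar> \<partial>\<mu>)" by simp
      also have "\<dots> \<le> \<beta> * G" using G[OF T] \<beta> by (intro mult_left_mono) auto
      finally show ?thesis .
    qed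
    have "(\<integral>\<^sup>+X. ennreal (\<bar>emp_dev \<mu> n (g (a 0 t0)) X\<bar> ^ p) \<partial>?P)
        \<le> ennreal ((6 * (sqrt (real p * (\<beta> * G) / real n) + 2 * real p * \<beta> / real n)) ^ p)"
      by (rule emp_dev_moment[OF \<mu> meas[OF T] bnd[OF T] sq \<beta> n p1])
    also have "\<dots> \<le> ennreal ((18 * Q) ^ p)"
    proof (intro ennreal_leI power_mono)
      have "sqrt (real p * (\<beta> * G) / real n) = Q" by (simp add: Q_def mult_ac)
      then show "6 * (sqrt (real p * (\<beta> * G) / real n) + 2 * real p * \<beta> / real n) \<le> 18 * Q"
        using pbQ by simp
      show "0 \<le> 6 * (sqrt (real p * (\<beta> * G) / real n) + 2 * real p * \<beta> / real n)"
        using \<beta> G1 by auto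
    qed
    finally have "(\<integral>\<^sup>+X. ennreal ((\<bar>emp_dev \<mu> n (g (a 0 t0)) X\<bar> / (18 * Q)) ^ p) \<partial>?P) \<le> ennreal ((18 * Q / (18 * Q)) ^ p)"
      using Q0 by (intro scaled[OF _ _ _ emp_dev_measurable[OF meas[OF T]]]) auto
    then show ?thesis using Q0 by simp
  qed
  have inc_int: "(\<integral>\<^sup>+X. ennreal ((\<bar>emp_dev \<mu> n (inc k c) X\<bar> / u k) ^ p) \<partial>?P) \<le> ennreal ((1 / 2 ^ k) ^ p)" if c: "c \<in> C k" for k c
  proof -
    have b0: "0 < \<beta> * D / 16 ^ k" using \<beta> D1 by simp
    have "(\<integral>\<^sup>+X. ennreal (\<bar>emp_dev \<mu> n (inc k c) X\<bar> ^ p) \<partial>?P)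
        \<le> ennreal ((6 * (sqrt (real p * (\<beta> * D / 16 ^ k * (2 * G)) / real n) + 2 * real p * (\<beta> * D / 16 ^ k) / real n)) ^ p)"
      by (rule emp_dev_moment[OF \<mu> inc_meas[OF c] inc_bnd[OF c] inc_sq[OF c] b0 n p1])
    also have "\<dots> \<le> ennreal ((24 * D * Q / 4 ^ k) ^ p)"
    proof (intro ennreal_leI power_mono)
      have "sqrt (real p * (\<beta> * D / 16 ^ k * (2 * G)) / real n) = sqrt (2 * D / 16 ^ k) * Q"
        unfolding Q_def by (subst real_sqrt_mult[symmetric]) (simp add: mult_ac)
      also have "sqrt (2 * D / 16 ^ k) = sqrt (2 * D) / 4 ^ k"
      proof -
        have "sqrt 16 = (4::real)" by (rule real_sqrt_unique) simp_all
        then have "sqrt (16 ^ k) = (4 ^ k :: real)" by (simp add: real_sqrt_power)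
        then show ?thesis by (simp add: real_sqrt_divide)
      qed
      also have "sqrt (2 * D) / 4 ^ k * Q \<le> 2 * D / 4 ^ k * Q"
      proof -
        have "sqrt (2 * D) \<le> 2 * D" using D1 by (intro real_le_lsqrt) (auto simp: power2_eq_square)
        then show ?thesis using Q0 by (intro mult_right_mono divide_right_mono) auto
      qed
      finally have 1: "sqrt (real p * (\<beta> * D / 16 ^ k * (2 * G)) / real n) \<le> 2 * D / 4 ^ k * Q" .
      have "2 * real p * (\<beta> * D / 16 ^ k) / real n = 2 * D / 16 ^ k * (real p * \<beta> / real n)" by simp
      also have "\<dots> \<le> 2 * D / 4 ^ k * Q"
      proof (rule mult_mono)
        have "(4::real) ^ k \<le> 16 ^ k" by (rule power_mono) auto
        then show "2 * D / 16 ^ k \<le> 2 * D / 4 ^ k" using D1 by (intro divide_left_mono) auto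
      qed (use pbQ D1 \<beta> in auto)
      finally have 2: "2 * real p * (\<beta> * D / 16 ^ k) / real n \<le> 2 * D / 4 ^ k * Q" .
      show "6 * (sqrt (real p * (\<beta> * D / 16 ^ k * (2 * G)) / real n) + 2 * real p * (\<beta> * D / 16 ^ k) / real n) \<le> 24 * D * Q / 4 ^ k"
        using 1 2 by simp
      show "0 \<le> 6 * (sqrt (real p * (\<beta> * D / 16 ^ k * (2 * G)) / real n) + 2 * real p * (\<beta> * D / 16 ^ k) / real n)"
        using \<beta> D1 G1 by auto
    qed
    finally have "(\<integral>\<^sup>+X. ennreal ((\<bar>emp_dev \<mu> n (inc k c) X\<bar> / u k) ^ p) \<partial>?P) \<le> ennreal ((24 * D * Q / 4 ^ k / u k) ^ p)"
      using Q0 D1 u0 by (intro scaled[OF _ _ _ emp_dev_measurable[OF inc_meas[OF c]]]) auto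
    also have "24 * D * Q / 4 ^ k / u k = 1 / 2 ^ k"
    proof -
      have "(4::real) ^ k = 2 ^ k * 2 ^ k" by (simp flip: power_mult_distrib)
      then show ?thesis using D1 Q0 by (simp add: u_def)
    qed
    finally show ?thesis .
  qed
  \<comment> \<open>Each summand is the p-th power of a link divided by its allowance, so the p-th
    root of \<open>R0\<close> bounds all normalised links simultaneously.\<close>
  define R0 where "R0 X = ennreal ((\<bar>emp_dev \<mu> n (g (a 0 t0)) X\<bar> / (18 * Q)) ^ p)
      + (\<Sum>k. \<Sum>c\<in>C k. ennreal ((\<bar>emp_dev \<mu> n (inc k c) X\<bar> / u k) ^ p))" for X
  have a0T: "a 0 t0 \<in> T" using rep(1)[OF t0] by (simp add: a_def)
  have m1[measurable]: "emp_dev \<mu> n (g (a 0 t0)) \<in> borel_measurable ?P"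
    by (rule emp_dev_measurable[OF meas[OF a0T]])
  have m2: "(\<lambda>X. ennreal ((\<bar>emp_dev \<mu> n (inc k c) X\<bar> / u k) ^ p)) \<in> borel_measurable ?P" if "c \<in> C k" for k c
    using emp_dev_measurable[OF inc_meas[OF that], of n] by measurable
  have m3[measurable]: "(\<lambda>X. \<Sum>c\<in>C k. ennreal ((\<bar>emp_dev \<mu> n (inc k c) X\<bar> / u k) ^ p)) \<in> borel_measurable ?P" for k
    by (rule borel_measurable_sum) (rule m2)
  have mR0[measurable]: "R0 \<in> borel_measurable ?P"
    unfolding R0_def[abs_def] by measurable
  have R0_int: "(\<integral>\<^sup>+X. R0 X \<partial>?P) \<le> ennreal (2 ^ p)"
  proof -
    have lev: "(\<integral>\<^sup>+X. (\<Sum>c\<in>C k. ennreal ((\<bar>emp_dev \<mu> n (inc k c) X\<bar> / u k) ^ p)) \<partial>?P) \<le> ennreal (16 ^ ?d * (1 / 2) ^ k)" for k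
    proof -
      have "(\<integral>\<^sup>+X. (\<Sum>c\<in>C k. ennreal ((\<bar>emp_dev \<mu> n (inc k c) X\<bar> / u k) ^ p)) \<partial>?P)
          = (\<Sum>c\<in>C k. \<integral>\<^sup>+X. ennreal ((\<bar>emp_dev \<mu> n (inc k c) X\<bar> / u k) ^ p) \<partial>?P)"
        by (rule nn_integral_sum) (rule m2)
      also have "\<dots> \<le> (\<Sum>c\<in>C k. ennreal ((1 / 2 ^ k) ^ p))" by (rule sum_mono) (rule inc_int)
      also have "\<dots> = ennreal (real (card (C k)) * (1 / 2 ^ k) ^ p)"
        by (simp add: ennreal_mult ennreal_of_nat_eq_real_of_nat)
      also have "\<dots> \<le> ennreal (16 ^ ?d * (1 / 2) ^ k)"
      proof (rule ennreal_leI)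
        have "real (card (C k)) \<le> real ((16 ^ Suc k) ^ ?d)" using C_card of_nat_mono by blast
        moreover have "(1 / 2 ^ k :: real) ^ p \<le> (1 / 2 ^ k) ^ (8 * ?d)"
          using p by (intro power_decreasing) auto
        ultimately have "real (card (C k)) * (1 / 2 ^ k) ^ p \<le> real ((16 ^ Suc k) ^ ?d) * (1 / 2 ^ k) ^ (8 * ?d)"
          by (intro mult_mono) auto
        also have "\<dots> = (16 ^ Suc k * (1 / 2 ^ k) ^ 8) ^ ?d"
          by (simp add: power_mult power_mult_distrib)
        also have "(16 ^ Suc k * (1 / 2 ^ k) ^ 8 :: real) = 16 * (1 / 16) ^ k"
        proof -
          have "((1 / 2 ^ k) ^ 8 :: real) = (1 / 256) ^ k"
          proof -
            have "((1 / 2 ^ k) ^ 8 :: real) = ((1 / 2) ^ k) ^ 8" by (simp add: power_one_over)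
            also have "\<dots> = ((1 / 2) ^ 8) ^ k" by (simp only: power_mult[symmetric] mult.commute)
            finally show ?thesis by (simp add: power_one_over)
          qed
          then have "(16 ^ Suc k * (1 / 2 ^ k) ^ 8 :: real) = 16 * (16 ^ k * (1 / 256) ^ k)" by simp
          also have "(16 ^ k * (1 / 256) ^ k :: real) = (1 / 16) ^ k" by (simp only: power_mult_distrib[symmetric]) (simp add: mult.assoc)
          finally show ?thesis .
        qed
        also have "(16 * (1 / 16) ^ k :: real) ^ ?d = 16 ^ ?d * ((1 / 16) ^ k) ^ ?d" by (simp add: power_mult_distrib)
        also have "\<dots> \<le> 16 ^ ?d * (1 / 2) ^ k"
        proof (rule mult_left_mono)
          have "((1 / 16 :: real) ^ k) ^ ?d \<le> ((1 / 16) ^ k) ^ 1"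
            using d1 by (intro power_decreasing) (auto simp: power_le_one)
          also have "\<dots> \<le> (1 / 2) ^ k" by (simp add: power_mono)
          finally show "((1 / 16 :: real) ^ k) ^ ?d \<le> (1 / 2) ^ k" .
        qed simp
        finally show "real (card (C k)) * (1 / 2 ^ k) ^ p \<le> 16 ^ ?d * (1 / 2) ^ k" .
      qed
      finally show ?thesis .
    qed
    have "(\<integral>\<^sup>+X. R0 X \<partial>?P) = (\<integral>\<^sup>+X. ennreal ((\<bar>emp_dev \<mu> n (g (a 0 t0)) X\<bar> / (18 * Q)) ^ p) \<partial>?P)
        + (\<Sum>k. \<integral>\<^sup>+X. (\<Sum>c\<in>C k. ennreal ((\<bar>emp_dev \<mu> n (inc k c) X\<bar> / u k) ^ p)) \<partial>?P)"
      unfolding R0_def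
      by (subst nn_integral_add, measurable, subst nn_integral_suminf, rule m3, rule refl)
    also have "\<dots> \<le> 1 + (\<Sum>k. ennreal (16 ^ ?d * (1 / 2) ^ k))"
      by (intro add_mono base_int suminf_le lev summableI)
    also have "(\<Sum>k. ennreal (16 ^ ?d * (1 / 2) ^ k)) = ennreal (16 ^ ?d * 2)"
    proof -
      have "(\<lambda>k. 16 ^ ?d * (1 / 2 :: real) ^ k) sums (16 ^ ?d * 2)"
        using sums_mult[OF geometric_sums[of "1/2::real"], of "16 ^ ?d"] by simp
      then show ?thesis by (intro suminf_ennreal_eq) auto
    qed
    also have "1 + ennreal (16 ^ ?d * 2) = ennreal (1 + 16 ^ ?d * 2)"
      by (subst ennreal_plus) auto
    also have "\<dots> \<le> ennreal (2 ^ p)"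
    proof (rule ennreal_leI)
      have y: "(16::real) \<le> 16 ^ ?d" using d1 self_le_power[of "16::real" ?d] by simp
      have "16 * (16::real) ^ ?d \<le> 16 ^ ?d * 16 ^ ?d" using y by (intro mult_right_mono) auto
      then have "1 + 16 ^ ?d * 2 \<le> (16::real) ^ ?d * 16 ^ ?d" using y by linarith
      also have "\<dots> = 2 ^ (8 * ?d)" by (simp add: power_mult flip: power_mult_distrib)
      also have "\<dots> \<le> 2 ^ p" using p by (intro power_increasing) auto
      finally show "1 + 16 ^ ?d * 2 \<le> (2::real) ^ p" .
    qed
    finally show ?thesis .
  qed
  have dom: "ennreal (\<bar>emp_dev \<mu> n (g t) X\<bar> ^ p) \<le> ennreal ((66 * D * Q) ^ p) * R0 X" if t: "t \<in> T" for t X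
  proof (cases "R0 X")
    case top
    have "0 < (66 * D * Q) ^ p" using D1 Q0 by simp
    then show ?thesis using top D1 Q0 by (simp add: ennreal_mult_top)
  next
    case (real r)
    have le_root: "y \<le> b * root p r" if "ennreal ((y / b) ^ p) \<le> R0 X" "0 < b" "0 \<le> y" for y b
    proof -
      have "(y / b) ^ p \<le> r" using that real by (simp add: ennreal_le_iff)
      then have "root p ((y / b) ^ p) \<le> root p r" using p1 by (intro real_root_le_mono) auto
      then have "y / b \<le> root p r" using p1 that by (subst (asm) real_root_power_cancel) auto
      then show ?thesis using that by (simp add: pos_divide_le_eq mult.commute)
    qed
    have r0: "0 \<le> root p r" using real p1 by (simp add: real_root_ge_zero)
    have aT: "a k t \<in> T" for k using rep(1)[OF t] by (simp add: a_def)
    have a0: "a 0 t = a 0 t0" using cell0[OF t] by (simp add: a_def)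
    have b1: "\<bar>emp_dev \<mu> n (g (a 0 t)) X\<bar> \<le> 18 * Q * root p r"
      unfolding a0 by (rule le_root) (use Q0 in \<open>auto simp: R0_def\<close>)
    have step: "\<bar>emp_dev \<mu> n (g (a (Suc k) t)) X - emp_dev \<mu> n (g (a k t)) X\<bar> \<le> u k * root p r" for k
    proof -
      let ?c = "cell (Suc k) t"
      have c: "?c \<in> C k" using t by (auto simp: C_def)
      have 1: "rep (Suc k) ?c = a (Suc k) t" by (simp add: a_def)
      have "cell k (rep (Suc k) ?c) = cell k t" by (rule parent) (rule rep(2)[OF t])
      then have 2: "rep k (cell k (rep (Suc k) ?c)) = a k t" by (simp add: a_def)
      have "emp_dev \<mu> n (inc k ?c) X = emp_dev \<mu> n (g (a (Suc k) t)) X - emp_dev \<mu> n (g (a k t)) X"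
        unfolding inc_def 2 unfolding 1 by (rule emp_dev_diff[OF ig[OF aT] ig[OF aT]])
      moreover have "\<bar>emp_dev \<mu> n (inc k ?c) X\<bar> \<le> u k * root p r"
      proof (rule le_root)
        let ?F = "\<lambda>k. \<Sum>c\<in>C k. ennreal ((\<bar>emp_dev \<mu> n (inc k c) X\<bar> / u k) ^ p)"
        have "ennreal ((\<bar>emp_dev \<mu> n (inc k ?c) X\<bar> / u k) ^ p) \<le> ?F k"
          by (rule member_le_sum[OF c]) (auto simp: C_fin)
        also have "\<dots> \<le> (\<Sum>k. ?F k)"
          using sum_le_suminf[of ?F "{k}"] by simp
        also have "\<dots> \<le> R0 X" by (simp add: R0_def)
        finally show "ennreal ((\<bar>emp_dev \<mu> n (inc k ?c) X\<bar> / u k) ^ p) \<le> R0 X" .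
      qed (use u0 in auto)
      ultimately show ?thesis by simp
    qed
    have part: "\<bar>emp_dev \<mu> n (g (a k t)) X\<bar> \<le> 18 * Q * root p r + (\<Sum>j<k. u j) * root p r" for k
    proof (induction k)
      case 0
      then show ?case using b1 by simp
    next
      case (Suc k)
      then show ?case using step[of k] by (simp add: distrib_right)
    qed
    \<comment> \<open>The total allowance along a chain is at most (18 + 48) D Q = 66 D Q; the bound
      \<open>2 ^ p\<close> on the integral of \<open>R0\<close> doubles this to the constant
      132.\<close>
    have usum: "(\<Sum>j<k. u j) \<le> 48 * D * Q" for k
    proof -
      have "(\<Sum>j<k. (1 / 2 :: real) ^ j) \<le> (\<Sum>j. (1 / 2) ^ j)"
        by (rule sum_le_suminf) (auto simp: summable_geometric)
      also have "\<dots> = 2" by (subst suminf_geometric) auto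
      finally have "24 * D * Q * (\<Sum>j<k. (1 / 2 :: real) ^ j) \<le> 24 * D * Q * 2"
        using D1 Q0 by (intro mult_left_mono) auto
      then show ?thesis by (simp add: u_def sum_distrib_left power_one_over field_simps)
    qed
    have pk: "\<bar>emp_dev \<mu> n (g (a k t)) X\<bar> \<le> 66 * D * Q * root p r" for k
    proof -
      have "18 * Q * root p r + (\<Sum>j<k. u j) * root p r \<le> 18 * D * Q * root p r + 48 * D * Q * root p r"
        using r0 Q0 D1 usum[of k] by (intro add_mono mult_right_mono) auto
      then show ?thesis using part[of k] by (simp add: algebra_simps)
    qed
    \<comment> \<open>What remains below level k is bounded by a sup norm, uniformly over all
      samples, and vanishes as k grows; so the bound on finite chains passes to every member of the
      family.\<close>
    have appr: "\<bar>emp_dev \<mu> n (g t) X\<bar> \<le> 66 * D * Q * root p r + 2 * (\<beta> * D * (1 / 16 ^ k))" for k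
    proof -
      have cl: "\<bar>e t i - e (a k t) i\<bar> \<le> 1 / 16 ^ k" for i
        by (rule close[OF t aT]) (simp add: a_def rep(2)[OF t])
      have "\<bar>emp_dev \<mu> n (\<lambda>x. g t x - g (a k t) x) X\<bar> \<le> 2 * (\<beta> * D * (1 / 16 ^ k))"
      proof (rule emp_dev_abs_le[OF \<mu>])
        show "(\<lambda>x. g t x - g (a k t) x) \<in> borel_measurable \<mu>" by (intro borel_measurable_diff meas t aT)
        show "\<bar>g t x - g (a k t) x\<bar> \<le> \<beta> * D * (1 / 16 ^ k)" for x by (rule lip[OF t aT cl])
      qed
      then show ?thesis
        using pk[of k] unfolding emp_dev_diff[OF ig[OF t] ig[OF aT]] by linarith
    qed
    have "(\<lambda>k. 66 * D * Q * root p r + 2 * (\<beta> * D * (1 / 16 ^ k))) \<longlonglongrightarrow> 66 * D * Q * root p r + 2 * (\<beta> * D * 0)"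
    proof -
      have "(\<lambda>k. (1 / 16 :: real) ^ k) \<longlonglongrightarrow> 0" by (rule LIMSEQ_power_zero) simp
      then have "(\<lambda>k. 1 / 16 ^ k :: real) \<longlonglongrightarrow> 0" by (simp add: power_one_over)
      then show ?thesis by (intro tendsto_intros)
    qed
    then have "\<bar>emp_dev \<mu> n (g t) X\<bar> \<le> 66 * D * Q * root p r + 2 * (\<beta> * D * 0)"
      by (rule LIMSEQ_le_const) (use appr in auto)
    then have "\<bar>emp_dev \<mu> n (g t) X\<bar> ^ p \<le> (66 * D * Q * root p r) ^ p" by (intro power_mono) auto
    also have "\<dots> = (66 * D * Q) ^ p * r"
      using real p1 by (simp add: power_mult_distrib real_root_pow_pos2)
    finally show ?thesis using real D1 Q0 by (simp add: ennreal_mult[symmetric] ennreal_leI)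
  qed
  show ?thesis
  proof (intro exI[of _ "\<lambda>X. ennreal ((66 * D * Q) ^ p) * R0 X"] conjI allI ballI dom)
    show "(\<lambda>X. ennreal ((66 * D * Q) ^ p) * R0 X) \<in> borel_measurable ?P" by measurable
    have "(\<integral>\<^sup>+X. ennreal ((66 * D * Q) ^ p) * R0 X \<partial>?P) = ennreal ((66 * D * Q) ^ p) * (\<integral>\<^sup>+X. R0 X \<partial>?P)"
      by (rule nn_integral_cmult) measurable
    also have "\<dots> \<le> ennreal ((66 * D * Q) ^ p) * ennreal (2 ^ p)" by (intro mult_left_mono R0_int) simp
    also have "\<dots> = ennreal ((132 * D * Q) ^ p)"
    proof -
      have "(66 * D * Q) ^ p * 2 ^ p = (132 * D * Q) ^ p" by (simp only: power_mult_distrib[symmetric]) (simp add: mult.assoc)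
      then show ?thesis using D1 Q0 by (subst ennreal_mult[symmetric]) auto
    qed
    finally show "(\<integral>\<^sup>+X. ennreal ((66 * D * Q) ^ p) * R0 X \<partial>?P) \<le> ennreal ((132 * D * sqrt (real p * G * \<beta> / real n)) ^ p)"
      by (simp add: Q_def)
  qed
qed

section \<open>Marginals, scaling and independence of blocks\<close>

abbreviation PiR :: "'d set \<Rightarrow> ('d \<Rightarrow> real) measure" where
  "PiR I \<equiv> \<Pi>\<^sub>M i\<in>I. lborel"

interpretation PiR: product_sigma_finite "\<lambda>_::'d. lborel :: real measure"
  by unfold_locales

definition depends_on :: "'d set \<Rightarrow> (real ^ 'd::finite \<Rightarrow> 'c) \<Rightarrow> bool" where
  "depends_on I \<phi> \<longleftrightarrow> (\<forall>x y. (\<forall>i\<in>I. x $ i = y $ i) \<longrightarrow> \<phi> x = \<phi> y)"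

lemma depends_onD: "depends_on I \<phi> \<Longrightarrow> (\<And>i. i \<in> I \<Longrightarrow> x $ i = y $ i) \<Longrightarrow> \<phi> x = \<phi> y"
  unfolding depends_on_def by blast

lemma vec_lambda_measurable':
  assumes "\<And>i. f i \<in> borel_measurable M"
  shows "(\<lambda>y. \<chi> i. f i y) \<in> M \<rightarrow>\<^sub>M (borel :: (real ^ 'd::finite) measure)"
  by (subst borel_measurable_euclidean_space) (auto simp: Basis_vec_def inner_axis assms)

lemma vec_lambda_measurable [measurable]:
  "(\<lambda>y. \<chi> i. y i) \<in> PiR (UNIV :: 'd::finite set) \<rightarrow>\<^sub>M borel"
  by (rule vec_lambda_measurable') simp

text \<open>Boxes determine Lebesgue measure. The identification gives Fubini for arbitrary
  splittings of the coordinates, the form in which marginals and blocks occur.\<close>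

lemma lborel_vec: "(lborel :: (real ^ 'd::finite) measure) = distr (PiR UNIV) borel (\<lambda>y. \<chi> i. y i)"
proof (rule lborel_eqI)
  fix l u :: "real ^ 'd" assume lu: "\<And>b. b \<in> Basis \<Longrightarrow> l \<bullet> b \<le> u \<bullet> b"
  have lu': "l $ i \<le> u $ i" for i using lu[of "axis i 1"] by (simp add: inner_axis axis_in_Basis_iff)
  have pre: "(\<lambda>y. \<chi> i. y i) -` box l u \<inter> space (PiR UNIV) = (\<Pi>\<^sub>E i\<in>UNIV. {l $ i<..<u $ i})"
    by (auto simp: space_PiM mem_box_cart PiE_iff)
  have "emeasure (distr (PiR UNIV) borel (\<lambda>y. \<chi> i. y i)) (box l u) = emeasure (PiR UNIV) (\<Pi>\<^sub>E i\<in>UNIV. {l $ i<..<u $ i})"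
    by (subst emeasure_distr) (auto simp: pre)
  also have "\<dots> = (\<Prod>i\<in>UNIV. ennreal (u $ i - l $ i))"
    by (subst PiR.emeasure_PiM) (auto simp: lu')
  also have "\<dots> = ennreal (\<Prod>i\<in>UNIV. u $ i - l $ i)" by (rule prod_ennreal) (simp add: lu')
  also have "(\<Prod>i\<in>UNIV. u $ i - l $ i) = (\<Prod>b\<in>Basis. (u - l) \<bullet> b)"
  proof -
    have bas: "(Basis :: (real ^ 'd) set) = range (\<lambda>i. axis i 1)" by (auto simp: Basis_vec_def)
    have inj: "inj (\<lambda>i::'d. axis i (1::real))" by (auto simp: inj_on_def axis_eq_axis)
    show ?thesis unfolding bas by (subst prod.reindex[OF inj]) (simp add: inner_axis)
  qed
  finally show "emeasure (distr (PiR UNIV) borel (\<lambda>y. \<chi> i. y i)) (box l u) = ennreal (\<Prod>b\<in>Basis. (u - l) \<bullet> b)" .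
qed simp

lemma merge_measurable_vec [measurable]:
  "(\<lambda>(x, y). \<chi> i. if i \<in> I then x $ i else y i) \<in> (borel :: (real ^ 'd::finite) measure) \<Otimes>\<^sub>M PiR (- I) \<rightarrow>\<^sub>M borel"
  unfolding case_prod_beta
proof (rule vec_lambda_measurable')
  fix i
  show "(\<lambda>p. if i \<in> I then fst p $ i else snd p i) \<in> borel_measurable ((borel :: (real ^ 'd) measure) \<Otimes>\<^sub>M PiR (- I))"
    by (cases "i \<in> I") (auto intro!: measurable_compose[OF measurable_snd measurable_component_singleton]
      measurable_compose[OF measurable_fst borel_measurable_nth] simp del: borel_measurable_nth)
qed

lemma marginal_measurable [measurable]:
  assumes [measurable]: "f \<in> borel_measurable borel"
  shows "marginal f I \<in> borel_measurable borel"
proof -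
  interpret finite_product_sigma_finite "\<lambda>_. lborel :: real measure" "- I" by unfold_locales simp
  have "(\<lambda>(x, y). ennreal (f (\<chi> i. if i \<in> I then x $ i else y i))) \<in> borel_measurable (borel \<Otimes>\<^sub>M PiR (- I))"
    using measurable_compose[OF merge_measurable_vec[of I], of "\<lambda>x. ennreal (f x)" borel]
    by (simp add: case_prod_beta)
  then show ?thesis unfolding marginal_def[abs_def] by (rule borel_measurable_nn_integral)
qed

lemma marginal_depends: "depends_on I (marginal f I)"
proof -
  have *: "(\<chi> i. if i \<in> I then x $ i else z i) = (\<chi> i. if i \<in> I then y $ i else z i)"
    if "\<forall>i\<in>I. x $ i = y $ i" for x y :: "real ^ 'a" and z
    using that by (simp add: vec_eq_iff)
  show ?thesis unfolding depends_on_def marginal_def by (intro allI impI) (simp only: *)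
qed

text \<open>Fubini over \<open>I\<close> and its complement: \<phi> is constant on the sections, so
  the inner integral is \<phi> times the marginal.\<close>

lemma nn_integral_marginal:
  fixes f :: "real ^ 'd::finite \<Rightarrow> real" and \<phi> :: "real ^ 'd \<Rightarrow> ennreal"
  assumes [measurable]: "f \<in> borel_measurable borel" "\<phi> \<in> borel_measurable borel"
    and dep: "depends_on I \<phi>"
  shows "(\<integral>\<^sup>+x. \<phi> x * ennreal (f x) \<partial>lborel) = (\<integral>\<^sup>+y. \<phi> (\<chi> i. y i) * marginal f I (\<chi> i. y i) \<partial>PiR I)"
proof -
  have "(\<integral>\<^sup>+x. \<phi> x * ennreal (f x) \<partial>lborel) = (\<integral>\<^sup>+y. \<phi> (\<chi> i. y i) * ennreal (f (\<chi> i. y i)) \<partial>PiR UNIV)"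
    by (subst lborel_vec, subst nn_integral_distr) auto
  also have "\<dots> = (\<integral>\<^sup>+y. \<phi> (\<chi> i. y i) * ennreal (f (\<chi> i. y i)) \<partial>PiR (I \<union> - I))" by simp
  also have "\<dots> = (\<integral>\<^sup>+x. (\<integral>\<^sup>+y. \<phi> (\<chi> i. merge I (-I) (x, y) i) * ennreal (f (\<chi> i. merge I (-I) (x, y) i)) \<partial>PiR (-I)) \<partial>PiR I)"
    by (rule PiR.product_nn_integral_fold) (auto simp: Compl_partition)
  also have "\<dots> = (\<integral>\<^sup>+x. \<phi> (\<chi> i. x i) * marginal f I (\<chi> i. x i) \<partial>PiR I)"
  proof (rule nn_integral_cong)
    fix x assume "x \<in> space (PiR I)"
    have 1: "\<phi> (\<chi> i. merge I (-I) (x, y) i) = \<phi> (\<chi> i. x i)" for y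
      by (rule depends_onD[OF dep]) (simp add: merge_def)
    have 2: "(\<chi> i. merge I (-I) (x, y) i) = (\<chi> i. if i \<in> I then (\<chi> i. x i) $ i else y i)" for y
      by (simp add: vec_eq_iff merge_def)
    have m: "(\<lambda>y. ennreal (f (\<chi> i. if i \<in> I then (\<chi> i. x i) $ i else y i))) \<in> borel_measurable (PiR (- I))"
    proof -
      have "(\<lambda>y. \<chi> i. if i \<in> I then (\<chi> i. x i) $ i else y i) \<in> PiR (- I) \<rightarrow>\<^sub>M borel"
      proof (rule vec_lambda_measurable')
        fix i show "(\<lambda>y. if i \<in> I then (\<chi> i. x i) $ i else y i) \<in> borel_measurable (PiR (- I))"
          by (cases "i \<in> I") (auto intro: measurable_component_singleton)
      qed
      then show ?thesis by measurable
    qed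
    show "(\<integral>\<^sup>+y. \<phi> (\<chi> i. merge I (-I) (x, y) i) * ennreal (f (\<chi> i. merge I (-I) (x, y) i)) \<partial>PiR (-I)) = \<phi> (\<chi> i. x i) * marginal f I (\<chi> i. x i)"
      unfolding 1 unfolding marginal_def 2 using m by (rule nn_integral_cmult)
  qed
  finally show ?thesis .
qed

definition law :: "(real ^ 'd::finite \<Rightarrow> real) \<Rightarrow> (real ^ 'd) measure" where
  "law f = density lborel (\<lambda>x. ennreal (f x))"

lemma law_sets [measurable_cong, simp]: "sets (law f) = sets borel"
  by (simp add: law_def)

lemma law_space [simp]: "space (law f) = UNIV"
  by (simp add: law_def)

lemma law_prob: "is_density f \<Longrightarrow> prob_space (law f)"
  unfolding law_def is_density_def by (intro prob_spaceI) (simp add: emeasure_density)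

definition proj :: "'d set \<Rightarrow> real ^ 'd::finite \<Rightarrow> 'd \<Rightarrow> real" where
  "proj I x = (\<lambda>i\<in>I. x $ i)"

lemma proj_measurable [measurable]: "proj I \<in> borel \<rightarrow>\<^sub>M PiR I"
  unfolding proj_def[abs_def] by (rule measurable_restrict) simp

lemma embed_measurable [measurable]: "(\<lambda>y. \<chi> i. y i) \<in> PiR I \<rightarrow>\<^sub>M (borel :: (real ^ 'd::finite) measure)"
proof (rule vec_lambda_measurable')
  fix i :: 'd
  show "(\<lambda>y. y i) \<in> borel_measurable (PiR I)"
  proof (cases "i \<in> I")
    case True
    then show ?thesis using measurable_component_singleton[of i I "\<lambda>_. lborel"] by simp
  next
    case False
    then have "(\<lambda>y. y i) \<in> borel_measurable (PiR I) \<longleftrightarrow> (\<lambda>y. undefined::real) \<in> borel_measurable (PiR I)"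
      by (intro measurable_cong) (auto simp: space_PiM PiE_def extensional_def)
    then show ?thesis by simp
  qed
qed

lemma distr_proj_law:
  assumes f: "is_density f"
  shows "distr (law f) (PiR I) (proj I) = density (PiR I) (\<lambda>y. marginal f I (\<chi> i. y i))"
proof (rule measure_eqI)
  have [measurable]: "f \<in> borel_measurable borel" using f by (simp add: is_density_def)
  fix A assume "A \<in> sets (distr (law f) (PiR I) (proj I))"
  then have A[measurable]: "A \<in> sets (PiR I)" by simp
  let ?\<phi> = "\<lambda>x. indicator A (proj I x) :: ennreal"
  have dep: "depends_on I ?\<phi>"
    unfolding depends_on_def proj_def by (metis (mono_tags, lifting) restrict_ext)
  have "emeasure (distr (law f) (PiR I) (proj I)) A = (\<integral>\<^sup>+x. ?\<phi> x * ennreal (f x) \<partial>lborel)"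
  proof -
    have "emeasure (distr (law f) (PiR I) (proj I)) A = (\<integral>\<^sup>+x. ?\<phi> x \<partial>law f)"
      by (subst nn_integral_distr[symmetric, of "proj I" "law f" "PiR I" "indicator A"]) auto
    also have "\<dots> = (\<integral>\<^sup>+x. ?\<phi> x * ennreal (f x) \<partial>lborel)"
      unfolding law_def by (subst nn_integral_density) (auto simp: mult.commute)
    finally show ?thesis .
  qed
  also have "\<dots> = (\<integral>\<^sup>+y. ?\<phi> (\<chi> i. y i) * marginal f I (\<chi> i. y i) \<partial>PiR I)"
    by (rule nn_integral_marginal[OF _ _ dep]) auto
  also have "\<dots> = (\<integral>\<^sup>+y. marginal f I (\<chi> i. y i) * indicator A y \<partial>PiR I)"
    by (rule nn_integral_cong) (auto simp: proj_def space_PiM PiE_restrict mult.commute)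
  also have "\<dots> = emeasure (density (PiR I) (\<lambda>y. marginal f I (\<chi> i. y i))) A"
    by (subst emeasure_density) auto
  finally show "emeasure (distr (law f) (PiR I) (proj I)) A = emeasure (density (PiR I) (\<lambda>y. marginal f I (\<chi> i. y i))) A" .
qed simp

text \<open>Finiteness of the marginal allows the extended-valued density of the projected law to be
  replaced by a real one, so that signed integrands are covered.\<close>

lemma integral_law:
  fixes \<phi> :: "real ^ 'd::finite \<Rightarrow> real"
  assumes f: "is_density f" and [measurable]: "\<phi> \<in> borel_measurable borel"
    and dep: "depends_on I \<phi>" and fin: "\<And>x. marginal f I x < \<infinity>"
  shows "(\<integral>x. \<phi> x \<partial>law f) = (\<integral>y. enn2real (marginal f I (\<chi> i. y i)) * \<phi> (\<chi> i. y i) \<partial>PiR I)"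
proof -
  have [measurable]: "f \<in> borel_measurable borel" using f by (simp add: is_density_def)
  have "\<phi> (\<chi> i. proj I x i) = \<phi> x" for x
    by (rule depends_onD[OF dep]) (simp add: proj_def)
  then have "(\<integral>x. \<phi> x \<partial>law f) = (\<integral>x. \<phi> (\<chi> i. proj I x i) \<partial>law f)" by simp
  also have "\<dots> = (\<integral>y. \<phi> (\<chi> i. y i) \<partial>distr (law f) (PiR I) (proj I))"
    by (subst integral_distr) auto
  also have "\<dots> = (\<integral>y. \<phi> (\<chi> i. y i) \<partial>density (PiR I) (\<lambda>y. ennreal (enn2real (marginal f I (\<chi> i. y i)))))"
    using fin by (simp add: distr_proj_law[OF f] less_top)
  also have "\<dots> = (\<integral>y. enn2real (marginal f I (\<chi> i. y i)) * \<phi> (\<chi> i. y i) \<partial>PiR I)"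
    by (subst integral_real_density) auto
  finally show ?thesis .
qed

text \<open>The measures are compared on product boxes, where the one-dimensional scaling of
  Lebesgue measure applies to each side of the box. Later \<open>c\<close> is the point x0 and
  \<open>w\<close> a bandwidth.\<close>

lemma PiR_affine:
  fixes w c :: "'d::finite \<Rightarrow> real"
  assumes w: "\<And>i. i \<in> I \<Longrightarrow> 0 < w i"
  shows "PiR I = density (distr (PiR I) (PiR I) (\<lambda>u. \<lambda>i\<in>I. c i + w i * u i)) (\<lambda>_. ennreal (\<Prod>i\<in>I. w i))"
proof (rule PiR.PiM_eqI[symmetric])
  have [measurable]: "(\<lambda>u. \<lambda>i\<in>I. c i + w i * u i) \<in> PiR I \<rightarrow>\<^sub>M PiR I"
    by (rule measurable_restrict) (auto intro!: borel_measurable_add borel_measurable_times measurable_component_singleton simp: measurable_lborel1)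
  fix A :: "'d \<Rightarrow> real set" assume A: "\<And>i. i \<in> I \<Longrightarrow> A i \<in> sets lborel"
  have AP: "Pi\<^sub>E I A \<in> sets (PiR I)" using A by (intro sets_PiM_I_finite) auto
  have pre: "(\<lambda>u. \<lambda>i\<in>I. c i + w i * u i) -` Pi\<^sub>E I A \<inter> space (PiR I) = (\<Pi>\<^sub>E i\<in>I. (\<lambda>u. c i + w i * u) -` A i)"
    by (auto simp: space_PiM PiE_iff)
  have one: "emeasure lborel (A i) = ennreal (w i) * emeasure lborel ((\<lambda>u. c i + w i * u) -` A i)" if "i \<in> I" for i
  proof -
    have "emeasure lborel (A i) = emeasure (density (distr lborel borel (\<lambda>x. c i + w i * x)) (\<lambda>_. ennreal \<bar>w i\<bar>)) (A i)"
      by (subst lborel_real_affine[of "w i" "c i"]) (use w[OF that] in auto)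
    also have "\<dots> = ennreal (w i) * emeasure (distr lborel borel (\<lambda>x. c i + w i * x)) (A i)"
      using A[OF that] w[OF that] by (subst emeasure_density_const) auto
    also have "emeasure (distr lborel borel (\<lambda>x. c i + w i * x)) (A i) = emeasure lborel ((\<lambda>u. c i + w i * u) -` A i)"
      using A[OF that] by (subst emeasure_distr) auto
    finally show ?thesis .
  qed
  have "emeasure (density (distr (PiR I) (PiR I) (\<lambda>u. \<lambda>i\<in>I. c i + w i * u i)) (\<lambda>_. ennreal (\<Prod>i\<in>I. w i))) (Pi\<^sub>E I A)
     = ennreal (\<Prod>i\<in>I. w i) * emeasure (PiR I) (\<Pi>\<^sub>E i\<in>I. (\<lambda>u. c i + w i * u) -` A i)"
    using AP by (subst emeasure_density_const) (auto simp: emeasure_distr pre)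
  also have "\<dots> = ennreal (\<Prod>i\<in>I. w i) * (\<Prod>i\<in>I. emeasure lborel ((\<lambda>u. c i + w i * u) -` A i))"
  proof (subst PiR.emeasure_PiM)
    fix i assume "i \<in> I"
    have "(\<lambda>u. c i + w i * u) \<in> borel_measurable borel" by measurable
    from measurable_sets[OF this, of "A i"] show "(\<lambda>u. c i + w i * u) -` A i \<in> sets lborel"
      using A[OF \<open>i \<in> I\<close>] by simp
  qed auto
  also have "\<dots> = (\<Prod>i\<in>I. ennreal (w i) * emeasure lborel ((\<lambda>u. c i + w i * u) -` A i))"
    using w by (subst prod_ennreal[symmetric]) (auto simp: prod.distrib less_imp_le)
  also have "\<dots> = (\<Prod>i\<in>I. emeasure lborel (A i))" using one by simp
  finally show "emeasure (density (distr (PiR I) (PiR I) (\<lambda>u. \<lambda>i\<in>I. c i + w i * u i)) (\<lambda>_. ennreal (\<Prod>i\<in>I. w i))) (Pi\<^sub>E I A)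
     = (\<Prod>i\<in>I. emeasure lborel (A i))" .
qed simp_all

lemma integral_PiR_affine:
  fixes \<psi> :: "('d::finite \<Rightarrow> real) \<Rightarrow> real"
  assumes w: "\<And>i. i \<in> I \<Longrightarrow> 0 < w i" and [measurable]: "\<psi> \<in> borel_measurable (PiR I)"
  shows "(\<integral>y. \<psi> y \<partial>PiR I) = (\<Prod>i\<in>I. w i) * (\<integral>u. \<psi> (\<lambda>i\<in>I. c i + w i * u i) \<partial>PiR I)"
proof -
  have [measurable]: "(\<lambda>u. \<lambda>i\<in>I. c i + w i * u i) \<in> PiR I \<rightarrow>\<^sub>M PiR I"
    by (rule measurable_restrict) (auto intro!: borel_measurable_add borel_measurable_times measurable_component_singleton simp: measurable_lborel1)
  have w0: "0 \<le> (\<Prod>i\<in>I. w i)" using w by (intro prod_nonneg) (auto simp: less_imp_le)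
  have "(\<integral>y. \<psi> y \<partial>PiR I) = (\<integral>y. \<psi> y \<partial>density (distr (PiR I) (PiR I) (\<lambda>u. \<lambda>i\<in>I. c i + w i * u i)) (\<lambda>_. ennreal (\<Prod>i\<in>I. w i)))"
    by (rule arg_cong[OF PiR_affine[of I w c, OF w], of "\<lambda>M. integral\<^sup>L M \<psi>"])
  also have "\<dots> = (\<integral>y. (\<Prod>i\<in>I. w i) * \<psi> y \<partial>distr (PiR I) (PiR I) (\<lambda>u. \<lambda>i\<in>I. c i + w i * u i))"
    by (subst integral_real_density) (use w0 in auto)
  also have "\<dots> = (\<Prod>i\<in>I. w i) * (\<integral>u. \<psi> (\<lambda>i\<in>I. c i + w i * u i) \<partial>PiR I)"
    by (subst integral_distr) auto
  finally show ?thesis .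
qed

section \<open>Factorisation of integrals over independent blocks\<close>

lemma nn_integral_PiR_blocks:
  fixes \<phi> :: "'d::finite set \<Rightarrow> real ^ 'd \<Rightarrow> ennreal"
  assumes "finite P" "disjoint P"
    and "\<And>I. I \<in> P \<Longrightarrow> \<phi> I \<in> borel_measurable borel" "\<And>I. I \<in> P \<Longrightarrow> depends_on I (\<phi> I)"
  shows "(\<integral>\<^sup>+y. (\<Prod>I\<in>P. \<phi> I (\<chi> i. y i)) \<partial>PiR (\<Union>P)) = (\<Prod>I\<in>P. \<integral>\<^sup>+y. \<phi> I (\<chi> i. y i) \<partial>PiR I)"
  using assms
proof (induction P rule: finite_induct)
  case empty
  then show ?case by (simp add: PiM_empty nn_integral_count_space_finite)
next
  case (insert I P)
  have d: "disjoint P" using insert.prems(1) by (simp add: pairwise_insert)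
  have dI: "J \<inter> I = {}" if "J \<in> P" for J
  proof -
    have "J \<noteq> I" using that insert.hyps(2) by auto
    with that show ?thesis by (intro disjointD[OF insert.prems(1)]) simp_all
  qed
  have IP: "I \<inter> \<Union>P = {}" using dI by blast
  note m[measurable] = insert.prems(2)
  have mP: "(\<lambda>y. \<Prod>J\<in>P. \<phi> J (\<chi> i. y i)) \<in> borel_measurable (PiR A)" for A
    using m by (intro borel_measurable_prod_ennreal measurable_compose[OF embed_measurable]) auto
  have mI: "(\<lambda>y. \<phi> I (\<chi> i. y i)) \<in> borel_measurable (PiR A)" for A
    using m[of I] by measurable
  have "(\<integral>\<^sup>+y. (\<Prod>J\<in>insert I P. \<phi> J (\<chi> i. y i)) \<partial>PiR (\<Union>(insert I P)))
      = (\<integral>\<^sup>+y. \<phi> I (\<chi> i. y i) * (\<Prod>J\<in>P. \<phi> J (\<chi> i. y i)) \<partial>PiR (I \<union> \<Union>P))"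
    using insert.hyps by simp
  also have "\<dots> = (\<integral>\<^sup>+x. (\<integral>\<^sup>+y. \<phi> I (\<chi> i. merge I (\<Union>P) (x, y) i) * (\<Prod>J\<in>P. \<phi> J (\<chi> i. merge I (\<Union>P) (x, y) i)) \<partial>PiR (\<Union>P)) \<partial>PiR I)"
    by (rule PiR.product_nn_integral_fold) (auto simp: IP intro!: borel_measurable_times mP mI)
  also have "\<dots> = (\<integral>\<^sup>+x. (\<integral>\<^sup>+y. \<phi> I (\<chi> i. x i) * (\<Prod>J\<in>P. \<phi> J (\<chi> i. y i)) \<partial>PiR (\<Union>P)) \<partial>PiR I)"
  proof (intro nn_integral_cong arg_cong2[where f = "(*)"] prod.cong refl)
    fix x y :: "'d \<Rightarrow> real"
    show "\<phi> I (\<chi> i. merge I (\<Union>P) (x, y) i) = \<phi> I (\<chi> i. x i)"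
      by (rule depends_onD[OF insert.prems(3)]) (auto simp: merge_def)
    fix J assume J: "J \<in> P"
    show "\<phi> J (\<chi> i. merge I (\<Union>P) (x, y) i) = \<phi> J (\<chi> i. y i)"
    proof (rule depends_onD[OF insert.prems(3)])
      fix i assume "i \<in> J"
      then have "i \<notin> I" "i \<in> \<Union>P" using dI[OF J] J by auto
      then show "(\<chi> i. merge I (\<Union>P) (x, y) i) $ i = (\<chi> i. y i) $ i" by (simp add: merge_def)
    qed (use J in auto)
  qed
  also have "\<dots> = (\<integral>\<^sup>+x. \<phi> I (\<chi> i. x i) * (\<integral>\<^sup>+y. (\<Prod>J\<in>P. \<phi> J (\<chi> i. y i)) \<partial>PiR (\<Union>P)) \<partial>PiR I)"
    by (intro nn_integral_cong nn_integral_cmult mP)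
  also have "\<dots> = (\<integral>\<^sup>+x. \<phi> I (\<chi> i. x i) \<partial>PiR I) * (\<integral>\<^sup>+y. (\<Prod>J\<in>P. \<phi> J (\<chi> i. y i)) \<partial>PiR (\<Union>P))"
    by (rule nn_integral_multc[OF mI])
  finally show ?case using insert by (simp add: d)
qed

lemma nn_integral_law_prod:
  fixes \<phi> :: "'d::finite set \<Rightarrow> real ^ 'd \<Rightarrow> ennreal"
  assumes f: "is_density f" and P: "P \<in> indep_partitions f"
    and m: "\<And>I. I \<in> P \<Longrightarrow> \<phi> I \<in> borel_measurable borel" and dep: "\<And>I. I \<in> P \<Longrightarrow> depends_on I (\<phi> I)"
  shows "(\<integral>\<^sup>+x. (\<Prod>I\<in>P. \<phi> I x) \<partial>law f) = (\<Prod>I\<in>P. \<integral>\<^sup>+x. \<phi> I x \<partial>law f)"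
proof -
  have [measurable]: "f \<in> borel_measurable borel" using f by (simp add: is_density_def)
  have part: "partition_on UNIV P" and ff: "\<And>x. ennreal (f x) = (\<Prod>I\<in>P. marginal f I x)"
    using P by (auto simp: indep_partitions_def)
  have fin: "finite P" by simp
  have mP: "(\<lambda>x. \<Prod>I\<in>P. \<phi> I x) \<in> borel_measurable borel"
    using m by (intro borel_measurable_prod_ennreal) auto
  have law: "(\<integral>\<^sup>+x. \<psi> x \<partial>law f) = (\<integral>\<^sup>+x. \<psi> x * ennreal (f x) \<partial>lborel)" if [measurable]: "\<psi> \<in> borel_measurable borel" for \<psi>
    unfolding law_def by (subst nn_integral_density) (auto simp: mult.commute)
  let ?\<psi> = "\<lambda>I x. \<phi> I x * marginal f I x"
  have m\<psi>: "?\<psi> I \<in> borel_measurable borel" if "I \<in> P" for I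
    using m[OF that] by measurable
  have dep\<psi>: "depends_on I (?\<psi> I)" if "I \<in> P" for I
    using dep[OF that] marginal_depends[of I f] unfolding depends_on_def by metis
  have "(\<integral>\<^sup>+x. (\<Prod>I\<in>P. \<phi> I x) \<partial>law f) = (\<integral>\<^sup>+x. (\<Prod>I\<in>P. ?\<psi> I x) \<partial>lborel)"
    by (simp add: law[OF mP] ff prod.distrib)
  also have "\<dots> = (\<integral>\<^sup>+y. (\<Prod>I\<in>P. ?\<psi> I (\<chi> i. y i)) \<partial>PiR (\<Union>P))"
    using part m\<psi> unfolding lborel_vec
    by (subst nn_integral_distr) (auto simp: partition_on_def intro!: borel_measurable_prod_ennreal)
  also have "\<dots> = (\<Prod>I\<in>P. \<integral>\<^sup>+y. ?\<psi> I (\<chi> i. y i) \<partial>PiR I)"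
    using part by (intro nn_integral_PiR_blocks m\<psi> dep\<psi>) (auto simp: partition_on_def)
  also have "\<dots> = (\<Prod>I\<in>P. \<integral>\<^sup>+x. \<phi> I x \<partial>law f)"
    by (intro prod.cong refl) (simp add: law m nn_integral_marginal[OF _ m dep])
  finally show ?thesis .
qed

text \<open>For signed functions the argument is probabilistic: applied to indicators of preimages,
  the nonnegative version says that the variables \<open>g I\<close> are independent, and the
  expectation of a product of independent integrable variables factorises.\<close>

lemma integral_law_prod:
  fixes g :: "'d::finite set \<Rightarrow> real ^ 'd \<Rightarrow> real"
  assumes f: "is_density f" and P: "P \<in> indep_partitions f"
    and m: "\<And>I. I \<in> P \<Longrightarrow> g I \<in> borel_measurable borel" and dep: "\<And>I. I \<in> P \<Longrightarrow> depends_on I (g I)"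
    and bnd: "\<And>I x. I \<in> P \<Longrightarrow> \<bar>g I x\<bar> \<le> b"
  shows "(\<integral>x. (\<Prod>I\<in>P. g I x) \<partial>law f) = (\<Prod>I\<in>P. \<integral>x. g I x \<partial>law f)"
proof -
  interpret prob_space "law f" by (rule law_prob[OF f])
  have part: "partition_on UNIV P" using P by (auto simp: indep_partitions_def)
  then have Pne: "P \<noteq> {}" by (auto simp: partition_on_def)
  have fin: "finite P" by simp
  have "indep_vars (\<lambda>_. borel) g P"
    unfolding indep_vars_def2
  proof (intro conjI ballI)
    show "random_variable borel (g I)" if "I \<in> P" for I using m[OF that] by simp
    show "indep_sets (\<lambda>I. {g I -` A \<inter> space (law f) |A. A \<in> sets borel}) P"
    proof (subst indep_sets_finite[OF Pne fin])
      show "{g I -` A \<inter> space (law f) |A. A \<in> sets borel} \<subseteq> events" if "I \<in> P" for I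
        using m[OF that] by (auto simp: measurable_def)
      show "space (law f) \<in> {g I -` A \<inter> space (law f) |A. A \<in> sets borel}" for I
        by (auto intro!: exI[of _ UNIV])
      show "\<forall>B\<in>\<Pi> I\<in>P. {g I -` A \<inter> space (law f) |A. A \<in> sets borel}. prob (\<Inter>I\<in>P. B I) = (\<Prod>I\<in>P. prob (B I))"
      proof
        fix B assume B0: "B \<in> (\<Pi> I\<in>P. {g I -` A \<inter> space (law f) |A. A \<in> sets borel})"
        have "\<exists>A. A \<in> sets borel \<and> B I = g I -` A" if "I \<in> P" for I
          using Pi_mem[OF B0 that] by auto
        then have "\<forall>I. \<exists>A. I \<in> P \<longrightarrow> A \<in> sets borel \<and> B I = g I -` A" by blast
        from choice[OF this] obtain A where A: "\<And>I. I \<in> P \<Longrightarrow> A I \<in> sets borel \<and> B I = g I -` A I" by blast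
        have B: "B I \<in> sets borel" if "I \<in> P" for I
          using A[OF that] measurable_sets[OF m[OF that], of "A I"] by simp
        let ?\<phi> = "\<lambda>I. indicator (B I) :: real ^ 'd \<Rightarrow> ennreal"
        have depB: "depends_on I (?\<phi> I)" if "I \<in> P" for I
        proof -
          have "x \<in> B I \<longleftrightarrow> y \<in> B I" if "\<forall>i\<in>I. x $ i = y $ i" for x y
            using depends_onD[OF dep[OF \<open>I \<in> P\<close>], of x y] that A[OF \<open>I \<in> P\<close>] by auto
          then show ?thesis unfolding depends_on_def indicator_def by auto
        qed
        have "emeasure (law f) (\<Inter>I\<in>P. B I) = (\<integral>\<^sup>+x. (\<Prod>I\<in>P. ?\<phi> I x) \<partial>law f)"
        proof -
          have "(\<Inter>I\<in>P. B I) \<in> sets borel" using B fin Pne by (intro sets.finite_INT) auto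
          moreover have "(\<Prod>I\<in>P. ?\<phi> I x) = indicator (\<Inter>I\<in>P. B I) x" for x
            by (auto simp: indicator_def prod_zero_iff)
          ultimately show ?thesis by simp
        qed
        also have "\<dots> = (\<Prod>I\<in>P. \<integral>\<^sup>+x. ?\<phi> I x \<partial>law f)"
          using B by (intro nn_integral_law_prod[OF f P] depB) auto
        also have "\<dots> = (\<Prod>I\<in>P. emeasure (law f) (B I))" using B by simp
        finally show "prob (\<Inter>I\<in>P. B I) = (\<Prod>I\<in>P. prob (B I))"
          by (simp add: emeasure_eq_measure prod_ennreal prod_nonneg ennreal_inj)
      qed
    qed
  qed
  then show ?thesis
  proof (rule indep_vars_lebesgue_integral[OF fin])
    show "integrable (law f) (g I)" if "I \<in> P" for I
      by (rule integrable_const_bound[where B = b]) (use m[OF that] bnd[OF that] in auto)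
  qed
qed

section \<open>Size of the threshold constant\<close>

text \<open>The derivative is (1 + ln t)^2, strictly positive because ln t < -1 below 1 / 72. Hence
  the equation defining \<open>delta_star\<close> has at most one solution in this range.\<close>

lemma delta_star_mono:
  fixes x y :: real
  assumes "0 < x" "x < y" "y \<le> 1 / 72"
  shows "x * (1 + (ln x)\<^sup>2) < y * (1 + (ln y)\<^sup>2)"
proof (rule DERIV_pos_imp_increasing[OF assms(2)])
  fix t assume t: "x \<le> t" "t \<le> y"
  then have t0: "0 < t" "t \<le> 1 / 72" using assms by auto
  have "ln t \<le> ln (1 / 72)" using t0 by simp
  also have "\<dots> < -1"
  proof -
    have "exp (1::real) < 72" using exp_le by linarith
    then have "1 < ln (72::real)" by (metis exp_gt_zero ln_exp ln_less_cancel_iff zero_less_numeral)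
    then show ?thesis by (simp add: ln_div)
  qed
  finally have l: "ln t < -1" .
  have "((\<lambda>t. t * (1 + (ln t)\<^sup>2)) has_real_derivative (1 + ln t)\<^sup>2) (at t)"
    using t0 by (auto intro!: derivative_eq_intros simp: power2_eq_square field_simps)
  moreover have "0 < (1 + ln t)\<^sup>2" using l by simp
  ultimately show "\<exists>d. ((\<lambda>t. t * (1 + (ln t)\<^sup>2)) has_real_derivative d) (at t) \<and> 0 < d" by blast
qed

text \<open>\<open>LEAST\<close> is informative only once a smallest solution is known to exist.
  Every solution is at most 1 / 72, since pi^2 \<ge> 9 and the logarithmic factor is at least 1; the
  intermediate value theorem provides one and monotonicity makes it least.\<close>

lemma delta_star_bounds: "0 < delta_star" "delta_star \<le> 1 / 72"
proof -
  let ?S = "\<lambda>\<delta>::real. 0 < \<delta> \<and> 8 * pi\<^sup>2 * \<delta> * (1 + (ln \<delta>)\<^sup>2) = 1"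
  have pi9: "9 \<le> pi\<^sup>2"
  proof -
    have "3\<^sup>2 \<le> pi\<^sup>2" using pi_gt3 by (intro power_mono) auto
    then show ?thesis by simp
  qed
  have pi16: "pi\<^sup>2 \<le> 16"
  proof -
    have "pi\<^sup>2 \<le> 4\<^sup>2" using pi_less_4 by (intro power_mono) auto
    then show ?thesis by simp
  qed
  have le: "\<delta> \<le> 1 / 72" if "?S \<delta>" for \<delta>
  proof -
    have "72 * \<delta> \<le> 8 * pi\<^sup>2 * \<delta>" using that pi9 by simp
    also have "\<dots> * 1 \<le> 8 * pi\<^sup>2 * \<delta> * (1 + (ln \<delta>)\<^sup>2)" using that by (intro mult_left_mono) auto
    finally show ?thesis using that by simp
  qed
  \<comment> \<open>At the left end point, pi^2 \<le> 16 and ln 2 < 1 bound the expression by 8 * 16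
    * 401 / 2^20, which is below 1.\<close>
  have "\<exists>\<delta>. 1 / 2 ^ 20 \<le> \<delta> \<and> \<delta> \<le> 1 \<and> 8 * pi\<^sup>2 * \<delta> * (1 + (ln \<delta>)\<^sup>2) = 1"
  proof (rule IVT)
    have "ln (2 ^ 20 :: real) = real 20 * ln 2" by (rule ln_realpow)
    then have "ln (1 / 2 ^ 20 :: real) = - (20 * ln 2)"
      using ln_inverse[of "2 ^ 20 :: real"] by (simp only: inverse_eq_divide)
    then have "(ln (1 / 2 ^ 20 :: real))\<^sup>2 = 400 * (ln 2)\<^sup>2" by (simp add: power_mult_distrib)
    also have "\<dots> \<le> 400 * 1\<^sup>2" using ln_2_less_1 by (intro mult_left_mono power_mono) auto
    finally have "8 * pi\<^sup>2 * (1 / 2 ^ 20) * (1 + (ln (1 / 2 ^ 20))\<^sup>2) \<le> 8 * 16 * (1 / 2 ^ 20) * (1 + 400)"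
      using pi16 by (intro mult_mono) auto
    then show "8 * pi\<^sup>2 * (1 / 2 ^ 20) * (1 + (ln (1 / 2 ^ 20))\<^sup>2) \<le> 1" by simp
    show "1 \<le> 8 * pi\<^sup>2 * 1 * (1 + (ln 1)\<^sup>2)" using pi9 by simp
    show "\<forall>x. 1 / 2 ^ 20 \<le> x \<and> x \<le> 1 \<longrightarrow> isCont (\<lambda>\<delta>. 8 * pi\<^sup>2 * \<delta> * (1 + (ln \<delta>)\<^sup>2)) x"
    proof (intro allI impI)
      fix x :: real assume "1 / 2 ^ 20 \<le> x \<and> x \<le> 1"
      then have "0 < x" by (auto intro: less_le_trans[rotated])
      then show "isCont (\<lambda>\<delta>. 8 * pi\<^sup>2 * \<delta> * (1 + (ln \<delta>)\<^sup>2)) x" by (intro continuous_intros) auto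
    qed
  qed simp
  then obtain \<delta> where \<delta>1: "1 / 2 ^ 20 \<le> \<delta>" "8 * pi\<^sup>2 * \<delta> * (1 + (ln \<delta>)\<^sup>2) = 1" by blast
  have "0 < (1 / 2 ^ 20 :: real)" by simp
  then have \<delta>: "?S \<delta>" using \<delta>1 less_le_trans by blast
  have least: "\<delta> \<le> \<delta>'" if "?S \<delta>'" for \<delta>'
  proof (rule ccontr)
    assume "\<not> \<delta> \<le> \<delta>'"
    then have "\<delta>' * (1 + (ln \<delta>')\<^sup>2) < \<delta> * (1 + (ln \<delta>)\<^sup>2)"
      using that le[OF \<delta>] by (intro delta_star_mono) auto
    then have "8 * pi\<^sup>2 * (\<delta>' * (1 + (ln \<delta>')\<^sup>2)) < 8 * pi\<^sup>2 * (\<delta> * (1 + (ln \<delta>)\<^sup>2))"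
      using pi9 by (intro mult_strict_left_mono) auto
    then have "8 * pi\<^sup>2 * \<delta>' * (1 + (ln \<delta>')\<^sup>2) < 8 * pi\<^sup>2 * \<delta> * (1 + (ln \<delta>)\<^sup>2)"
      by (simp only: mult.assoc)
    then show False using that \<delta> by linarith
  qed
  have "delta_star = \<delta>"
    unfolding delta_star_def
  proof (rule Least_equality)
    show "\<delta> \<le> \<delta>'" if "?S \<delta>'" for \<delta>' by (rule least[OF that])
  qed (rule \<delta>)
  then show "0 < delta_star" "delta_star \<le> 1 / 72" using \<delta> le[OF \<delta>] by auto
qed

lemma log_square_over_bounded:
  fixes c \<delta> :: real
  assumes "0 < c" "c < \<delta>"
  shows "(1 + (ln \<delta>)\<^sup>2) / \<delta> \<le> 5 + (1 + (ln c)\<^sup>2) / c"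
proof (cases "1 \<le> \<delta>")
  case True
  have "ln \<delta> = 2 * ln (sqrt \<delta>)" using True by (simp add: ln_sqrt)
  also have "\<dots> \<le> 2 * sqrt \<delta>" using ln_bound[of "sqrt \<delta>"] True by simp
  finally have "(ln \<delta>)\<^sup>2 \<le> (2 * sqrt \<delta>)\<^sup>2" using True by (intro power_mono) auto
  then have "1 + (ln \<delta>)\<^sup>2 \<le> 5 * \<delta>" using True by (simp add: power_mult_distrib)
  then have "(1 + (ln \<delta>)\<^sup>2) / \<delta> \<le> 5" using True by (simp add: pos_divide_le_eq)
  moreover have "0 \<le> (1 + (ln c)\<^sup>2) / c" using assms by simp
  ultimately show ?thesis by linarith
next
  case False
  have "ln c \<le> ln \<delta>" "ln \<delta> \<le> 0" using assms False by auto
  then have "(ln \<delta>)\<^sup>2 \<le> (ln c)\<^sup>2" by (simp add: abs_le_square_iff[symmetric])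
  then have "(1 + (ln \<delta>)\<^sup>2) / \<delta> \<le> (1 + (ln c)\<^sup>2) / c"
    using assms by (intro frac_le) auto
  then show ?thesis by simp
qed

text \<open>A real supremum over an unbounded family is unspecified, so even nonnegativity needs an
  upper bound for the family. Both logarithms are at most 2 Y, and Y / \<delta>^2 is a multiple of
  (1 + (ln \<delta>)^2) / \<delta>, which is bounded for \<delta> above
  \<open>delta_star\<close>.\<close>

lemma C_entropy_nonneg: "0 \<le> C_entropy s"
proof -
  define c where "c = delta_star"
  have c: "0 < c" unfolding c_def by (rule delta_star_bounds)
  define Y where "Y \<delta> = 9216 * (real s + 1) * \<delta> / s_star \<delta>" for \<delta> :: real
  have ss: "0 < s_star \<delta>" for \<delta> unfolding s_star_def by (intro divide_pos_pos add_pos_nonneg) auto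
  have Y0: "0 < Y \<delta>" if "0 < \<delta>" for \<delta> unfolding Y_def using that ss by simp
  have Ys: "9216 * (real s + 1) * \<delta>\<^sup>2 / (s_star \<delta>)\<^sup>2 \<le> (Y \<delta>)\<^sup>2" if "0 < \<delta>" for \<delta>
  proof -
    have "(9216 * (real s + 1)) * 1 \<le> (9216 * (real s + 1)) * (9216 * (real s + 1))"
      by (intro mult_left_mono) auto
    then have "9216 * (real s + 1) * (\<delta>\<^sup>2 / (s_star \<delta>)\<^sup>2) \<le> (9216 * (real s + 1))\<^sup>2 * (\<delta>\<^sup>2 / (s_star \<delta>)\<^sup>2)"
      by (intro mult_right_mono) (auto simp: power2_eq_square)
    then show ?thesis by (simp add: Y_def power_mult_distrib power_divide)
  qed
  define Bd where "Bd = 1 / c\<^sup>2 + 2 * (9216 * (real s + 1) * (pi\<^sup>2 / 6) * (5 + (1 + (ln c)\<^sup>2) / c))"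
  have key: "(1 + 2 * Y \<delta>) / \<delta>\<^sup>2 \<le> Bd" if "c < \<delta>" for \<delta>
  proof -
    have d0: "0 < \<delta>" using c that by simp
    have "Y \<delta> / \<delta>\<^sup>2 = 9216 * (real s + 1) * (pi\<^sup>2 / 6) * ((1 + (ln \<delta>)\<^sup>2) / \<delta>)"
      using d0 by (simp add: Y_def s_star_def power2_eq_square)
    also have "\<dots> \<le> 9216 * (real s + 1) * (pi\<^sup>2 / 6) * (5 + (1 + (ln c)\<^sup>2) / c)"
      by (intro mult_left_mono log_square_over_bounded c that) auto
    finally have 1: "Y \<delta> / \<delta>\<^sup>2 \<le> 9216 * (real s + 1) * (pi\<^sup>2 / 6) * (5 + (1 + (ln c)\<^sup>2) / c)" .
    have 2: "1 / \<delta>\<^sup>2 \<le> 1 / c\<^sup>2" using c that by (intro divide_left_mono power_mono) auto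
    have "(1 + 2 * Y \<delta>) / \<delta>\<^sup>2 = 1 / \<delta>\<^sup>2 + 2 * (Y \<delta> / \<delta>\<^sup>2)" by (simp add: add_divide_distrib)
    then show ?thesis unfolding Bd_def using 1 2 by linarith
  qed
  have pos: "0 \<le> (SUP \<delta>\<in>{c<..}. max 0 (1 + ln (Z \<delta>)) / \<delta>\<^sup>2)"
    if Z: "\<And>\<delta>. c < \<delta> \<Longrightarrow> ln (Z \<delta>) \<le> 2 * Y \<delta>" for Z
  proof -
    have bd: "bdd_above ((\<lambda>\<delta>. max 0 (1 + ln (Z \<delta>)) / \<delta>\<^sup>2) ` {c<..})"
    proof (rule bdd_aboveI2)
      fix \<delta> assume "\<delta> \<in> {c<..}"
      then have d: "c < \<delta>" by simp
      have "max 0 (1 + ln (Z \<delta>)) / \<delta>\<^sup>2 \<le> (1 + 2 * Y \<delta>) / \<delta>\<^sup>2"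
        using Z[OF d] Y0[of \<delta>] c d by (intro divide_right_mono) auto
      also have "\<dots> \<le> Bd" by (rule key[OF d])
      finally show "max 0 (1 + ln (Z \<delta>)) / \<delta>\<^sup>2 \<le> Bd" .
    qed
    have "0 \<le> max 0 (1 + ln (Z (c + 1))) / (c + 1)\<^sup>2" by simp
    also have "\<dots> \<le> (SUP \<delta>\<in>{c<..}. max 0 (1 + ln (Z \<delta>)) / \<delta>\<^sup>2)"
      by (rule cSUP_upper[OF _ bd]) simp
    finally show ?thesis .
  qed
  have "0 \<le> (SUP \<delta>\<in>{c<..}. max 0 (1 + ln (9216 * (real s + 1) * \<delta>\<^sup>2 / (s_star \<delta>)\<^sup>2)) / \<delta>\<^sup>2)"
  proof (rule pos)
    fix \<delta> assume "c < \<delta>"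
    then have d0: "0 < \<delta>" using c by simp
    have "0 < 9216 * (real s + 1) * \<delta>\<^sup>2 / (s_star \<delta>)\<^sup>2" using d0 ss[of \<delta>] by (auto intro!: divide_pos_pos)
    then have "ln (9216 * (real s + 1) * \<delta>\<^sup>2 / (s_star \<delta>)\<^sup>2) \<le> ln ((Y \<delta>)\<^sup>2)"
      using Ys[OF d0] by (intro ln_mono)
    also have "\<dots> = 2 * ln (Y \<delta>)" using Y0[OF d0] by (simp add: ln_realpow)
    also have "\<dots> \<le> 2 * Y \<delta>" using ln_bound[OF Y0[OF d0]] by simp
    finally show "ln (9216 * (real s + 1) * \<delta>\<^sup>2 / (s_star \<delta>)\<^sup>2) \<le> 2 * Y \<delta>" .
  qed
  moreover have "0 \<le> (SUP \<delta>\<in>{c<..}. max 0 (1 + ln (9216 * (real s + 1) * \<delta> / s_star \<delta>)) / \<delta>\<^sup>2)"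
  proof (rule pos)
    fix \<delta> assume "c < \<delta>"
    then have "0 < \<delta>" using c by simp
    then show "ln (9216 * (real s + 1) * \<delta> / s_star \<delta>) \<le> 2 * Y \<delta>"
      using ln_bound[OF Y0] Y0[of \<delta>] unfolding Y_def[symmetric] by (smt (verit))
  qed
  ultimately show ?thesis unfolding C_entropy_def c_def by simp
qed

text \<open>The summand with \<open>delta_star\<close> alone suffices: 1 / delta_star \<ge> 72, and
  746496 = 144 * 72^2.\<close>

lemma C_one_ge:
  assumes "0 \<le> q"
  shows "746496 * real s \<le> C_one q s"
proof -
  note d = delta_star_bounds
  have "72 \<le> 1 / delta_star" using d by (simp add: field_simps)
  then have "72\<^sup>2 \<le> (1 / delta_star)\<^sup>2" by (rule power_mono) simp
  then have "144 * real s * 72\<^sup>2 \<le> 144 * real s * (1 / delta_star)\<^sup>2" by (rule mult_left_mono) simp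
  then have "746496 * real s \<le> 144 * real s / delta_star\<^sup>2" by (simp add: power_divide)
  then show ?thesis using C_entropy_nonneg[of s] assms unfolding C_one_def by simp
qed

text \<open>\<open>mom_exp\<close> times the logarithmic cost is the order of the moments of the empirical processes
  that are used; \<open>lip_const\<close> is the relative Lipschitz constant of the rescaled product kernels;
  \<open>thr_const\<close> is the multiple of the standard deviation beyond which deviations are
  negligible.\<close>

definition mom_exp :: "nat \<Rightarrow> real \<Rightarrow> nat" where
  "mom_exp d q = 8 * d + nat \<lceil>(real d + 3) * q\<rceil> + 2"

definition lip_const :: "real \<Rightarrow> real \<Rightarrow> nat \<Rightarrow> real" where
  "lip_const B L d = real d * (1 + L / B)"

definition thr_const :: "real \<Rightarrow> real \<Rightarrow> real \<Rightarrow> nat \<Rightarrow> real" where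
  "thr_const B L q d = 396 * lip_const B L d * sqrt (2 * B ^ d * real (mom_exp d q))"

text \<open>The supremum is bounded below by its term at s = d. There the first factor dominates
  \<open>10 * lip_const\<close>, the second \<open>7 * sqrt ((1 + 2 * q) * B ^ d)\<close>, and
  \<open>C_one\<close> contributes 746496 d. The quantity \<open>10 * thr_const\<close> is bounded
  by the same product with numerical factor 19800 in place of 52254720.\<close>

lemma lam_ge:
  assumes B: "1 \<le> kernel_sup K" and L: "0 < L" and d: "1 \<le> d" and q: "1 \<le> q"
    and \<tau>: "\<And>s. s \<in> {1..d} \<Longrightarrow> 0 < \<tau> s"
  shows "1 \<le> lam K L \<zz> \<tau> d q" "10 * thr_const (kernel_sup K) L q d \<le> lam K L \<zz> \<tau> d q"
proof -
  define B where "B = kernel_sup K"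
  have bdd: "bdd_above ((\<lambda>s. max 1 (lam_dim K L \<zz> \<tau> d (2 * q) s)) ` {1..d})" by simp
  have up: "max 1 (lam_dim K L \<zz> \<tau> d (2 * q) d) \<le> lam K L \<zz> \<tau> d q"
    unfolding lam_def by (rule cSUP_upper[OF _ bdd]) (use d in simp)
  then show "1 \<le> lam K L \<zz> \<tau> d q" by simp
  define r where "r = sqrt ((1 + 2 * q) * B ^ d)"
  have Bd: "1 \<le> B ^ d" using B by (simp add: B_def)
  have r0: "0 \<le> r" unfolding r_def using q Bd by simp
  have inf: "0 < (INF r\<in>{1..d}. \<tau> r)"
  proof -
    have "(INF r\<in>{1..d}. \<tau> r) = Min (\<tau> ` {1..d})" using d by (intro cInf_eq_Min) auto
    then show ?thesis using \<tau> d by simp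
  qed
  have s1: "1 \<le> sqrt (3 * (2 * q) + real d * (2 * q) * max 1 \<zz> * (1 + 1 / (INF r\<in>{1..d}. \<tau> r)))"
  proof -
    have "0 \<le> real d * (2 * q) * max 1 \<zz> * (1 + 1 / (INF r\<in>{1..d}. \<tau> r))"
      using q inf by (intro mult_nonneg_nonneg) auto
    then have "1 \<le> 3 * (2 * q) + real d * (2 * q) * max 1 \<zz> * (1 + 1 / (INF r\<in>{1..d}. \<tau> r))"
      using q by linarith
    then show ?thesis by (simp only: real_sqrt_ge_1_iff)
  qed
  have LB: "0 \<le> L / B" using L B by (simp add: B_def)
  have m1: "10 * lip_const B L d \<le> max (10 * real d * exp (real d) + 10 * real d * exp 1 * L / B) (48 * exp 1)"
  proof -
    have "10 * real d * 1 \<le> 10 * real d * exp (real d)" by (intro mult_left_mono) auto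
    moreover have "10 * real d * (L / B) * 1 \<le> 10 * real d * (L / B) * exp 1"
      using LB by (intro mult_left_mono mult_nonneg_nonneg) auto
    ultimately show ?thesis by (simp add: lip_const_def algebra_simps)
  qed
  have lip0: "0 \<le> lip_const B L d" using LB by (simp add: lip_const_def)
  have m2: "7 * r \<le> sqrt 7 + 7 * sqrt ((1 + 2 * q) * kernel_sup K ^ d)" by (simp add: r_def B_def)
  have m3: "746496 * real d \<le> C_one (2 * q) d" using q by (intro C_one_ge) simp
  have base: "10 * lip_const B L d * (7 * r) * (746496 * real d) * 1 \<le> lam_base K L (2 * q) d"
    unfolding lam_base_def using m1 m2 m3 Bd lip0 r0
    by (intro mult_mono mult_nonneg_nonneg) (auto simp: B_def intro: order_trans[of 0 "10 * lip_const B L d"] order_trans[of 0 "7 * r"])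
  have base0: "0 \<le> 10 * lip_const B L d * (7 * r) * (746496 * real d) * 1" using lip0 r0 by simp
  have "1 * (10 * lip_const B L d * (7 * r) * (746496 * real d) * 1) \<le> lam_dim K L \<zz> \<tau> d (2 * q) d"
    unfolding lam_dim_def using s1 base base0 by (intro mult_mono) auto
  then have big: "10 * lip_const B L d * (7 * r) * (746496 * real d) \<le> lam K L \<zz> \<tau> d q"
    using up by simp
  \<comment> \<open>After the square root this contributes one factor d and the root of 1 + 2 q,
    both of which are present in the lower bound for \<open>lam\<close>.\<close>
  have A: "real (mom_exp d q) \<le> 11 * (real d)\<^sup>2 * (1 + 2 * q)"
  proof -
    have dq: "0 \<le> (real d + 3) * q" using q by simp
    have "real (nat \<lceil>(real d + 3) * q\<rceil>) \<le> (real d + 3) * q + 1"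
      using dq by linarith
    then have "real (mom_exp d q) \<le> 8 * real d + (real d + 3) * q + 3" by (simp add: mom_exp_def)
    also have "\<dots> \<le> 8 * real d + (real d + 3 * real d) * q + 3 * real d"
      using d q by (intro add_mono mult_right_mono) auto
    also have "\<dots> = real d * (11 + 4 * q)" by (simp add: algebra_simps)
    also have "\<dots> \<le> (real d)\<^sup>2 * (11 * (1 + 2 * q))"
      using d q by (intro mult_mono) (auto simp: power2_eq_square)
    finally show ?thesis by (simp add: algebra_simps)
  qed
  have "sqrt (2 * B ^ d * real (mom_exp d q)) \<le> sqrt ((5 * real d)\<^sup>2 * ((1 + 2 * q) * B ^ d))"
  proof (rule real_sqrt_le_mono)
    have "2 * B ^ d * real (mom_exp d q) \<le> 2 * B ^ d * (11 * (real d)\<^sup>2 * (1 + 2 * q))"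
      using Bd A by (intro mult_left_mono) auto
    also have "\<dots> = 22 * ((real d)\<^sup>2 * ((1 + 2 * q) * B ^ d))" by simp
    also have "\<dots> \<le> 25 * ((real d)\<^sup>2 * ((1 + 2 * q) * B ^ d))" using q Bd by (intro mult_right_mono) auto
    finally show "2 * B ^ d * real (mom_exp d q) \<le> (5 * real d)\<^sup>2 * ((1 + 2 * q) * B ^ d)"
      by (simp add: power_mult_distrib mult.assoc)
  qed
  also have "\<dots> = 5 * real d * r" by (simp add: real_sqrt_mult r_def)
  finally have "10 * thr_const B L q d \<le> 10 * (396 * lip_const B L d * (5 * real d * r))"
    unfolding thr_const_def using lip0 by (intro mult_left_mono) auto
  also have "\<dots> = 19800 * (lip_const B L d * r * real d)" by simp
  also have "\<dots> \<le> 52254720 * (lip_const B L d * r * real d)" using lip0 r0 by (intro mult_right_mono) auto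
  also have "\<dots> = 10 * lip_const B L d * (7 * r) * (746496 * real d)" by simp
  finally show "10 * thr_const (kernel_sup K) L q d \<le> lam K L \<zz> \<tau> d q"
    using big unfolding B_def by linarith
qed

section \<open>Rescaled product kernels\<close>

abbreviation scaled_kernel :: "(real \<Rightarrow> real) \<Rightarrow> 'd::finite set \<Rightarrow> real ^ 'd \<Rightarrow> real ^ 'd \<Rightarrow> real" where
  "scaled_kernel \<equiv> selection_rule.kernel_scaled"

lemmas scaled_kernel_def = selection_rule.kernel_scaled_def

text \<open>Weak enough to pass from a kernel to its absolute value, whose integral need not be \<open>1\<close>.\<close>

definition kernel_like :: "(real \<Rightarrow> real) \<Rightarrow> real \<Rightarrow> real \<Rightarrow> bool" where
  "kernel_like \<kappa> B L \<longleftrightarrow> (\<forall>x. \<bar>\<kappa> x\<bar> \<le> B) \<and> (\<forall>x. 1 / 2 < \<bar>x\<bar> \<longrightarrow> \<kappa> x = 0) \<and>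
     (\<forall>x y. \<bar>\<kappa> x - \<kappa> y\<bar> \<le> L * \<bar>x - y\<bar>) \<and> 1 \<le> B \<and> 0 < L"

lemma kernel_like_abs: "kernel_like \<kappa> B L \<Longrightarrow> kernel_like (\<lambda>x. \<bar>\<kappa> x\<bar>) B L"
  unfolding kernel_like_def by (fastforce intro: order_trans[OF abs_triangle_ineq3])

lemma kernel_like_measurable [measurable_dest]:
  assumes "kernel_like \<kappa> B L"
  shows "\<kappa> \<in> borel_measurable borel"
proof (rule borel_measurable_continuous_onI)
  have "L-lipschitz_on UNIV \<kappa>"
    using assms by (auto simp: lipschitz_on_def kernel_like_def dist_real_def less_imp_le)
  then show "continuous_on UNIV \<kappa>" by (rule lipschitz_on_continuous_on)
qed

lemma kernel_like_integrable:
  assumes k: "kernel_like \<kappa> B L"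
  shows "integrable lborel \<kappa>" "(\<integral>x. \<bar>\<kappa> x\<bar> \<partial>lborel) \<le> B"
proof -
  note kernel_like_measurable[OF k, measurable]
  have dom: "\<bar>\<kappa> x\<bar> \<le> B * indicator {-1/2..1/2} x" for x
    using k by (auto simp: kernel_like_def indicator_def)
  have id: "integrable lborel (\<lambda>x. B * indicator {-1/2..1/2::real} x)"
    by simp
  show i: "integrable lborel \<kappa>"
    by (rule Bochner_Integration.integrable_bound[OF id])
      (auto intro!: AE_I2 order_trans[OF dom] abs_ge_self simp del: abs_mult)
  have "(\<integral>x. \<bar>\<kappa> x\<bar> \<partial>lborel) \<le> (\<integral>x. B * indicator {-1/2..1/2::real} x \<partial>lborel)"
    using i id dom by (intro integral_mono) auto
  also have "\<dots> = B" by simp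
  finally show "(\<integral>x. \<bar>\<kappa> x\<bar> \<partial>lborel) \<le> B" .
qed

lemma kde_kernel_like:
  assumes "kde_kernel K L"
  shows "kernel_like K (kernel_sup K) L" "has_bochner_integral lborel K 1"
proof -
  have bd: "bounded (range K)" and int: "has_bochner_integral lborel K 1"
    and supp: "closure {x. K x \<noteq> 0} \<subseteq> {-1/2..1/2}" and L: "0 < L" and lip: "L-lipschitz_on UNIV K"
    using assms by (auto simp: kde_kernel_def)
  show "has_bochner_integral lborel K 1" by (rule int)
  have "bdd_above (range (\<lambda>x. \<bar>K x\<bar>))"
  proof -
    obtain a where "\<forall>x\<in>range K. norm x \<le> a" using bd unfolding bounded_iff by blast
    then show ?thesis by (intro bdd_aboveI2[where M = a]) auto
  qed
  then have up: "\<bar>K x\<bar> \<le> kernel_sup K" for x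
    unfolding kernel_sup_def by (rule cSUP_upper[OF UNIV_I])
  have zero: "K x = 0" if "1 / 2 < \<bar>x\<bar>" for x
  proof (rule ccontr)
    assume "K x \<noteq> 0"
    then have "x \<in> closure {x. K x \<noteq> 0}" using closure_subset by fastforce
    then have "x \<in> {-1/2..1/2}" using supp by blast
    then show False using that by auto
  qed
  have "1 = (\<integral>x. K x \<partial>lborel)" using int by (simp add: has_bochner_integral_iff)
  also have "\<dots> \<le> (\<integral>x. kernel_sup K * indicator {-1/2..1/2::real} x \<partial>lborel)"
  proof (rule integral_mono)
    show "integrable lborel K" using int by (simp add: has_bochner_integral_iff)
    show "K x \<le> kernel_sup K * indicator {-1/2..1/2::real} x" for x
      using up[of x] zero[of x] by (auto simp: indicator_def)
  qed simp
  also have "\<dots> = kernel_sup K" by simp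
  finally have "1 \<le> kernel_sup K" .
  moreover have "\<bar>K x - K y\<bar> \<le> L * \<bar>x - y\<bar>" for x y
    using lipschitz_onD[OF lip, of x y] by (simp add: dist_real_def)
  ultimately show "kernel_like K (kernel_sup K) L"
    using up zero L by (simp add: kernel_like_def)
qed

text \<open>After division by \<open>c\<close> all factors lie in [-1, 1], where a difference of
  products is at most the sum of the differences of the factors.\<close>

lemma prod_diff_bound:
  fixes a b :: "'i \<Rightarrow> real"
  assumes c: "0 < c" and a: "\<And>i. i \<in> I \<Longrightarrow> \<bar>a i\<bar> \<le> c" and b: "\<And>i. i \<in> I \<Longrightarrow> \<bar>b i\<bar> \<le> c"
  shows "\<bar>(\<Prod>i\<in>I. a i) - (\<Prod>i\<in>I. b i)\<bar> \<le> c ^ card I * ((\<Sum>i\<in>I. \<bar>a i - b i\<bar>) / c)"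
proof -
  have s: "(\<Prod>i\<in>I. x i) = c ^ card I * (\<Prod>i\<in>I. x i / c)" for x :: "'i \<Rightarrow> real"
    using c by (simp add: prod_dividef)
  have "\<bar>(\<Prod>i\<in>I. a i) - (\<Prod>i\<in>I. b i)\<bar> = c ^ card I * \<bar>(\<Prod>i\<in>I. a i / c) - (\<Prod>i\<in>I. b i / c)\<bar>"
    unfolding s[of a] s[of b] using c by (simp add: right_diff_distrib[symmetric] abs_mult)
  also have "\<dots> \<le> c ^ card I * (\<Sum>i\<in>I. \<bar>a i / c - b i / c\<bar>)"
    using norm_prod_diff[of I "\<lambda>i. a i / c" "\<lambda>i. b i / c"] a b c
    by (intro mult_left_mono) auto
  also have "(\<Sum>i\<in>I. \<bar>a i / c - b i / c\<bar>) = (\<Sum>i\<in>I. \<bar>a i - b i\<bar>) / c"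
    using c by (simp add: diff_divide_distrib[symmetric] sum_divide_distrib)
  finally show ?thesis .
qed

lemma scaled_kernel_bound:
  assumes k: "kernel_like \<kappa> B L" and w: "\<And>i. i \<in> I \<Longrightarrow> 0 < w $ i"
  shows "\<bar>scaled_kernel \<kappa> I w x\<bar> \<le> B ^ card I / vol w I"
proof -
  have "\<bar>\<Prod>i\<in>I. \<kappa> (x $ i / w $ i)\<bar> \<le> (\<Prod>i\<in>I. B)"
    unfolding abs_prod using k by (intro prod_mono) (auto simp: kernel_like_def)
  moreover have "0 < vol w I" unfolding vol_def using w by (intro prod_pos) auto
  ultimately show ?thesis by (simp add: scaled_kernel_def divide_right_mono)
qed

lemma scaled_kernel_abs:
  assumes w: "\<And>i. i \<in> I \<Longrightarrow> 0 < w $ i"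
  shows "scaled_kernel (\<lambda>x. \<bar>\<kappa> x\<bar>) I w x = \<bar>scaled_kernel \<kappa> I w x\<bar>"
proof -
  have "0 < vol w I" unfolding vol_def using w by (intro prod_pos) auto
  then show ?thesis by (simp add: scaled_kernel_def abs_prod)
qed

lemma scaled_kernel_depends: "depends_on I (\<lambda>x. scaled_kernel \<kappa> I w (x - x0))"
  unfolding depends_on_def scaled_kernel_def by auto

lemma scaled_kernel_measurable [measurable]:
  assumes [measurable]: "\<kappa> \<in> borel_measurable borel"
  shows "(\<lambda>x. scaled_kernel \<kappa> I w (x - x0)) \<in> borel_measurable borel"
proof -
  have [measurable]: "(\<lambda>x. (x - x0) $ i) \<in> borel_measurable borel" for i
    by (simp add: borel_measurable_diff)
  show ?thesis unfolding scaled_kernel_def by measurable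
qed

text \<open>Compact support makes the bound uniform in y. For |y| > 1 both rescaled arguments lie
  outside [-1/2, 1/2] and everything vanishes; for |y| \<le> 1 the argument y / (1 + t) is itself
  1-Lipschitz in t.\<close>

lemma rescaled_kernel_lipschitz:
  assumes k: "kernel_like \<kappa> B L" and t: "0 \<le> t" "t \<le> 1" and t': "0 \<le> t'" "t' \<le> 1"
  shows "\<bar>\<kappa> (y / (1 + t)) / (1 + t) - \<kappa> (y / (1 + t')) / (1 + t')\<bar> \<le> (L + B) * \<bar>t - t'\<bar>"
proof -
  have B: "\<bar>\<kappa> z\<bar> \<le> B" and Lp: "\<bar>\<kappa> z - \<kappa> z'\<bar> \<le> L * \<bar>z - z'\<bar>" and Z: "1 / 2 < \<bar>z\<bar> \<Longrightarrow> \<kappa> z = 0"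
    and B1: "1 \<le> B" and L0: "0 < L" for z z'
    using k by (auto simp: kernel_like_def)
  have main: "\<bar>\<kappa> (y / (1 + t)) / (1 + t) - \<kappa> (y / (1 + t')) / (1 + t')\<bar> \<le> (L + B) * \<bar>t - t'\<bar>"
    if t: "0 \<le> t" "t \<le> 1" and t': "0 \<le> t'" "t' \<le> 1" and tt: "t \<le> t'" for t t'
  proof (cases "1 < \<bar>y\<bar>")
    case True
    have "1 / 2 < \<bar>y / (1 + s)\<bar>" if "0 \<le> s" "s \<le> 1" for s
    proof -
      have "1 + s < 2 * \<bar>y\<bar>" using True that by linarith
      then show ?thesis using that by (simp add: field_simps)
    qed
    then show ?thesis using Z t t' L0 B1 by simp
  next
    case False
    have inv: "\<bar>1 / (1 + t) - 1 / (1 + t')\<bar> \<le> \<bar>t - t'\<bar>"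
    proof -
      have e: "1 / (1 + t) - 1 / (1 + t') = (t' - t) / ((1 + t) * (1 + t'))"
        using t t' by (simp add: field_simps)
      have "1 * 1 \<le> (1 + t) * (1 + t')" using t t' by (intro mult_mono) auto
      then have "(t' - t) / ((1 + t) * (1 + t')) \<le> (t' - t) / 1"
        using tt by (intro divide_left_mono) auto
      moreover have "0 \<le> (t' - t) / ((1 + t) * (1 + t'))" using tt t t' by simp
      ultimately show ?thesis unfolding e using tt by (subst abs_of_nonneg) auto
    qed
    have "\<bar>y / (1 + t) - y / (1 + t')\<bar> = \<bar>y\<bar> * \<bar>1 / (1 + t) - 1 / (1 + t')\<bar>"
      by (simp add: abs_mult[symmetric] right_diff_distrib)
    also have "\<dots> \<le> 1 * \<bar>t - t'\<bar>" using False inv by (intro mult_mono) auto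
    finally have y: "\<bar>y / (1 + t) - y / (1 + t')\<bar> \<le> \<bar>t - t'\<bar>" by simp
    have "\<kappa> (y / (1 + t)) / (1 + t) - \<kappa> (y / (1 + t')) / (1 + t')
        = (\<kappa> (y / (1 + t)) - \<kappa> (y / (1 + t'))) / (1 + t) + \<kappa> (y / (1 + t')) * (1 / (1 + t) - 1 / (1 + t'))"
      by (simp add: diff_divide_distrib right_diff_distrib)
    also have "\<bar>\<dots>\<bar> \<le> \<bar>\<kappa> (y / (1 + t)) - \<kappa> (y / (1 + t'))\<bar> / (1 + t) + \<bar>\<kappa> (y / (1 + t'))\<bar> * \<bar>1 / (1 + t) - 1 / (1 + t')\<bar>"
      using t by (intro order_trans[OF abs_triangle_ineq] add_mono) (auto simp: abs_mult abs_divide)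
    also have "\<dots> \<le> L * \<bar>t - t'\<bar> + B * \<bar>t - t'\<bar>"
    proof (intro add_mono mult_mono)
      have "\<bar>\<kappa> (y / (1 + t)) - \<kappa> (y / (1 + t'))\<bar> / (1 + t) \<le> \<bar>\<kappa> (y / (1 + t)) - \<kappa> (y / (1 + t'))\<bar> / 1"
        using t by (intro divide_left_mono) auto
      also have "\<dots> \<le> L * \<bar>y / (1 + t) - y / (1 + t')\<bar>" using Lp by simp
      also have "\<dots> \<le> L * \<bar>t - t'\<bar>" using y L0 by (intro mult_left_mono) auto
      finally show "\<bar>\<kappa> (y / (1 + t)) - \<kappa> (y / (1 + t'))\<bar> / (1 + t) \<le> L * \<bar>t - t'\<bar>" .
    qed (use B B1 inv in auto)
    finally show ?thesis by (simp add: algebra_simps)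
  qed
  show ?thesis
  proof (cases "t \<le> t'")
    case True
    then show ?thesis using main t t' by blast
  next
    case False
    then have "\<bar>\<kappa> (y / (1 + t')) / (1 + t') - \<kappa> (y / (1 + t)) / (1 + t)\<bar> \<le> (L + B) * \<bar>t' - t\<bar>"
      using main t t' by simp
    then show ?thesis by (simp add: abs_minus_commute)
  qed
qed

text \<open>Writing w = b (1 + t) turns the rescaled kernel into a product of the functions of
  \<open>rescaled_kernel_lipschitz\<close> over one fixed volume. The bound is the sup norm bound at
  the corner b times the relative constant \<open>lip_const\<close>, as the chaining
  requires.\<close>

lemma scaled_kernel_lipschitz:
  fixes b :: "'d::finite \<Rightarrow> real"
  assumes k: "kernel_like \<kappa> B L" and b: "\<And>i. i \<in> I \<Longrightarrow> 0 < b i"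
    and t: "\<And>i. i \<in> I \<Longrightarrow> 0 \<le> t i \<and> t i \<le> 1 \<and> w $ i = b i * (1 + t i)"
    and t': "\<And>i. i \<in> I \<Longrightarrow> 0 \<le> t' i \<and> t' i \<le> 1 \<and> w' $ i = b i * (1 + t' i)"
    and r: "\<And>i. i \<in> I \<Longrightarrow> \<bar>t i - t' i\<bar> \<le> r" and r0: "0 \<le> r"
  shows "\<bar>scaled_kernel \<kappa> I w x - scaled_kernel \<kappa> I w' x\<bar>
      \<le> B ^ CARD('d) / (\<Prod>i\<in>I. b i) * (real CARD('d) * (1 + L / B)) * r"
proof -
  have B: "1 \<le> B" and L: "0 < L" using k by (auto simp: kernel_like_def)
  let ?\<phi> = "\<lambda>t i. \<kappa> (x $ i / b i / (1 + t i)) / (1 + t i)"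
  have repr: "scaled_kernel \<kappa> I w x = (\<Prod>i\<in>I. ?\<phi> t i) / (\<Prod>i\<in>I. b i)"
    if "\<And>i. i \<in> I \<Longrightarrow> 0 \<le> t i \<and> t i \<le> 1 \<and> w $ i = b i * (1 + t i)" for t w
  proof -
    have "(\<Prod>i\<in>I. \<kappa> (x $ i / w $ i)) / (\<Prod>i\<in>I. w $ i) = (\<Prod>i\<in>I. \<kappa> (x $ i / b i / (1 + t i))) / (\<Prod>i\<in>I. b i * (1 + t i))"
      using that by (intro arg_cong2[where f = "(/)"] prod.cong) auto
    then show ?thesis by (simp add: scaled_kernel_def vol_def prod_dividef prod.distrib mult.commute)
  qed
  have bnd: "\<bar>?\<phi> t i\<bar> \<le> B" if "0 \<le> t i \<and> t i \<le> 1" for t i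
  proof -
    have "\<bar>?\<phi> t i\<bar> \<le> \<bar>\<kappa> (x $ i / b i / (1 + t i))\<bar> / 1"
      using that by (simp add: abs_divide) (intro divide_left_mono[of 1, simplified], auto)
    also have "\<dots> \<le> B" using k by (simp add: kernel_like_def)
    finally show ?thesis .
  qed
  have b0: "0 < (\<Prod>i\<in>I. b i)" using b by (intro prod_pos) auto
  have "\<bar>scaled_kernel \<kappa> I w x - scaled_kernel \<kappa> I w' x\<bar> = \<bar>(\<Prod>i\<in>I. ?\<phi> t i) - (\<Prod>i\<in>I. ?\<phi> t' i)\<bar> / (\<Prod>i\<in>I. b i)"
    using b0 by (simp add: repr[OF t] repr[OF t'] diff_divide_distrib[symmetric])
  also have "\<dots> \<le> (B ^ card I * ((\<Sum>i\<in>I. \<bar>?\<phi> t i - ?\<phi> t' i\<bar>) / B)) / (\<Prod>i\<in>I. b i)"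
    using B b0 t t' by (intro divide_right_mono prod_diff_bound bnd) auto
  also have "\<dots> \<le> (B ^ CARD('d) * (real CARD('d) * ((L + B) * r) / B)) / (\<Prod>i\<in>I. b i)"
  proof (intro divide_right_mono mult_mono)
    show "B ^ card I \<le> B ^ CARD('d)" using B by (intro power_increasing card_mono) auto
    have "(\<Sum>i\<in>I. \<bar>?\<phi> t i - ?\<phi> t' i\<bar>) \<le> (\<Sum>i\<in>I. (L + B) * r)"
    proof (rule sum_mono)
      fix i assume i: "i \<in> I"
      have "\<bar>?\<phi> t i - ?\<phi> t' i\<bar> \<le> (L + B) * \<bar>t i - t' i\<bar>"
        using t[OF i] t'[OF i] by (intro rescaled_kernel_lipschitz[OF k]) auto
      also have "\<dots> \<le> (L + B) * r" using r[OF i] B L by (intro mult_left_mono) auto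
      finally show "\<bar>?\<phi> t i - ?\<phi> t' i\<bar> \<le> (L + B) * r" .
    qed
    also have "\<dots> = real (card I) * ((L + B) * r)" by simp
    also have "\<dots> \<le> real CARD('d) * ((L + B) * r)"
      using B L r0 by (intro mult_right_mono) (auto intro!: card_mono)
    finally show "(\<Sum>i\<in>I. \<bar>?\<phi> t i - ?\<phi> t' i\<bar>) \<le> real CARD('d) * ((L + B) * r)" .
  qed (use B b0 in \<open>auto intro!: divide_nonneg_nonneg sum_nonneg\<close>)
  also have "\<dots> = B ^ CARD('d) / (\<Prod>i\<in>I. b i) * (real CARD('d) * (1 + L / B)) * r"
    using B by (simp add: field_simps)
  finally show ?thesis .
qed

text \<open>The expectation of the kernel estimator; \<open>smoothed_eq\<close> shows it to be a
  kernel average of the marginal density around x0.\<close>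

definition smoothed :: "(real \<Rightarrow> real) \<Rightarrow> (real ^ 'd::finite \<Rightarrow> real) \<Rightarrow> real ^ 'd \<Rightarrow> 'd set \<Rightarrow> real ^ 'd \<Rightarrow> real" where
  "smoothed \<kappa> f x0 I w = (\<integral>x. scaled_kernel \<kappa> I w (x - x0) \<partial>law f)"

text \<open>The substitution x = x0 + w u cancels the volume in the rescaled kernel and produces the
  integrals that occur in \<open>bias\<close>.\<close>

lemma smoothed_eq:
  fixes w x0 :: "real ^ 'd::finite"
  assumes f: "is_density f" and k: "kernel_like \<kappa> B L" and w: "\<And>i. i \<in> I \<Longrightarrow> 0 < w $ i"
    and F: "\<And>x. marginal f I x \<le> ennreal F"
  shows "smoothed \<kappa> f x0 I w
    = (\<integral>u. (\<Prod>i\<in>I. \<kappa> (u i)) * enn2real (marginal f I (\<chi> i. x0 $ i + w $ i * u i)) \<partial>PiR I)"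
proof -
  note kernel_like_measurable[OF k, measurable]
  have [measurable]: "f \<in> borel_measurable borel" using f by (simp add: is_density_def)
  have fin: "marginal f I x < \<infinity>" for x
    using F[of x] by (metis ennreal_less_top infinity_ennreal_def order_le_less_trans)
  let ?\<psi> = "\<lambda>y. enn2real (marginal f I (\<chi> i. y i)) * scaled_kernel \<kappa> I w ((\<chi> i. y i) - x0)"
  have V: "0 < vol w I" unfolding vol_def using w by (intro prod_pos) auto
  have "smoothed \<kappa> f x0 I w = (\<integral>y. ?\<psi> y \<partial>PiR I)"
    unfolding smoothed_def by (rule integral_law[OF f _ scaled_kernel_depends fin]) simp
  also have "\<dots> = (\<Prod>i\<in>I. w $ i) * (\<integral>u. ?\<psi> (\<lambda>i\<in>I. x0 $ i + w $ i * u i) \<partial>PiR I)"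
    by (rule integral_PiR_affine[OF w]) auto
  also have "\<dots> = (\<integral>u. (\<Prod>i\<in>I. w $ i) * ?\<psi> (\<lambda>i\<in>I. x0 $ i + w $ i * u i) \<partial>PiR I)" by simp
  also have "\<dots> = (\<integral>u. (\<Prod>i\<in>I. \<kappa> (u i)) * enn2real (marginal f I (\<chi> i. x0 $ i + w $ i * u i)) \<partial>PiR I)"
  proof (rule Bochner_Integration.integral_cong[OF refl])
    fix u
    have 1: "marginal f I (\<chi> i. (\<lambda>i\<in>I. x0 $ i + w $ i * u i) i) = marginal f I (\<chi> i. x0 $ i + w $ i * u i)"
      by (rule depends_onD[OF marginal_depends]) simp
    have 2: "scaled_kernel \<kappa> I w ((\<chi> i. (\<lambda>i\<in>I. x0 $ i + w $ i * u i) i) - x0) = (\<Prod>i\<in>I. \<kappa> (u i)) / vol w I"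
    proof -
      have "\<kappa> (((\<chi> i. (\<lambda>i\<in>I. x0 $ i + w $ i * u i) i) - x0) $ i / w $ i) = \<kappa> (u i)" if "i \<in> I" for i
        using that w[OF that] by simp
      then show ?thesis unfolding scaled_kernel_def by (simp cong: prod.cong)
    qed
    show "(\<Prod>i\<in>I. w $ i) * ?\<psi> (\<lambda>i\<in>I. x0 $ i + w $ i * u i) = (\<Prod>i\<in>I. \<kappa> (u i)) * enn2real (marginal f I (\<chi> i. x0 $ i + w $ i * u i))"
      unfolding 1 2 vol_def[symmetric] using V by simp
  qed
  finally show ?thesis .
qed

lemma prod_kernel_integrable:
  fixes I :: "'d::finite set"
  assumes k: "kernel_like \<kappa> B L"
  shows "integrable (PiR I) (\<lambda>u. \<Prod>i\<in>I. \<kappa> (u i))"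
    "(\<integral>u. (\<Prod>i\<in>I. \<kappa> (u i)) \<partial>PiR I) = (\<integral>x. \<kappa> x \<partial>lborel) ^ card I"
  using PiR.product_integrable_prod[of I "\<lambda>_. \<kappa>"] PiR.product_integral_prod[of I "\<lambda>_. \<kappa>"] kernel_like_integrable[OF k]
  by auto

lemma kernel_marginal_integrable:
  fixes z :: "('d::finite \<Rightarrow> real) \<Rightarrow> real ^ 'd"
  assumes f: "is_density f" and k: "kernel_like \<kappa> B L" and F: "\<And>x. marginal f I x \<le> ennreal F" "0 \<le> F"
    and [measurable]: "z \<in> PiR I \<rightarrow>\<^sub>M borel"
  shows "integrable (PiR I) (\<lambda>u. (\<Prod>i\<in>I. \<kappa> (u i)) * enn2real (marginal f I (z u)))"
proof -
  have [measurable]: "f \<in> borel_measurable borel" using f by (simp add: is_density_def)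
  have m: "0 \<le> enn2real (marginal f I x)" "enn2real (marginal f I x) \<le> F" for x
    using enn2real_mono[OF F(1)[of x]] F(2) by auto
  have i: "integrable (PiR I) (\<lambda>u. F * (\<Prod>i\<in>I. \<kappa> (u i)))"
    by (intro integrable_mult_right prod_kernel_integrable(1)[OF k])
  have [measurable]: "(\<lambda>u. \<Prod>i\<in>I. \<kappa> (u i)) \<in> borel_measurable (PiR I)"
    using prod_kernel_integrable(1)[OF k] by (rule borel_measurable_integrable)
  show ?thesis
  proof (rule Bochner_Integration.integrable_bound[OF i])
    show "AE u in PiR I. norm ((\<Prod>i\<in>I. \<kappa> (u i)) * enn2real (marginal f I (z u))) \<le> norm (F * (\<Prod>i\<in>I. \<kappa> (u i)))"
      using m F(2) by (auto simp: abs_mult mult.commute intro!: mult_right_mono)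
  qed measurable
qed

lemma affine_embed_measurable:
  "(\<lambda>u. \<chi> i. c i + w i * u i) \<in> PiR I \<rightarrow>\<^sub>M (borel :: (real ^ 'd::finite) measure)"
proof (rule vec_lambda_measurable')
  fix i :: 'd
  have "(\<lambda>u. (\<chi> j. u j) $ i) \<in> borel_measurable (PiR I)"
    by (rule measurable_compose[OF embed_measurable borel_measurable_nth])
  then have [measurable]: "(\<lambda>u. u i) \<in> borel_measurable (PiR I)" by simp
  show "(\<lambda>u. c i + w i * u i) \<in> borel_measurable (PiR I)" by measurable
qed

lemma smoothed_abs_le:
  assumes f: "is_density f" and k: "kernel_like \<kappa> B L" and w: "\<And>i. i \<in> I \<Longrightarrow> 0 < w $ i"
    and F: "\<And>x. marginal f I x \<le> ennreal F" "0 \<le> F"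
  shows "\<bar>smoothed \<kappa> f x0 I w\<bar> \<le> F * B ^ card I"
proof -
  have m: "0 \<le> enn2real (marginal f I x)" "enn2real (marginal f I x) \<le> F" for x
    using enn2real_mono[OF F(1)[of x]] F(2) by auto
  note ka = kernel_like_abs[OF k]
  note affine_embed_measurable[measurable]
  have "\<bar>smoothed \<kappa> f x0 I w\<bar> \<le> (\<integral>u. \<bar>(\<Prod>i\<in>I. \<kappa> (u i)) * enn2real (marginal f I (\<chi> i. x0 $ i + w $ i * u i))\<bar> \<partial>PiR I)"
    by (subst smoothed_eq[OF f k w F(1)], assumption) (rule integral_abs_bound)
  also have "\<dots> \<le> (\<integral>u. F * (\<Prod>i\<in>I. \<bar>\<kappa> (u i)\<bar>) \<partial>PiR I)"
  proof (rule integral_mono)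
    show "integrable (PiR I) (\<lambda>u. \<bar>(\<Prod>i\<in>I. \<kappa> (u i)) * enn2real (marginal f I (\<chi> i. x0 $ i + w $ i * u i))\<bar>)"
      by (intro integrable_abs kernel_marginal_integrable[OF f k F]) measurable
    show "integrable (PiR I) (\<lambda>u. F * (\<Prod>i\<in>I. \<bar>\<kappa> (u i)\<bar>))"
      by (intro integrable_mult_right prod_kernel_integrable(1)[OF ka])
    show "\<bar>(\<Prod>i\<in>I. \<kappa> (u i)) * enn2real (marginal f I (\<chi> i. x0 $ i + w $ i * u i))\<bar> \<le> F * (\<Prod>i\<in>I. \<bar>\<kappa> (u i)\<bar>)" for u
    proof -
      have "\<bar>(\<Prod>i\<in>I. \<kappa> (u i)) * enn2real (marginal f I (\<chi> i. x0 $ i + w $ i * u i))\<bar>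
          = enn2real (marginal f I (\<chi> i. x0 $ i + w $ i * u i)) * (\<Prod>i\<in>I. \<bar>\<kappa> (u i)\<bar>)"
        using m(1) by (simp add: abs_mult abs_prod)
      then show ?thesis using m(2) by (simp add: mult_right_mono prod_nonneg)
    qed
  qed
  also have "\<dots> = F * (\<integral>x. \<bar>\<kappa> x\<bar> \<partial>lborel) ^ card I"
    by (subst prod_kernel_integrable(2)[OF ka, symmetric]) simp
  also have "\<dots> \<le> F * B ^ card I"
    using kernel_like_integrable(2)[OF k] F(2) by (intro mult_left_mono power_mono) auto
  finally show ?thesis .
qed

text \<open>Positive \<eta> gives the change of expectation when the bandwidth grows from \<eta> to
  the join, as needed for the auxiliary estimators; \<eta> = 0 gives the ordinary bias, because the
  kernel has total mass 1 and the join of h with 0 is h. One supremum over \<eta> thus serves both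
  purposes.\<close>

lemma bias_eq:
  fixes h \<eta> x0 :: "real ^ 'd::finite"
  assumes f: "is_density f" and K: "kde_kernel K L" and h: "\<And>i. i \<in> I \<Longrightarrow> 0 < h $ i"
    and F: "\<And>x. marginal f I x \<le> ennreal F" "0 \<le> F"
  shows "(\<And>i. i \<in> I \<Longrightarrow> 0 < \<eta> $ i) \<Longrightarrow>
      selection_rule.bias K x0 f I h \<eta> = smoothed K f x0 I (sup h \<eta>) - smoothed K f x0 I \<eta>"
    and "h \<in> unit_box \<Longrightarrow> selection_rule.bias K x0 f I h 0 = smoothed K f x0 I h - enn2real (marginal f I x0)"
proof -
  note k = kde_kernel_like[OF K]
  have meas: "(\<lambda>u. \<chi> i. x0 $ i + w $ i * u i) \<in> PiR I \<rightarrow>\<^sub>M borel" for w :: "real ^ 'd"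
    by (rule affine_embed_measurable)
  have split: "selection_rule.bias K x0 f I h \<eta>
      = (\<integral>u. (\<Prod>i\<in>I. K (u i)) * enn2real (marginal f I (\<chi> i. x0 $ i + sup h \<eta> $ i * u i)) \<partial>PiR I)
      - (\<integral>u. (\<Prod>i\<in>I. K (u i)) * enn2real (marginal f I (\<chi> i. x0 $ i + \<eta> $ i * u i)) \<partial>PiR I)" for \<eta> :: "real ^ 'd"
    unfolding selection_rule.bias_def right_diff_distrib
    by (rule Bochner_Integration.integral_diff) (intro kernel_marginal_integrable[OF f k(1) F] meas)+
  show "selection_rule.bias K x0 f I h \<eta> = smoothed K f x0 I (sup h \<eta>) - smoothed K f x0 I \<eta>"
    if \<eta>: "\<And>i. i \<in> I \<Longrightarrow> 0 < \<eta> $ i"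
  proof -
    have "0 < sup h \<eta> $ i" if "i \<in> I" for i using h[OF that] by (simp add: sup_vec_def sup_real_def)
    then show ?thesis unfolding split by (simp add: smoothed_eq[OF f k(1) _ F(1)] \<eta>)
  qed
  show "selection_rule.bias K x0 f I h 0 = smoothed K f x0 I h - enn2real (marginal f I x0)" if hb: "h \<in> unit_box"
  proof -
    have "sup h 0 = h" using hb by (auto simp: vec_eq_iff sup_vec_def sup_real_def unit_box_def less_imp_le)
    moreover have "(\<integral>u. (\<Prod>i\<in>I. K (u i)) \<partial>PiR I) = 1"
      by (subst prod_kernel_integrable(2)[OF k(1)]) (use k(2) in \<open>simp add: has_bochner_integral_iff\<close>)
    ultimately show ?thesis unfolding split by (simp add: smoothed_eq[OF f k(1) h F(1)] vec_nth_inverse)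
  qed
qed

section \<open>Geometry of the parameter set\<close>

text \<open>On \<open>joins l\<close> the logarithms of the bandwidth ratios are at most \<open>rate_const * l\<close>, which
  leaves \<open>cell_count l\<close> cells of fixed logarithmic size; \<open>sum_const\<close> bounds
  \<open>cell_count l * l powr q * exp (- l)\<close>.\<close>

definition rate_const :: "real \<Rightarrow> nat \<Rightarrow> real" where
  "rate_const \<zz> d = 1 + 3 * \<zz> * real d"

definition grid_const :: "real \<Rightarrow> nat \<Rightarrow> nat" where
  "grid_const \<zz> d = nat \<lceil>2 * real d * rate_const \<zz> d\<rceil>"

definition cell_count :: "real \<Rightarrow> nat \<Rightarrow> nat \<Rightarrow> real" where
  "cell_count \<zz> d l = 4 ^ d * (2 * real (grid_const \<zz> d * l) + 1) ^ d"

definition sum_const :: "real \<Rightarrow> real \<Rightarrow> nat \<Rightarrow> real" where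
  "sum_const \<zz> q d = 4 ^ d * (2 * real (grid_const \<zz> d) + 1) ^ d * real (d + nat \<lceil>q\<rceil>) ^ (d + nat \<lceil>q\<rceil>)"

lemma cell_count_bound:
  assumes q: "1 \<le> q" and l: "1 \<le> l"
  shows "cell_count \<zz> d l * real l powr q * exp (- real l) \<le> sum_const \<zz> q d"
proof -
  let ?g = "real (grid_const \<zz> d)" and ?m = "d + nat \<lceil>q\<rceil>"
  have l1: "1 \<le> real l" using l by simp
  have "(2 * (?g * real l) + 1) ^ d \<le> ((2 * ?g + 1) * real l) ^ d"
    using l1 by (intro power_mono) (auto simp: algebra_simps)
  then have 1: "cell_count \<zz> d l \<le> 4 ^ d * ((2 * ?g + 1) ^ d * real l ^ d)"
    by (simp add: cell_count_def power_mult_distrib)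
  have "real l powr q \<le> real l powr real (nat \<lceil>q\<rceil>)" using l1 q by (intro powr_mono) linarith+
  also have "\<dots> = real l ^ nat \<lceil>q\<rceil>" using l1 by (simp add: powr_realpow)
  finally have 2: "real l powr q \<le> real l ^ nat \<lceil>q\<rceil>" .
  have "cell_count \<zz> d l * real l powr q \<le> 4 ^ d * ((2 * ?g + 1) ^ d * real l ^ d) * real l ^ nat \<lceil>q\<rceil>"
    using 1 2 by (intro mult_mono) (auto simp: cell_count_def)
  also have "\<dots> = 4 ^ d * (2 * ?g + 1) ^ d * real l ^ ?m" by (simp add: power_add)
  also have "\<dots> \<le> 4 ^ d * (2 * ?g + 1) ^ d * (real ?m ^ ?m * exp (real l))"
  proof (intro mult_left_mono power_le_power_mult_exp)
    have "1 \<le> \<lceil>q\<rceil>" using q by linarith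
    then show "1 \<le> ?m" by linarith
  qed auto
  finally have "cell_count \<zz> d l * real l powr q \<le> sum_const \<zz> q d * exp (real l)"
    by (simp add: sum_const_def mult.assoc)
  then show ?thesis by (simp add: exp_minus field_simps)
qed

text \<open>The set may be unbounded below; restricted to integers above a witness it is finite, and
  its maximum is the value of \<open>GREATEST\<close>.\<close>

lemma Greatest_int_holds:
  fixes Q :: "int \<Rightarrow> bool"
  assumes m0: "Q m0" and b: "\<And>m. Q m \<Longrightarrow> m \<le> b"
  shows "Q (GREATEST m. Q m)"
proof -
  let ?S = "{m. Q m \<and> m0 \<le> m}"
  have fin: "finite ?S" by (rule finite_subset[of _ "{m0..b}"]) (use b in auto)
  have ne: "?S \<noteq> {}" using m0 by auto
  have Max: "Q (Max ?S)" "m0 \<le> Max ?S" using Max_in[OF fin ne] by auto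
  have "m \<le> Max ?S" if "Q m" for m
  proof (cases "m0 \<le> m")
    case True
    then show ?thesis using that fin by (intro Max_ge) auto
  qed (use Max(2) in simp)
  then have "(GREATEST m. Q m) = Max ?S" using Max(1) by (intro Greatest_equality) auto
  then show ?thesis using Max(1) by simp
qed

lemma vol_pos: "(\<And>i. i \<in> I \<Longrightarrow> 0 < w $ i) \<Longrightarrow> 0 < vol w I"
  unfolding vol_def by (rule prod_pos) auto

lemma vol_le_1: "(\<And>i. i \<in> I \<Longrightarrow> 0 < w $ i \<and> w $ i \<le> 1) \<Longrightarrow> vol w I \<le> 1"
  unfolding vol_def by (rule prod_le_1) (auto simp: less_imp_le)

lemma vol_mono: "(\<And>i. i \<in> I \<Longrightarrow> 0 < w $ i \<and> w $ i \<le> w' $ i) \<Longrightarrow> vol w I \<le> vol w' I"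
  unfolding vol_def by (rule prod_mono) (auto simp: less_imp_le)

lemma vol_subset:
  fixes w :: "real ^ 'd::finite"
  assumes "J \<subseteq> I" "\<And>i. i \<in> I \<Longrightarrow> 0 < w $ i \<and> w $ i \<le> 1"
  shows "vol w I \<le> vol w J"
proof -
  have "vol w I = vol w J * vol w (I - J)"
    unfolding vol_def using assms(1) by (subst prod.subset_diff[of J I]) (auto simp: mult.commute)
  also have "\<dots> \<le> vol w J * 1"
    using assms by (intro mult_left_mono vol_le_1 less_imp_le[OF vol_pos]) auto
  finally show ?thesis by simp
qed

lemma sup_vec_nth: "sup h \<eta> $ i = max (h $ i) (\<eta> $ i)" for h \<eta> :: "real ^ 'd::finite"
  by (simp add: sup_vec_def sup_real_def)

lemma partition_on_part: "partition_on UNIV P \<Longrightarrow> I \<in> P \<Longrightarrow> I \<noteq> {}"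
  by (auto simp: partition_on_def)

text \<open>\<open>B\<close>, \<open>lm\<close>, \<open>a\<close>, \<open>d\<close> and \<open>A\<close> are mere abbreviations. They are
  parameters because a constant such as \<open>CARD('d)\<close>, defined inside the locale, would carry an
  extra type argument.\<close>

locale adaptive = selection_rule K L \<zz> \<tau> q \<hh> x0 n \<HH> \<PP>
  for K L \<zz> \<tau> q and \<hh> :: "'d::finite set \<Rightarrow> real ^ 'd" and x0 n \<HH> \<PP> +
  fixes f :: "real ^ 'd \<Rightarrow> real" and F B lm a :: real and d A :: nat
  assumes B_eq: "B = kernel_sup K"
    and d_eq: "d = CARD('d)"
    and A_eq: "A = mom_exp d q"
    and lm_eq: "lm = lam K L \<zz> \<tau> d q"
    and a_const_eq: "a = a_const K L \<zz> \<tau> d q"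
    and K: "kde_kernel K L"
    and z: "0 < \<zz>"
    and \<tau>: "\<And>s. s \<in> {1..CARD('d)} \<Longrightarrow> 0 < \<tau> s \<and> \<tau> s \<le> 1"
    and q: "1 \<le> q"
    and F: "0 < F"
    and hh: "\<And>I i. i \<in> I \<Longrightarrow> 0 < \<hh> I $ i \<and> \<hh> I $ i \<le> 1"
    and n: "3 \<le> n"
    and HH: "\<HH> \<subseteq> unit_box"
    and PP: "\<PP> \<subseteq> {P. partition_on UNIV P}"
    and params_ne: "params \<noteq> {}"
    and f: "f \<in> density_class F \<PP>"
begin

lemma d1: "1 \<le> d" by (simp add: Suc_leI d_eq)

lemma K_like: "kernel_like K B L" unfolding B_eq by (rule kde_kernel_like[OF K])

lemma B1: "1 \<le> B" and L0: "0 < L"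
  using K_like by (auto simp: kernel_like_def)

lemma lm_ge: "1 \<le> lm" "10 * thr_const B L q d \<le> lm"
  using lam_ge[OF B1[unfolded B_eq] L0 d1 q, of \<tau> \<zz>] \<tau> by (auto simp: lm_eq d_eq B_eq)

lemma A8: "8 * d \<le> A" "1 \<le> A" by (auto simp: mom_exp_def A_eq)

lemma lip1: "1 \<le> lip_const B L d"
proof -
  have "1 * 1 \<le> real d * (1 + L / B)" using d1 L0 B1 by (intro mult_mono) auto
  then show ?thesis by (simp add: lip_const_def)
qed

lemma a_pos: "0 < a" and a_eq: "a = 1 / (4 * lm\<^sup>2 * (1 + 2 * q))"
proof -
  show "a = 1 / (4 * lm\<^sup>2 * (1 + 2 * q))"
    unfolding a_const_eq a_const_def lm_eq using q by (simp add: power_mult_distrib)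
  then show "0 < a" using lm_ge q by simp
qed

text \<open>A consequence of \<open>10 * thr_const \<le> lm\<close> and the definition of
  \<open>a\<close>. It makes the deviation threshold at volume ln n / (a n) a small fraction of the
  mean level, as \<open>bad_event_exists\<close> requires.\<close>

lemma a_thr: "144 * (thr_const B L q d)\<^sup>2 * a \<le> 1"
proof -
  have t0: "0 \<le> thr_const B L q d" using lip1 B1 by (simp add: thr_const_def)
  have "(10 * thr_const B L q d)\<^sup>2 \<le> lm\<^sup>2" using lm_ge t0 by (intro power_mono) auto
  then have "100 * (thr_const B L q d)\<^sup>2 \<le> lm\<^sup>2" by (simp add: power_mult_distrib)
  then have "144 * (thr_const B L q d)\<^sup>2 \<le> 4 * lm\<^sup>2" using zero_le_power2[of "thr_const B L q d"] by linarith
  also have "\<dots> \<le> 4 * lm\<^sup>2 * (1 + 2 * q)" using mult_left_mono[of 1 "1 + 2 * q" "4 * lm\<^sup>2"] q by simp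
  finally have *: "144 * (thr_const B L q d)\<^sup>2 \<le> 4 * lm\<^sup>2 * (1 + 2 * q)" .
  have "0 < 4 * lm\<^sup>2 * (1 + 2 * q)" using lm_ge q by simp
  then show ?thesis unfolding a_eq using * by simp
qed

text \<open>The square of \<open>thr_const\<close> contains the factor \<open>2 * B ^ d * A\<close>,
  so \<open>a_thr\<close> controls it. The first bound turns the lower volume bound into the regime
  condition \<open>p * \<beta> \<le> n\<close> of the chaining lemma.\<close>

lemma a_AB: "4 * real A * B ^ d * a \<le> 1" and a_le1: "a \<le> 1"
proof -
  have "1\<^sup>2 \<le> (396 * lip_const B L d)\<^sup>2" using lip1 by (intro power_mono) auto
  then have "1 * (2 * B ^ d * real A) \<le> (396 * lip_const B L d)\<^sup>2 * (2 * B ^ d * real A)"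
    using B1 by (intro mult_right_mono) auto
  also have "\<dots> = (thr_const B L q d)\<^sup>2" using B1 by (simp add: thr_const_def power_mult_distrib A_eq)
  finally have "144 * (2 * B ^ d * real A) * a \<le> 144 * (thr_const B L q d)\<^sup>2 * a"
    using a_pos by (intro mult_right_mono mult_left_mono) auto
  moreover have "144 * (2 * B ^ d * real A) * a = 288 * (B ^ d * real A * a)" by simp
  ultimately have 1: "288 * (B ^ d * real A * a) \<le> 1" using a_thr by linarith
  have "0 \<le> B ^ d * real A * a" using B1 a_pos by simp
  then show "4 * real A * B ^ d * a \<le> 1" using 1 by (simp add: mult_ac)
  have "1 * 1 * a \<le> B ^ d * real A * a"
    using B1 A8 a_pos by (intro mult_right_mono mult_mono) auto
  then show "a \<le> 1" using 1 by linarith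
qed

lemma ln_n: "1 \<le> ln (real n)"
proof -
  have "exp (1::real) \<le> real n" using exp_le n by linarith
  then show ?thesis using n by (subst ln_ge_iff) auto
qed

lemma paramsD:
  assumes "(h, P) \<in> params"
  shows "P \<in> \<PP>" "partition_on UNIV P" "h \<in> unit_box" "h \<in> \<HH>" "\<And>I. I \<in> P \<Longrightarrow> h \<in> bandwidths I"
    "\<And>i. 0 < h $ i \<and> h $ i \<le> 1"
  using assms PP by (auto simp: params_def all_params_def unit_box_def)

lemma PP_ne: "\<PP> \<noteq> {}" using params_ne by (auto simp: params_def)

lemma PP_part: "P \<in> \<PP> \<Longrightarrow> partition_on UNIV P" using PP by auto

lemma part_ne: "P \<in> \<PP> \<Longrightarrow> P \<noteq> {}" using PP by (auto simp: partition_on_def)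

lemma hh_vol: "0 < vol (\<hh> I) I" "vol (\<hh> I) I \<le> 1"
  using hh by (auto intro!: vol_pos vol_le_1)

lemma INF_part_pos:
  assumes "P \<in> \<PP>"
  shows "0 < (INF I\<in>P. vol (\<hh> I) I)" "I \<in> P \<Longrightarrow> (INF I\<in>P. vol (\<hh> I) I) \<le> vol (\<hh> I) I"
proof -
  have "(INF I\<in>P. vol (\<hh> I) I) = Min ((\<lambda>I. vol (\<hh> I) I) ` P)"
    using part_ne[OF assms] by (intro cInf_eq_Min) auto
  then show "0 < (INF I\<in>P. vol (\<hh> I) I)" "I \<in> P \<Longrightarrow> (INF I\<in>P. vol (\<hh> I) I) \<le> vol (\<hh> I) I"
    using part_ne[OF assms] hh_vol by auto
qed

lemma V_max_ge: "P \<in> \<PP> \<Longrightarrow> (INF I\<in>P. vol (\<hh> I) I) \<le> V_max"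
  unfolding V_max_def by (rule cSUP_upper) auto

lemma V_max_pos: "0 < V_max" and V_max_le1: "V_max \<le> 1"
proof -
  obtain P where "P \<in> \<PP>" using PP_ne by auto
  then show "0 < V_max" using INF_part_pos(1) V_max_ge by fastforce
  show "V_max \<le> 1"
    unfolding V_max_def
  proof (rule cSUP_least[OF PP_ne])
    fix P assume P: "P \<in> \<PP>"
    then obtain I where "I \<in> P" using part_ne by blast
    then show "(INF I\<in>P. vol (\<hh> I) I) \<le> 1" using INF_part_pos(2)[OF P] hh_vol(2) order_trans by blast
  qed
qed

lemma card_part: "I \<noteq> {} \<Longrightarrow> card I \<in> {1..CARD('d)}" for I :: "'d set"
  by (auto simp: Suc_le_eq card_gt_0_iff intro: card_mono)

text \<open>The maximum in \<open>M\<close> is over a nonempty set, since \<open>v I m\<close> tends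
  to infinity as m tends to minus infinity. Hence \<open>M I\<close> satisfies its own constraint
  even when it is not positive.\<close>

lemma M_bound:
  assumes I: "I \<noteq> {}"
  shows "ln (real n) / (a * real n) \<le> v I (M I) * min (vol (\<hh> I) I) V_max"
proof -
  define t where "t = ln (real n) / (a * real n)"
  define c where "c = min (vol (\<hh> I) I) V_max"
  have t: "0 < t" unfolding t_def using ln_n a_pos n by (intro divide_pos_pos mult_pos_pos) auto
  have c: "0 < c" unfolding c_def using hh_vol V_max_pos by simp
  have \<tau>I: "0 < \<tau> (card I)" using \<tau>[OF card_part[OF I]] by simp
  let ?Q = "\<lambda>m. v I m * c \<ge> t \<and> real_of_int m \<le> log 2 (real n)"
  have "?Q (GREATEST m. ?Q m)"
  proof (rule Greatest_int_holds)
    let ?N = "\<lceil>max 0 (log 2 (t / c) / \<tau> (card I))\<rceil>"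
    show "?Q (- ?N)"
    proof
      have "log 2 (t / c) / \<tau> (card I) \<le> real_of_int ?N" by linarith
      then have "log 2 (t / c) \<le> real_of_int ?N * \<tau> (card I)" using \<tau>I by (simp add: pos_divide_le_eq)
      then have "2 powr (log 2 (t / c)) \<le> 2 powr (real_of_int ?N * \<tau> (card I))" by simp
      then have "t / c \<le> v I (- ?N)" using t c by (simp add: v_def)
      then show "t \<le> v I (- ?N) * c" using c by (simp add: pos_divide_le_eq)
      have "real_of_int (- ?N) \<le> 0" by simp
      also have "0 \<le> log 2 (real n)" using n by simp
      finally show "real_of_int (- ?N) \<le> log 2 (real n)" .
    qed
    show "m \<le> \<lfloor>log 2 (real n)\<rfloor>" if "?Q m" for m using that by linarith
  qed
  moreover have "(GREATEST m. ?Q m) = M I" unfolding M_def t_def c_def a_const_eq d_eq by simp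
  ultimately show ?thesis unfolding t_def c_def by simp
qed

lemma v_antimono: "I \<noteq> {} \<Longrightarrow> m \<le> m' \<Longrightarrow> v I m' \<le> v I m"
  unfolding v_def using \<tau>[OF card_part[of I]] by (simp add: mult_right_mono)

lemma v_pos: "0 < v I m" by (simp add: v_def)

lemma bandwidthsE:
  assumes hP: "(h, P) \<in> params" and I: "I \<in> P"
  obtains m W where "1 \<le> m" "m \<le> M I" "W = vol (\<hh> I) I \<or> W = V_max" "h \<in> band I m W"
proof -
  obtain m where "m \<in> {1..M I}" "h \<in> band I m (vol (\<hh> I) I) \<union> band I m V_max"
    using paramsD(5)[OF hP I] unfolding bandwidths_def by blast
  then show thesis using that[of m "vol (\<hh> I) I"] that[of m V_max] by auto
qed

text \<open>Since \<open>v I m\<close> decreases in m, the constraint satisfied by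
  \<open>M I\<close> is passed on to all bands up to it. The existence of a band forces
  \<open>M I \<ge> 1\<close>, so \<open>v I (M I) \<le> 1\<close> and the reference volumes inherit
  the same bound.\<close>

lemma vol_ge:
  assumes hP: "(h, P) \<in> params" and I: "I \<in> P"
  shows "ln (real n) / (a * real n) \<le> vol h I" "ln (real n) / (a * real n) \<le> vol (\<hh> I) I" "ln (real n) / (a * real n) \<le> V_max"
proof -
  have Ine: "I \<noteq> {}" using partition_on_part[OF paramsD(2)[OF hP] I] .
  obtain m W where m: "1 \<le> m" "m \<le> M I" "W = vol (\<hh> I) I \<or> W = V_max" "h \<in> band I m W"
    using bandwidthsE[OF hP I] .
  note b = M_bound[OF Ine]
  have min0: "0 \<le> min (vol (\<hh> I) I) V_max" using hh_vol[of I] V_max_pos by simp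
  have "v I (M I) * min (vol (\<hh> I) I) V_max \<le> v I m * W"
    using v_antimono[OF Ine m(2)] m(3) v_pos[of I m] min0 by (intro mult_mono) auto
  also have "\<dots> \<le> vol h I" using m(4) by (simp add: band_def)
  finally show "ln (real n) / (a * real n) \<le> vol h I" using b by linarith
  have "v I (M I) \<le> v I 0" using m by (intro v_antimono[OF Ine]) auto
  then have "v I (M I) \<le> 1" by (simp add: v_def)
  then have "v I (M I) * min (vol (\<hh> I) I) V_max \<le> 1 * min (vol (\<hh> I) I) V_max"
    using min0 by (intro mult_right_mono) auto
  then show "ln (real n) / (a * real n) \<le> vol (\<hh> I) I" "ln (real n) / (a * real n) \<le> V_max" using b by auto
qed

lemma inv_n_le: "1 / real n \<le> ln (real n) / (a * real n)"
proof -
  have "a * 1 \<le> 1 * ln (real n)" using a_le1 a_pos ln_n by (intro mult_mono) auto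
  then show ?thesis using a_pos n by (simp add: field_simps)
qed

lemma ratio_le_n:
  assumes "x \<le> 1" "ln (real n) / (a * real n) \<le> y"
  shows "x / y \<le> real n"
proof -
  have "1 / real n \<le> y" using inv_n_le assms by linarith
  moreover have "0 < 1 / real n" using n by simp
  ultimately have y0: "0 < y" and "1 / real n \<le> y" by linarith+
  then have y: "0 < y" "1 \<le> real n * y" using n by (auto simp: field_simps)
  then show ?thesis using assms(1) by (simp add: pos_divide_le_eq mult.commute)
qed

lemma delta_set:
  assumes hP: "(h, P) \<in> params"
  defines "T \<equiv> {(P', I, I'). P' \<in> \<PP> \<and> I \<in> P \<and> I' \<in> P' \<and> I \<inter> I' \<noteq> {}}"
  shows "finite T" "T \<noteq> {}"
proof -
  show "finite T" by simp
  obtain I where "I \<in> P" using part_ne[OF paramsD(1)[OF hP]] by blast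
  then have "(P, I, I) \<in> T" using paramsD(1)[OF hP] partition_on_part[OF paramsD(2)[OF hP]] by (auto simp: T_def)
  then show "T \<noteq> {}" by auto
qed

lemma delta_ge:
  assumes hP: "(h, P) \<in> params" and "P' \<in> \<PP>" "I \<in> P" "I' \<in> P'" "I \<inter> I' \<noteq> {}"
  shows "vol (sup (\<hh> I) (\<hh> I')) (I \<inter> I') / vol h (I \<inter> I') \<le> delta h P" "V_max / (INF J\<in>P. vol (\<hh> J) J) \<le> delta h P"
proof -
  have "max (vol (sup (\<hh> I) (\<hh> I')) (I \<inter> I') / vol h (I \<inter> I')) (V_max / (INF J\<in>P. vol (\<hh> J) J)) \<le> delta h P"
    unfolding delta_def
    by (rule cSUP_upper2[where x = "(P', I, I')"]) (use assms delta_set[OF hP] in auto)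
  then show "vol (sup (\<hh> I) (\<hh> I')) (I \<inter> I') / vol h (I \<inter> I') \<le> delta h P" "V_max / (INF J\<in>P. vol (\<hh> J) J) \<le> delta h P" by auto
qed

text \<open>All numerators are at most 1 and all denominators at least 1 / n. Hence the cost never
  exceeds ln n and finitely many integer levels suffice.\<close>

lemma delta_le_n:
  assumes hP: "(h, P) \<in> params"
  shows "delta h P \<le> real n"
  unfolding delta_def
proof (rule cSUP_least[OF delta_set(2)[OF hP]])
  fix t assume "t \<in> {(P', I, I'). P' \<in> \<PP> \<and> I \<in> P \<and> I' \<in> P' \<and> I \<inter> I' \<noteq> {}}"
  then obtain P' I I' where t: "t = (P', I, I')" and *: "P' \<in> \<PP>" "I \<in> P" "I' \<in> P'" by auto
  have "vol h I \<le> vol h (I \<inter> I')" using paramsD(6)[OF hP] by (intro vol_subset) auto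
  then have 1: "ln (real n) / (a * real n) \<le> vol h (I \<inter> I')" using vol_ge(1)[OF hP *(2)] by linarith
  have "vol (sup (\<hh> I) (\<hh> I')) (I \<inter> I') \<le> 1" using hh by (intro vol_le_1) (auto simp: sup_vec_nth less_max_iff_disj)
  from ratio_le_n[OF this 1] have 2: "vol (sup (\<hh> I) (\<hh> I')) (I \<inter> I') / vol h (I \<inter> I') \<le> real n" .
  have "ln (real n) / (a * real n) \<le> (INF J\<in>P. vol (\<hh> J) J)"
    using part_ne[OF paramsD(1)[OF hP]] vol_ge(2)[OF hP] by (intro cINF_greatest) auto
  from ratio_le_n[OF V_max_le1 this] 2
  show "(case t of (P', I, I') \<Rightarrow> max (vol (sup (\<hh> I) (\<hh> I')) (I \<inter> I') / vol h (I \<inter> I')) (V_max / (INF J\<in>P. vol (\<hh> J) J))) \<le> real n" by (simp add: t)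
qed

lemma delta_ge1:
  assumes hP: "(h, P) \<in> params"
  shows "1 \<le> delta h P"
proof -
  note P = paramsD(1)[OF hP]
  obtain I where I: "I \<in> P" using part_ne[OF P] by blast
  have "1 \<le> V_max / (INF J\<in>P. vol (\<hh> J) J)" using V_max_ge[OF P] INF_part_pos(1)[OF P] by simp
  then show ?thesis using delta_ge(2)[OF hP P I I] partition_on_part[OF paramsD(2)[OF hP] I] by auto
qed

text \<open>\<open>V_max / vol h I\<close> is the product of two ratios that \<open>delta\<close>
  controls, one through the reference volumes of the partition and one through the bandwidth. This
  is the origin of the square, and later of the factor exp (2 l).\<close>

lemma hh_ratio:
  assumes hP: "(h, P) \<in> params" and I: "I \<in> P"
  shows "vol (\<hh> I) I / vol h I \<le> delta h P" "V_max / vol h I \<le> (delta h P)\<^sup>2"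
proof -
  note P = paramsD(1)[OF hP]
  have Ine: "I \<noteq> {}" using partition_on_part[OF paramsD(2)[OF hP] I] .
  have hv: "0 < vol h I" using paramsD(6)[OF hP] by (intro vol_pos) auto
  show 1: "vol (\<hh> I) I / vol h I \<le> delta h P" using delta_ge(1)[OF hP P I I] Ine by simp
  have "V_max / vol (\<hh> I) I \<le> V_max / (INF J\<in>P. vol (\<hh> J) J)"
    using INF_part_pos[OF P] I V_max_pos hh_vol by (intro divide_left_mono) auto
  also have "\<dots> \<le> delta h P" using delta_ge(2)[OF hP P I I] Ine by simp
  finally have 2: "V_max / vol (\<hh> I) I \<le> delta h P" .
  have "V_max / vol h I = (V_max / vol (\<hh> I) I) * (vol (\<hh> I) I / vol h I)" using hh_vol(1)[of I] by simp
  also have "\<dots> \<le> delta h P * delta h P"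
    using 1 2 delta_ge1[OF hP] hh_vol(1)[of I] hv by (intro mult_mono) auto
  finally show "V_max / vol h I \<le> (delta h P)\<^sup>2" by (simp add: power2_eq_square)
qed

text \<open>The index m of the band is hidden, but the volume reveals it:
  \<open>vol h I \<le> v I (m - 1) * W\<close> bounds \<open>1 / v I (m - 1)\<close> by the square
  of \<open>delta\<close>, and passing to m costs at most a factor 2 as \<tau> \<le> 1. The
  coordinatewise ceiling of the band thereby becomes explicit.\<close>

lemma h_le_hh:
  assumes hP: "(h, P) \<in> params" and I: "I \<in> P" and i: "i \<in> I"
  shows "h $ i \<le> (2 * (delta h P)\<^sup>2) powr \<zz> * \<hh> I $ i"
proof -
  have Ine: "I \<noteq> {}" using i by auto
  have hv: "0 < vol h I" using paramsD(6)[OF hP] by (intro vol_pos) auto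
  obtain m W where m: "1 \<le> m" "m \<le> M I" "W = vol (\<hh> I) I \<or> W = V_max" "h \<in> band I m W"
    using bandwidthsE[OF hP I] .
  note \<tau>I = \<tau>[OF card_part[OF Ine]]
  have W: "0 < W" using m(3) hh_vol V_max_pos by auto
  have d2: "delta h P \<le> (delta h P)\<^sup>2"
    using delta_ge1[OF hP] by (simp add: power2_eq_square mult_left_le)
  have "vol h I \<le> v I (m - 1) * W" using m(4) by (simp add: band_def)
  then have "1 / v I (m - 1) \<le> W / vol h I" using hv v_pos[of I "m - 1"] by (simp add: field_simps)
  also have "\<dots> \<le> (delta h P)\<^sup>2" using m(3) hh_ratio[OF hP I] d2 by auto
  finally have 1: "1 / v I (m - 1) \<le> (delta h P)\<^sup>2" .
  have "1 / v I m = 2 powr (\<tau> (card I)) * (1 / v I (m - 1))"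
    by (simp add: v_def powr_minus_divide[symmetric] powr_add[symmetric] algebra_simps)
  also have "\<dots> \<le> 2 powr 1 * (delta h P)\<^sup>2"
  proof (rule mult_mono)
    show "2 powr \<tau> (card I) \<le> (2::real) powr 1" using \<tau>I by (intro powr_mono) auto
  qed (use 1 v_pos[of I "m - 1"] in auto)
  finally have 2: "1 / v I m \<le> 2 * (delta h P)\<^sup>2" by simp
  have "v I m powr (- \<zz>) = (1 / v I m) powr \<zz>" using v_pos[of I m] by (simp add: powr_minus powr_divide inverse_eq_divide)
  also have "\<dots> \<le> (2 * (delta h P)\<^sup>2) powr \<zz>" using 2 z v_pos[of I m] by (intro powr_mono2) auto
  finally have "v I m powr (- \<zz>) * \<hh> I $ i \<le> (2 * (delta h P)\<^sup>2) powr \<zz> * \<hh> I $ i"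
    using hh[OF i] by (intro mult_right_mono) auto
  moreover have "h $ i \<le> v I m powr (- \<zz>) * \<hh> I $ i" using m(4) i by (simp add: band_def)
  ultimately show ?thesis by linarith
qed

lemma V_le: "(h, P) \<in> params \<Longrightarrow> I \<in> P \<Longrightarrow> V h P \<le> vol h I"
  unfolding V_def by (rule cINF_lower) auto

lemma V_pos: "(h, P) \<in> params \<Longrightarrow> 0 < V h P"
proof -
  assume hP: "(h, P) \<in> params"
  have "V h P = Min (vol h ` P)" unfolding V_def using part_ne[OF paramsD(1)[OF hP]] by (intro cInf_eq_Min) auto
  then show ?thesis using part_ne[OF paramsD(1)[OF hP]] paramsD(6)[OF hP] by (auto intro!: vol_pos)
qed

definition cost :: "real ^ 'd \<Rightarrow> 'd set set \<Rightarrow> real ^ 'd \<Rightarrow> 'd set set \<Rightarrow> real" where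
  "cost h P \<eta> P' = max 1 (max (ln (delta h P)) (ln (delta \<eta> P')))"

text \<open>The pair (I, I') is kept, and not merely the intersection, because the reference
  bandwidth \<open>sup (\<hh> I) (\<hh> I')\<close> of the cells depends on it.\<close>

definition joins :: "nat \<Rightarrow> ('d set \<times> 'd set \<times> (real ^ 'd)) set" where
  "joins l = {(I, I', sup h \<eta>) | I I' h \<eta>. \<exists>P P'. (h, P) \<in> params \<and> (\<eta>, P') \<in> params \<and> I \<in> P \<and> I' \<in> P' \<and>
     I \<inter> I' \<noteq> {} \<and> cost h P \<eta> P' \<le> real l}"

lemma cost_le: "(h, P) \<in> params \<Longrightarrow> (\<eta>, P') \<in> params \<Longrightarrow> cost h P \<eta> P' \<le> ln (real n)"
  using delta_le_n[of h P] delta_ge1[of h P] delta_le_n[of \<eta> P'] delta_ge1[of \<eta> P'] ln_n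
  by (auto simp: cost_def)

lemma joins_bounds:
  assumes "(I, I', w) \<in> joins l"
  shows "\<And>i. i \<in> I \<inter> I' \<Longrightarrow> 0 < w $ i \<and> w $ i \<le> 1"
    and "V_max * exp (- 2 * real l) \<le> vol w (I \<inter> I')"
    and "ln (real n) / (a * real n) \<le> vol w (I \<inter> I')"
    and "\<And>i. i \<in> I \<inter> I' \<Longrightarrow> \<bar>ln (w $ i / sup (\<hh> I) (\<hh> I') $ i)\<bar> \<le> rate_const \<zz> d * real l"
    and "1 \<le> l"
proof -
  obtain h \<eta> P P' where w: "w = sup h \<eta>" and hP: "(h, P) \<in> params" and eP: "(\<eta>, P') \<in> params"
    and I: "I \<in> P" and I': "I' \<in> P'" and ne: "I \<inter> I' \<noteq> {}" and c: "cost h P \<eta> P' \<le> real l"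
    using assms unfolding joins_def by blast
  let ?J = "I \<inter> I'" and ?H = "sup (\<hh> I) (\<hh> I')"
  note h01 = paramsD(6)[OF hP] and e01 = paramsD(6)[OF eP]
  show w01: "0 < w $ i \<and> w $ i \<le> 1" if "i \<in> ?J" for i
    using h01[of i] e01[of i] by (auto simp: w sup_vec_nth)
  show l1: "1 \<le> l" using c by (simp add: cost_def)
  have hJ: "vol h I \<le> vol w ?J"
  proof -
    have "vol h I \<le> vol h ?J" using h01 by (intro vol_subset) auto
    also have "\<dots> \<le> vol w ?J" using h01 by (intro vol_mono) (auto simp: w sup_vec_nth)
    finally show ?thesis .
  qed
  show "ln (real n) / (a * real n) \<le> vol w ?J" using vol_ge(1)[OF hP I] hJ by linarith
  have lnd: "ln (delta h P) \<le> l" "ln (delta \<eta> P') \<le> l" using c by (auto simp: cost_def)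
  have le_exp: "x \<le> exp (real l)" if "1 \<le> x" "ln x \<le> real l" for x
  proof -
    have "x = exp (ln x)" using that by simp
    also have "\<dots> \<le> exp (real l)" using that by (subst exp_le_cancel_iff)
    finally show ?thesis .
  qed
  have dl: "delta h P \<le> exp l" "delta \<eta> P' \<le> exp l"
    using le_exp lnd delta_ge1[OF hP] delta_ge1[OF eP] by auto
  have hv: "0 < vol h I" using h01 by (intro vol_pos) auto
  have "V_max / vol h I \<le> exp (2 * real l)"
  proof -
    have "(delta h P)\<^sup>2 \<le> (exp l)\<^sup>2" using dl delta_ge1[OF hP] by (intro power_mono) auto
    then show ?thesis using hh_ratio(2)[OF hP I] by (simp add: exp_double)
  qed
  then have "V_max * exp (- 2 * real l) \<le> vol h I" using hv by (simp add: exp_minus field_simps)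
  then show "V_max * exp (- 2 * real l) \<le> vol w ?J" using hJ by linarith
  have Hpos: "0 < ?H $ i" if "i \<in> ?J" for i using hh[of i I] that by (simp add: sup_vec_nth less_max_iff_disj)
  have up: "ln (w $ i / ?H $ i) \<le> 3 * \<zz> * real l" if i: "i \<in> ?J" for i
  proof -
    have E: "(2 * x\<^sup>2) powr \<zz> \<le> exp (3 * \<zz> * real l)" if "1 \<le> x" "ln x \<le> real l" for x
    proof -
      have "ln (2 * x\<^sup>2) = ln 2 + 2 * ln x" using that by (simp add: ln_mult ln_realpow)
      also have "\<dots> \<le> 1 + 2 * real l" using that ln_2_less_1 by simp
      also have "\<dots> \<le> 3 * real l" using l1 by simp
      finally have "\<zz> * ln (2 * x\<^sup>2) \<le> \<zz> * (3 * real l)" using z by (intro mult_left_mono) auto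
      then show ?thesis using that by (simp add: powr_def mult_ac)
    qed
    have "h $ i \<le> exp (3 * \<zz> * real l) * ?H $ i"
    proof -
      have "h $ i \<le> (2 * (delta h P)\<^sup>2) powr \<zz> * \<hh> I $ i" using i by (intro h_le_hh[OF hP I]) auto
      also have "\<dots> \<le> exp (3 * \<zz> * real l) * ?H $ i"
        using hh[of i I] i by (intro mult_mono E delta_ge1[OF hP] lnd) (auto simp: sup_vec_nth)
      finally show ?thesis .
    qed
    moreover have "\<eta> $ i \<le> exp (3 * \<zz> * real l) * ?H $ i"
    proof -
      have "\<eta> $ i \<le> (2 * (delta \<eta> P')\<^sup>2) powr \<zz> * \<hh> I' $ i" using i by (intro h_le_hh[OF eP I']) auto
      also have "\<dots> \<le> exp (3 * \<zz> * real l) * ?H $ i"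
        using hh[of i I'] i by (intro mult_mono E delta_ge1[OF eP] lnd) (auto simp: sup_vec_nth)
      finally show ?thesis .
    qed
    ultimately have "w $ i \<le> exp (3 * \<zz> * real l) * ?H $ i" by (simp add: w sup_vec_nth)
    then have "w $ i / ?H $ i \<le> exp (3 * \<zz> * real l)" using Hpos[OF i] by (simp add: pos_divide_le_eq)
    moreover have "0 < w $ i / ?H $ i" using w01[OF i] Hpos[OF i] by simp
    ultimately have "ln (w $ i / ?H $ i) \<le> ln (exp (3 * \<zz> * real l))" by (intro ln_mono)
    then show ?thesis by simp
  qed
  \<comment> \<open>\<open>delta\<close> bounds a ratio of volumes, hence only the sum of the
    logarithms from below and not each of them.\<close>
  have tot: "- real l \<le> (\<Sum>i\<in>?J. ln (w $ i / ?H $ i))"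
  proof -
    have "vol ?H ?J / vol h ?J \<le> delta h P" by (rule delta_ge(1)[OF hP paramsD(1)[OF eP] I I' ne])
    also have "\<dots> \<le> exp l" by (rule dl)
    finally have "vol ?H ?J / vol h ?J \<le> exp l" .
    moreover have hJ0: "0 < vol h ?J" using h01 by (intro vol_pos) auto
    ultimately have "vol ?H ?J \<le> exp l * vol h ?J" by (simp add: pos_divide_le_eq)
    also have "\<dots> \<le> exp l * vol w ?J" using h01 by (intro mult_left_mono vol_mono) (auto simp: w sup_vec_nth)
    finally have *: "vol ?H ?J \<le> exp l * vol w ?J" .
    have H0: "0 < vol ?H ?J" using Hpos by (rule vol_pos)
    have W0: "0 < vol w ?J" using w01 by (intro vol_pos) auto
    have "exp (- real l) \<le> vol w ?J / vol ?H ?J" using * H0 by (simp add: exp_minus field_simps)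
    then have "ln (exp (- real l)) \<le> ln (vol w ?J / vol ?H ?J)" by (intro ln_mono) auto
    also have "vol w ?J / vol ?H ?J = (\<Prod>i\<in>?J. w $ i / ?H $ i)" by (simp add: vol_def prod_dividef)
    also have "ln \<dots> = (\<Sum>i\<in>?J. ln (w $ i / ?H $ i))" using w01 Hpos by (intro ln_prod) (auto, (metis Int_iff less_irrefl)+)
    finally show ?thesis by simp
  qed
  \<comment> \<open>All other coordinates are at most \<open>3 * \<zz> * l\<close>, so the lower
    bound on the sum forces a lower bound on each single term; this explains
    \<open>rate_const\<close>.\<close>
  show "\<bar>ln (w $ i / ?H $ i)\<bar> \<le> rate_const \<zz> d * real l" if i: "i \<in> ?J" for i
  proof -
    have "(\<Sum>i\<in>?J. ln (w $ i / ?H $ i)) = ln (w $ i / ?H $ i) + (\<Sum>j\<in>?J - {i}. ln (w $ j / ?H $ j))"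
      using i by (simp add: sum.remove)
    also have "(\<Sum>j\<in>?J - {i}. ln (w $ j / ?H $ j)) \<le> (\<Sum>j\<in>?J - {i}. 3 * \<zz> * real l)" by (intro sum_mono up) auto
    also have "\<dots> = real (card (?J - {i})) * (3 * \<zz> * real l)" by simp
    also have "\<dots> \<le> real d * (3 * \<zz> * real l)" using z by (intro mult_right_mono) (auto intro!: card_mono simp: d_eq)
    finally have "- real l - real d * (3 * \<zz> * real l) \<le> ln (w $ i / ?H $ i)" using tot by linarith
    then have lo: "- (rate_const \<zz> d * real l) \<le> ln (w $ i / ?H $ i)" by (simp add: rate_const_def algebra_simps)
    have "1 * (3 * \<zz> * real l) \<le> real d * (3 * \<zz> * real l)" using z d1 by (intro mult_right_mono) auto
    then have "3 * \<zz> * real l \<le> rate_const \<zz> d * real l" by (simp add: rate_const_def algebra_simps)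
    then show ?thesis using up[OF i] lo by linarith
  qed
qed

end

section \<open>Uniform deviations over the parameter set\<close>

context adaptive
begin

lemma fD: "is_density f" "prob_space (law f)" "indep_partitions f \<inter> \<PP> \<noteq> {}"
  using f law_prob by (auto simp: density_class_def)

lemma marginal_le:
  assumes "P \<in> \<PP>" "P' \<in> \<PP>" "J \<in> meet P P'"
  shows "marginal f J x \<le> ennreal F"
proof -
  have "marginal f J x \<le> (SUP x. marginal f J x)" by (rule SUP_upper) simp
  also have "\<dots> \<le> (SUP J\<in>meet P P'. SUP x. marginal f J x)" by (rule SUP_upper) (rule assms)
  also have "\<dots> \<le> (SUP P'\<in>\<PP>. SUP J\<in>meet P P'. SUP x. marginal f J x)" by (rule SUP_upper[OF assms(2)])
  also have "\<dots> \<le> (SUP P\<in>\<PP>. SUP P'\<in>\<PP>. SUP J\<in>meet P P'. SUP x. marginal f J x)" by (rule SUP_upper[OF assms(1)])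
  also have "\<dots> \<le> ennreal F" using f by (simp add: density_class_def)
  finally show ?thesis .
qed

definition kernel_at :: "(real \<Rightarrow> real) \<Rightarrow> 'd set \<Rightarrow> real ^ 'd \<Rightarrow> real ^ 'd \<Rightarrow> real" where
  "kernel_at \<kappa> J w x = scaled_kernel \<kappa> J w (x - x0)"

definition dev :: "(real \<Rightarrow> real) \<Rightarrow> 'd set \<Rightarrow> real ^ 'd \<Rightarrow> (nat \<Rightarrow> real ^ 'd) \<Rightarrow> real" where
  "dev \<kappa> J w = emp_dev (law f) n (kernel_at \<kappa> J w)"

abbreviation "samples \<equiv> \<Pi>\<^sub>M i\<in>{1..n}. law f"

lemma kernel_at_measurable:
  assumes "kernel_like \<kappa> B L"
  shows "kernel_at \<kappa> J w \<in> borel_measurable (law f)"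
  using scaled_kernel_measurable[OF kernel_like_measurable[OF assms], of J w x0] unfolding kernel_at_def[abs_def]
  by (simp add: measurable_cong_sets[OF law_sets refl])

text \<open>Within a cell each coordinate varies by a factor below 2^(1/d), so all volumes agree up
  to a factor 2 and the relative positions w / b - 1 lie in [0, 1). Weighting by sqrt (vol w)
  cancels the volume in the chaining bound, which makes the cells comparable.\<close>

lemma cell_bound:
  fixes k :: "'d \<Rightarrow> int"
  assumes \<kappa>: "kernel_like \<kappa> B L" and G1: "1 \<le> G"
    and G: "\<And>w. (I, I', w) \<in> joins l \<Longrightarrow> (\<integral>x. \<bar>kernel_at \<kappa> (I \<inter> I') w x\<bar> \<partial>law f) \<le> G"
    and l1: "1 \<le> l" and l2: "real l \<le> 2 * ln (real n)"
  defines "T \<equiv> {w. (I, I', w) \<in> joins l \<and> (\<forall>i\<in>I \<inter> I'. k i = \<lfloor>real d * log 2 (w $ i / sup (\<hh> I) (\<hh> I') $ i)\<rfloor>)}"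
  shows "\<exists>S. S \<in> borel_measurable samples \<and>
    (\<forall>X. \<forall>w\<in>T. ennreal ((sqrt (vol w (I \<inter> I')) * \<bar>dev \<kappa> (I \<inter> I') w X\<bar>) ^ (A * l)) \<le> S X) \<and>
    (\<integral>\<^sup>+X. S X \<partial>samples) \<le> ennreal ((132 * lip_const B L d * sqrt (2 * B ^ d * real (A * l) * G / real n)) ^ (A * l))"
proof (cases "T = {}")
  case True
  then show ?thesis by (intro exI[of _ "\<lambda>_. 0"]) auto
next
  case False
  let ?J = "I \<inter> I'" and ?H = "sup (\<hh> I) (\<hh> I')" and ?p = "A * l"
  \<comment> \<open>\<open>b\<close> is the lower corner of the cell on a logarithmic grid, to base
    2 and with step 1 / d, that passes through the reference bandwidth.\<close>
  define b where "b i = ?H $ i * 2 powr (real_of_int (k i) / real d)" for i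
  define Vb where "Vb = (\<Prod>i\<in>?J. b i)"
  define e where "e w i = (if i \<in> ?J then w $ i / b i - 1 else 0)" for w :: "real ^ 'd" and i
  have H0: "0 < ?H $ i" if "i \<in> ?J" for i using hh[of i I] that by (simp add: sup_vec_nth less_max_iff_disj)
  have b0: "0 < b i" if "i \<in> ?J" for i using H0[OF that] by (simp add: b_def)
  have Vb0: "0 < Vb" unfolding Vb_def using b0 by (intro prod_pos) auto
  have TJ: "(I, I', w) \<in> joins l" if "w \<in> T" for w using that by (simp add: T_def)
  have w0: "0 < w $ i" if "w \<in> T" "i \<in> ?J" for w i using joins_bounds(1)[OF TJ] that by blast
  have rng: "1 \<le> w $ i / b i \<and> w $ i / b i < 2 powr (1 / real d)" if w: "w \<in> T" and i: "i \<in> ?J" for w i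
  proof -
    have k: "k i = \<lfloor>real d * log 2 (w $ i / ?H $ i)\<rfloor>" using w i by (simp add: T_def)
    have r0: "0 < w $ i / ?H $ i" using w0[OF w i] H0[OF i] by simp
    have "real_of_int (k i) \<le> real d * log 2 (w $ i / ?H $ i)" "real d * log 2 (w $ i / ?H $ i) < real_of_int (k i) + 1"
      unfolding k by linarith+
    then have "real_of_int (k i) / real d \<le> log 2 (w $ i / ?H $ i)" "log 2 (w $ i / ?H $ i) < (real_of_int (k i) + 1) / real d"
      using d1 by (auto simp: field_simps)
    then have "2 powr (real_of_int (k i) / real d) \<le> 2 powr (log 2 (w $ i / ?H $ i))"
        "2 powr (log 2 (w $ i / ?H $ i)) < 2 powr ((real_of_int (k i) + 1) / real d)" by auto
    then have 1: "2 powr (real_of_int (k i) / real d) \<le> w $ i / ?H $ i"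
       and 2: "w $ i / ?H $ i < 2 powr (real_of_int (k i) / real d) * 2 powr (1 / real d)"
      using r0 by (auto simp: powr_add[symmetric] add_divide_distrib)
    define R E where "R = w $ i / ?H $ i" and "E = 2 powr (real_of_int (k i) / real d)"
    have eq: "w $ i / b i = R / E" by (simp add: b_def R_def E_def)
    have "E \<le> R" "R < E * 2 powr (1 / real d)" "0 < E" using 1 2 by (simp_all add: R_def E_def)
    then show ?thesis unfolding eq by (simp add: pos_divide_less_eq mult.commute)
  qed
  have two: "2 powr (1 / real d) \<le> (2::real)"
  proof -
    have "2 powr (1 / real d) \<le> (2::real) powr 1" using d1 by (intro powr_mono) auto
    then show ?thesis by simp
  qed
  have Vw: "Vb \<le> vol w ?J \<and> vol w ?J \<le> 2 * Vb" if w: "w \<in> T" for w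
  proof -
    have eq: "vol w ?J = Vb * (\<Prod>i\<in>?J. w $ i / b i)"
      unfolding vol_def Vb_def prod.distrib[symmetric] by (rule prod.cong) (use b0 in force)+
    have "1 \<le> (\<Prod>i\<in>?J. w $ i / b i)" using rng[OF w] by (intro prod_ge_1) auto
    moreover have "(\<Prod>i\<in>?J. w $ i / b i) \<le> 2"
    proof -
      have "(\<Prod>i\<in>?J. w $ i / b i) \<le> (\<Prod>i\<in>?J. 2 powr (1 / real d))"
        using rng[OF w] by (intro prod_mono) (auto intro: order_trans[of 0 1] less_imp_le)
      also have "\<dots> = (2 powr (1 / real d)) ^ card ?J" by simp
      also have "\<dots> \<le> (2 powr (1 / real d)) ^ d"
        by (intro power_increasing) (auto simp: d_eq intro!: card_mono ge_one_powr_ge_zero)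
      also have "\<dots> = 2" using d1 by (simp add: powr_realpow[symmetric] powr_powr)
      finally show ?thesis .
    qed
    ultimately show ?thesis unfolding eq using Vb0 by (auto simp: mult.commute)
  qed
  obtain w1 where w1: "w1 \<in> T" using False by auto
  have \<beta>0: "0 < B ^ d / Vb" using B1 Vb0 by simp
  \<comment> \<open>The factor 4 in \<open>a_AB\<close> is spent here: 2 on
    \<open>l \<le> 2 * ln n\<close> and 2 on passing from \<open>vol w\<close> to
    \<open>Vb\<close>.\<close>
  have pn: "real ?p * (B ^ d / Vb) \<le> real n"
  proof -
    have "ln (real n) / (a * real n) \<le> 2 * Vb" using joins_bounds(3)[OF TJ[OF w1]] Vw[OF w1] by linarith
    then have v: "ln (real n) \<le> 2 * a * real n * Vb" using a_pos n by (simp add: pos_divide_le_eq mult_ac)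
    have "real ?p * B ^ d = (real A * B ^ d) * real l" by simp
    also have "\<dots> \<le> (real A * B ^ d) * (2 * ln (real n))" using l2 B1 by (intro mult_left_mono) auto
    also have "\<dots> \<le> (real A * B ^ d) * (2 * (2 * a * real n * Vb))" using v B1 by (intro mult_left_mono) auto
    also have "\<dots> = (4 * real A * B ^ d * a) * (real n * Vb)" by simp
    also have "\<dots> \<le> 1 * (real n * Vb)" using a_AB Vb0 by (intro mult_right_mono) auto
    finally show ?thesis using Vb0 by (simp add: pos_divide_le_eq)
  qed
  have "\<exists>R. R \<in> borel_measurable samples \<and>
      (\<forall>X. \<forall>w\<in>T. ennreal (\<bar>emp_dev (law f) n (kernel_at \<kappa> ?J w) X\<bar> ^ ?p) \<le> R X) \<and>
      (\<integral>\<^sup>+X. R X \<partial>samples) \<le> ennreal ((132 * lip_const B L d * sqrt (real ?p * G * (B ^ d / Vb) / real n)) ^ ?p)"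
  proof (rule emp_dev_chaining[where e = e, OF fD(2)])
    show "kernel_at \<kappa> ?J w \<in> borel_measurable (law f)" for w
      by (rule kernel_at_measurable[OF \<kappa>])
    show "0 \<le> e w i \<and> e w i < 1" if "w \<in> T" for w i
      using rng[OF that, of i] two by (auto simp: e_def)
    show "\<bar>kernel_at \<kappa> ?J w x\<bar> \<le> B ^ d / Vb" if w: "w \<in> T" for w x
    proof -
      have "\<bar>kernel_at \<kappa> ?J w x\<bar> \<le> B ^ card ?J / vol w ?J"
        unfolding kernel_at_def by (rule scaled_kernel_bound[OF \<kappa>]) (rule w0[OF w])
      also have "\<dots> \<le> B ^ d / Vb"
        using Vw[OF w] Vb0 B1 by (intro frac_le power_increasing) (auto simp: d_eq intro!: card_mono)
      finally show ?thesis .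
    qed
    show "\<bar>kernel_at \<kappa> ?J w x - kernel_at \<kappa> ?J w' x\<bar> \<le> B ^ d / Vb * lip_const B L d * r"
      if w: "w \<in> T" and w': "w' \<in> T" and r: "\<And>i. \<bar>e w i - e w' i\<bar> \<le> r" for w w' r x
      unfolding kernel_at_def Vb_def lip_const_def d_eq
    proof (rule scaled_kernel_lipschitz[OF \<kappa> b0])
      show "0 \<le> e w i \<and> e w i \<le> 1 \<and> w $ i = b i * (1 + e w i)" if "i \<in> ?J" for i
        using rng[OF w that] two b0[OF that] that by (auto simp: e_def)
      show "0 \<le> e w' i \<and> e w' i \<le> 1 \<and> w' $ i = b i * (1 + e w' i)" if "i \<in> ?J" for i
        using rng[OF w' that] two b0[OF that] that by (auto simp: e_def)
      show "\<bar>e w i - e w' i\<bar> \<le> r" for i by (rule r)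
      show "0 \<le> r" using r[of undefined] by linarith
    qed
    show "(\<integral>x. \<bar>kernel_at \<kappa> ?J w x\<bar> \<partial>law f) \<le> G" if "w \<in> T" for w by (rule G[OF TJ[OF that]])
    show "8 * CARD('d) \<le> ?p"
    proof -
      have "8 * d * 1 \<le> A * l" using A8 l1 by (intro mult_mono) auto
      then show ?thesis by (simp add: d_eq)
    qed
  qed (use \<beta>0 G1 lip1 n pn in auto)
  then obtain R where R: "R \<in> borel_measurable samples"
      "\<And>X w. w \<in> T \<Longrightarrow> ennreal (\<bar>dev \<kappa> ?J w X\<bar> ^ ?p) \<le> R X"
      "(\<integral>\<^sup>+X. R X \<partial>samples) \<le> ennreal ((132 * lip_const B L d * sqrt (real ?p * G * (B ^ d / Vb) / real n)) ^ ?p)"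
    unfolding dev_def by blast
  show ?thesis
  proof (intro exI[of _ "\<lambda>X. ennreal (sqrt (2 * Vb) ^ ?p) * R X"] conjI allI ballI)
    show "(\<lambda>X. ennreal (sqrt (2 * Vb) ^ ?p) * R X) \<in> borel_measurable samples" using R(1) by measurable
    fix X w assume w: "w \<in> T"
    have "(sqrt (vol w ?J) * \<bar>dev \<kappa> ?J w X\<bar>) ^ ?p \<le> sqrt (2 * Vb) ^ ?p * \<bar>dev \<kappa> ?J w X\<bar> ^ ?p"
      unfolding power_mult_distrib using Vw[OF w] Vb0 by (intro mult_right_mono power_mono) auto
    then have "ennreal ((sqrt (vol w ?J) * \<bar>dev \<kappa> ?J w X\<bar>) ^ ?p) \<le> ennreal (sqrt (2 * Vb) ^ ?p) * ennreal (\<bar>dev \<kappa> ?J w X\<bar> ^ ?p)"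
      using Vb0 by (subst ennreal_mult[symmetric]) (auto intro: ennreal_leI)
    also have "\<dots> \<le> ennreal (sqrt (2 * Vb) ^ ?p) * R X" by (intro mult_left_mono R(2)[OF w]) simp
    finally show "ennreal ((sqrt (vol w ?J) * \<bar>dev \<kappa> ?J w X\<bar>) ^ ?p) \<le> ennreal (sqrt (2 * Vb) ^ ?p) * R X" .
  next
    have "(\<integral>\<^sup>+X. ennreal (sqrt (2 * Vb) ^ ?p) * R X \<partial>samples) = ennreal (sqrt (2 * Vb) ^ ?p) * (\<integral>\<^sup>+X. R X \<partial>samples)"
      by (rule nn_integral_cmult) (rule R(1))
    also have "\<dots> \<le> ennreal (sqrt (2 * Vb) ^ ?p) * ennreal ((132 * lip_const B L d * sqrt (real ?p * G * (B ^ d / Vb) / real n)) ^ ?p)"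
      by (intro mult_left_mono R(3)) simp
    also have "\<dots> = ennreal ((sqrt (2 * Vb) * (132 * lip_const B L d * sqrt (real ?p * G * (B ^ d / Vb) / real n))) ^ ?p)"
      using Vb0 lip1 G1 B1 by (subst ennreal_mult[symmetric]) (auto simp: power_mult_distrib)
    also have "sqrt (2 * Vb) * (132 * lip_const B L d * sqrt (real ?p * G * (B ^ d / Vb) / real n))
        = 132 * lip_const B L d * (sqrt (2 * Vb) * sqrt (real ?p * G * (B ^ d / Vb) / real n))" by simp
    also have "sqrt (2 * Vb) * sqrt (real ?p * G * (B ^ d / Vb) / real n) = sqrt (2 * B ^ d * real ?p * G / real n)"
      unfolding real_sqrt_mult[symmetric] using Vb0 by (simp add: field_simps)
    finally show "(\<integral>\<^sup>+X. ennreal (sqrt (2 * Vb) ^ ?p) * R X \<partial>samples)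
        \<le> ennreal ((132 * lip_const B L d * sqrt (2 * B ^ d * real ?p * G / real n)) ^ ?p)" .
  qed
qed

lemma uniform_moment:
  assumes \<kappa>: "kernel_like \<kappa> B L" and G1: "1 \<le> G"
    and G: "\<And>I I' w. (I, I', w) \<in> joins l \<Longrightarrow> (\<integral>x. \<bar>kernel_at \<kappa> (I \<inter> I') w x\<bar> \<partial>law f) \<le> G"
    and l1: "1 \<le> l" and l2: "real l \<le> 2 * ln (real n)"
  shows "\<exists>S. S \<in> borel_measurable samples \<and>
    (\<forall>X I I' w. (I, I', w) \<in> joins l \<longrightarrow> ennreal ((sqrt (vol w (I \<inter> I')) * \<bar>dev \<kappa> (I \<inter> I') w X\<bar>) ^ (A * l)) \<le> S X) \<and>
    (\<integral>\<^sup>+X. S X \<partial>samples) \<le> ennreal (cell_count \<zz> d l * (132 * lip_const B L d * sqrt (2 * B ^ d * real (A * l) * G / real n)) ^ (A * l))"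
proof -
  define T where "T = (\<lambda>(I, I', k). {w. (I, I', w) \<in> joins l \<and> (\<forall>i\<in>I \<inter> I'. (k :: 'd \<Rightarrow> int) i = \<lfloor>real d * log 2 (w $ i / sup (\<hh> I) (\<hh> I') $ i)\<rfloor>)})"
  define c where "c = 132 * lip_const B L d * sqrt (2 * B ^ d * real (A * l) * G / real n)"
  have "\<forall>C. \<exists>S. S \<in> borel_measurable samples \<and>
    (\<forall>X. \<forall>w\<in>T C. ennreal ((sqrt (vol w (fst C \<inter> fst (snd C))) * \<bar>dev \<kappa> (fst C \<inter> fst (snd C)) w X\<bar>) ^ (A * l)) \<le> S X) \<and>
    (\<integral>\<^sup>+X. S X \<partial>samples) \<le> ennreal (c ^ (A * l))"
  proof
    fix C :: "'d set \<times> 'd set \<times> ('d \<Rightarrow> int)"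
    obtain I I' k where C: "C = (I, I', k)" by (cases C) auto
    show "\<exists>S. S \<in> borel_measurable samples \<and>
      (\<forall>X. \<forall>w\<in>T C. ennreal ((sqrt (vol w (fst C \<inter> fst (snd C))) * \<bar>dev \<kappa> (fst C \<inter> fst (snd C)) w X\<bar>) ^ (A * l)) \<le> S X) \<and>
      (\<integral>\<^sup>+X. S X \<partial>samples) \<le> ennreal (c ^ (A * l))"
      using cell_bound[OF \<kappa> G1 G l1 l2, of I I' k] by (simp add: C T_def c_def)
  qed
  from choice[OF this] obtain S where S: "\<And>C. S C \<in> borel_measurable samples"
    "\<And>C X w. w \<in> T C \<Longrightarrow> ennreal ((sqrt (vol w (fst C \<inter> fst (snd C))) * \<bar>dev \<kappa> (fst C \<inter> fst (snd C)) w X\<bar>) ^ (A * l)) \<le> S C X"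
    "\<And>C. (\<integral>\<^sup>+X. S C X \<partial>samples) \<le> ennreal (c ^ (A * l))" by blast
  define m where "m = int (grid_const \<zz> d * l)"
  define Cs where "Cs = (UNIV :: 'd set set) \<times> (UNIV :: 'd set set) \<times> (\<Pi>\<^sub>E i\<in>(UNIV :: 'd set). {- m..m})"
  have fin: "finite Cs" unfolding Cs_def by (intro finite_SigmaI finite_PiE) auto
  \<comment> \<open>The factor \<open>4 ^ d\<close> counts the pairs (I, I'); the other counts the
    grid points with coordinates between -m and m.\<close>
  have card: "real (card Cs) = cell_count \<zz> d l"
  proof -
    have "card Cs = 2 ^ d * (2 ^ d * nat (2 * m + 1) ^ d)"
    proof -
      have "card (UNIV :: 'd set set) = 2 ^ d" using card_Pow[of "UNIV :: 'd set"] by (simp add: d_eq)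
      moreover have "card (\<Pi>\<^sub>E i\<in>(UNIV :: 'd set). {- m..m}) = nat (2 * m + 1) ^ d"
        by (subst card_PiE) (auto simp: d_eq algebra_simps)
      ultimately show ?thesis unfolding Cs_def card_cartesian_product by simp
    qed
    also have "\<dots> = (2 * 2) ^ d * nat (2 * m + 1) ^ d" by (simp only: power_mult_distrib mult.assoc)
    also have "nat (2 * m + 1) = 2 * (grid_const \<zz> d * l) + 1" unfolding m_def by linarith
    finally show ?thesis by (simp add: cell_count_def add.commute)
  qed
  have c0: "0 \<le> c" unfolding c_def using lip1 G1 B1 by simp
  show ?thesis
  proof (intro exI[of _ "\<lambda>X. \<Sum>C\<in>Cs. S C X"] conjI allI impI)
    show "(\<lambda>X. \<Sum>C\<in>Cs. S C X) \<in> borel_measurable samples" using S(1) by measurable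
    fix X I I' w assume w: "(I, I', w) \<in> joins l"
    let ?H = "sup (\<hh> I) (\<hh> I')"
    define k where "k i = (if i \<in> I \<inter> I' then \<lfloor>real d * log 2 (w $ i / ?H $ i)\<rfloor> else 0)" for i
    have k: "- m \<le> k i \<and> k i \<le> m" for i
    proof (cases "i \<in> I \<inter> I'")
      case True
      have "\<bar>ln (w $ i / ?H $ i)\<bar> \<le> rate_const \<zz> d * real l" by (rule joins_bounds(4)[OF w True])
      \<comment> \<open>Conversion to base 2 costs at most a factor 2, the 2 in
        \<open>grid_const\<close>; its factor d is the reciprocal of the grid step.\<close>
      moreover have ln2: "1 / 2 \<le> ln (2::real)" using ln2_ge_two_thirds by simp
      ultimately have "\<bar>log 2 (w $ i / ?H $ i)\<bar> \<le> (rate_const \<zz> d * real l) / (1 / 2)"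
        unfolding log_def abs_divide by (intro frac_le) auto
      then have "real d * \<bar>log 2 (w $ i / ?H $ i)\<bar> \<le> real d * ((rate_const \<zz> d * real l) / (1 / 2))"
        by (intro mult_left_mono) auto
      also have "\<dots> = (2 * real d * rate_const \<zz> d) * real l" by simp
      also have "\<dots> \<le> real (grid_const \<zz> d) * real l"
        unfolding grid_const_def by (intro mult_right_mono) linarith+
      finally have "\<bar>real d * log 2 (w $ i / ?H $ i)\<bar> \<le> real_of_int m" by (simp add: m_def abs_mult)
      then have "real_of_int (- m) \<le> real d * log 2 (w $ i / ?H $ i)" "real d * log 2 (w $ i / ?H $ i) \<le> real_of_int m" by auto
      then have "- m \<le> \<lfloor>real d * log 2 (w $ i / ?H $ i)\<rfloor>" "\<lfloor>real d * log 2 (w $ i / ?H $ i)\<rfloor> \<le> m"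
        by (simp_all only: le_floor_iff, linarith)
      then show ?thesis using True by (simp add: k_def)
    qed (auto simp: k_def m_def)
    have C: "(I, I', k) \<in> Cs" unfolding Cs_def using k by auto
    have "w \<in> T (I, I', k)" using w by (simp add: T_def k_def)
    then have "ennreal ((sqrt (vol w (I \<inter> I')) * \<bar>dev \<kappa> (I \<inter> I') w X\<bar>) ^ (A * l)) \<le> S (I, I', k) X"
      using S(2)[of w "(I, I', k)" X] by simp
    also have "\<dots> \<le> (\<Sum>C\<in>Cs. S C X)" by (rule member_le_sum[OF C]) (auto simp: fin)
    finally show "ennreal ((sqrt (vol w (I \<inter> I')) * \<bar>dev \<kappa> (I \<inter> I') w X\<bar>) ^ (A * l)) \<le> (\<Sum>C\<in>Cs. S C X)" .
  next
    have "(\<integral>\<^sup>+X. (\<Sum>C\<in>Cs. S C X) \<partial>samples) = (\<Sum>C\<in>Cs. \<integral>\<^sup>+X. S C X \<partial>samples)"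
      by (rule nn_integral_sum) (rule S(1))
    also have "\<dots> \<le> (\<Sum>C\<in>Cs. ennreal (c ^ (A * l)))" by (intro sum_mono S(3))
    also have "\<dots> = ennreal (real (card Cs) * c ^ (A * l))"
      using c0 by (simp add: ennreal_mult ennreal_of_nat_eq_real_of_nat)
    finally show "(\<integral>\<^sup>+X. (\<Sum>C\<in>Cs. S C X) \<partial>samples)
      \<le> ennreal (cell_count \<zz> d l * (132 * lip_const B L d * sqrt (2 * B ^ d * real (A * l) * G / real n)) ^ (A * l))"
      unfolding card c_def .
  qed
qed

end

text \<open>Where x exceeds t the ratio x / t is at least 1 and may be raised to the power p - q.
  This trades the q-th power of the excess for a moment of much higher order.\<close>

lemma excess_le:
  fixes x t q :: real
  assumes "0 < t" "0 \<le> x" "0 < q" "q \<le> real p"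
  shows "max 0 (x - t) powr q \<le> x ^ p * t powr (q - real p)"
proof (cases "t < x")
  case True
  have "max 0 (x - t) powr q \<le> x powr q" using True assms by (intro powr_mono2) auto
  also have "\<dots> = x powr q * 1" by simp
  also have "\<dots> \<le> x powr q * (x / t) powr (real p - q)"
    using True assms by (intro mult_left_mono ge_one_powr_ge_zero) auto
  also have "\<dots> = x powr (real p) * t powr (q - real p)"
    using True assms by (simp add: powr_divide powr_diff field_simps)
  also have "x powr (real p) = x ^ p" using True assms by (intro powr_realpow) auto
  finally show ?thesis .
next
  case False
  then show ?thesis using assms by simp
qed

context adaptive
begin

section \<open>Deviations beyond the threshold, at all cost levels at once\<close>

definition top_cost :: nat where
  "top_cost = nat \<lceil>ln (real n)\<rceil>"

lemma top_cost: "1 \<le> top_cost" "ln (real n) \<le> real top_cost" "real top_cost \<le> 2 * ln (real n)"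
  using ln_n unfolding top_cost_def by linarith+

lemma joins_mono: "l \<le> l' \<Longrightarrow> joins l \<subseteq> joins l'"
proof
  fix t assume l: "l \<le> l'" and t: "t \<in> joins l"
  then obtain I I' h \<eta> P P' where "t = (I, I', sup h \<eta>)" "(h, P) \<in> params" "(\<eta>, P') \<in> params" "I \<in> P" "I' \<in> P'"
    "I \<inter> I' \<noteq> {}" "cost h P \<eta> P' \<le> real l"
    unfolding joins_def by blast
  moreover have "cost h P \<eta> P' \<le> real l'" using calculation(7) l by simp
  ultimately show "t \<in> joins l'" unfolding joins_def by blast
qed

abbreviation "abs_mean I I' w \<equiv> \<integral>x. \<bar>kernel_at K (I \<inter> I') w x\<bar> \<partial>law f"

lemma abs_mean_le:
  assumes "(I, I', w) \<in> joins l"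
  shows "abs_mean I I' w \<le> F * B ^ d"
proof -
  let ?J = "I \<inter> I'"
  obtain P P' where P: "P \<in> \<PP>" "P' \<in> \<PP>" "I \<in> P" "I' \<in> P'" "?J \<noteq> {}"
    using assms paramsD(1) unfolding joins_def by blast
  then have J: "?J \<in> meet P P'" by (auto simp: meet_def)
  have w: "0 < w $ i" if "i \<in> ?J" for i using joins_bounds(1)[OF assms that] by simp
  have "abs_mean I I' w = smoothed (\<lambda>x. \<bar>K x\<bar>) f x0 ?J w"
  proof -
    have "scaled_kernel (\<lambda>x. \<bar>K x\<bar>) ?J w x = \<bar>scaled_kernel K ?J w x\<bar>" for x
      by (rule scaled_kernel_abs) (rule w)
    then show ?thesis unfolding smoothed_def kernel_at_def by simp
  qed
  also have "\<dots> \<le> F * B ^ card ?J"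
    using smoothed_abs_le[OF fD(1) kernel_like_abs[OF K_like] w marginal_le[OF P(1,2) J], of x0] F by auto
  also have "\<dots> \<le> F * B ^ d"
    using F B1 by (intro mult_left_mono power_increasing) (auto simp: d_eq intro!: card_mono)
  finally show ?thesis .
qed

definition GF :: real where "GF = max 1 (F * B ^ d)"

text \<open>The deterministic counterpart of \<open>G_bar / 2\<close>. It depends on f, so only its
  bound \<open>GF\<close> may enter the final constants.\<close>

definition Gs :: real where
  "Gs = (SUP (I, I', w) \<in> joins top_cost. max 1 (abs_mean I I' w))"

lemma joins_ne: "joins top_cost \<noteq> {}"
proof -
  obtain h P where hP: "(h, P) \<in> params" using params_ne by auto
  obtain I where I: "I \<in> P" using part_ne[OF paramsD(1)[OF hP]] by blast
  have "cost h P h P \<le> real top_cost" using cost_le[OF hP hP] top_cost(2) by linarith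
  moreover have "I \<inter> I \<noteq> {}" using partition_on_part[OF paramsD(2)[OF hP] I] by simp
  ultimately have "(I, I, sup h h) \<in> joins top_cost" using hP I unfolding joins_def by blast
  then show ?thesis by auto
qed

lemma Gs_bdd: "bdd_above ((\<lambda>(I, I', w). max 1 (abs_mean I I' w)) ` joins top_cost)"
  by (rule bdd_aboveI2[where M = GF]) (auto simp: GF_def max.coboundedI2 abs_mean_le split: prod.splits)

lemma Gs_le: "Gs \<le> GF"
  unfolding Gs_def by (rule cSUP_least[OF joins_ne]) (auto simp: GF_def max.coboundedI2 abs_mean_le split: prod.splits)

lemma Gs_ge:
  assumes "(I, I', w) \<in> joins l" "l \<le> top_cost"
  shows "max 1 (abs_mean I I' w) \<le> Gs"
proof -
  have "(I, I', w) \<in> joins top_cost" using joins_mono[OF assms(2)] assms(1) by auto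
  then show ?thesis unfolding Gs_def by (rule cSUP_upper2[OF Gs_bdd]) simp
qed

lemma Gs1: "1 \<le> Gs"
proof -
  obtain I I' w where "(I, I', w) \<in> joins top_cost" using joins_ne by auto
  from Gs_ge[OF this] show ?thesis by simp
qed

lemma A_ge: "(real d + 3) * q + 2 \<le> real A"
  unfolding A_eq mom_exp_def by simp linarith

definition thr :: real where "thr = thr_const B L q d"

lemma thr_pos: "0 < thr"
  unfolding thr_def thr_const_def using lip1 B1 A8 A_eq by auto

lemma three_pow: "(1 / 3) ^ m \<le> exp (- real m)"
proof -
  have "(1 / 3 :: real) \<le> exp (- 1)" using exp_le by (simp add: exp_minus field_simps)
  then have "(1 / 3 :: real) ^ m \<le> exp (- 1) ^ m" by (intro power_mono) auto
  then show ?thesis by (simp add: exp_of_nat_mult[symmetric])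
qed

text \<open>The factor 396 in \<open>thr_const\<close> is 3 * 132, so the threshold is three times
  the chaining bound, and moments of order A l normalised by it acquire the factor (1 / 3)^(A
  l).\<close>

lemma uniform_thr:
  assumes "1 \<le> l"
  shows "132 * lip_const B L d * sqrt (2 * B ^ d * real (A * l) * G / real n) = thr * sqrt (real l * G / real n) / 3"
proof -
  have "sqrt (2 * B ^ d * real (A * l) * G / real n) = sqrt (2 * B ^ d * real A) * sqrt (real l * G / real n)"
    unfolding real_sqrt_mult[symmetric] by (simp add: mult_ac)
  then show ?thesis by (simp add: thr_def thr_const_def A_eq)
qed

text \<open>One variable has to serve all levels, blocks and bandwidths. It is a weighted sum of the
  majorants of the levels, the weights being those with which \<open>excess_le\<close> applies at
  each level.\<close>

lemma remainder_exists:
  "\<exists>Z. Z \<in> borel_measurable samples \<and>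
     (\<forall>X I I' w l. 1 \<le> l \<longrightarrow> l \<le> top_cost \<longrightarrow> (I, I', w) \<in> joins l \<longrightarrow>
        ennreal (max 0 (\<bar>dev K (I \<inter> I') w X\<bar> - thr * sqrt (Gs * real l / (real n * vol w (I \<inter> I')))) powr q) \<le> Z X) \<and>
     (\<integral>\<^sup>+X. Z X \<partial>samples) \<le> ennreal (2 * (thr powr q * GF powr q * sum_const \<zz> q d) * (real n * V_max) powr (- q / 2))"
proof -
  have n0: "0 < real n" using n by simp
  define t where "t l = thr * sqrt (real l * Gs / real n)" for l :: nat
  have t0: "0 < t l" if "1 \<le> l" for l unfolding t_def using that thr_pos Gs1 n0 by auto
  have "\<forall>l. \<exists>S. 1 \<le> l \<and> l \<le> top_cost \<longrightarrow> S \<in> borel_measurable samples \<and>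
    (\<forall>X I I' w. (I, I', w) \<in> joins l \<longrightarrow> ennreal ((sqrt (vol w (I \<inter> I')) * \<bar>dev K (I \<inter> I') w X\<bar>) ^ (A * l)) \<le> S X) \<and>
    (\<integral>\<^sup>+X. S X \<partial>samples) \<le> ennreal (cell_count \<zz> d l * (t l / 3) ^ (A * l))"
  proof
    fix l
    show "\<exists>S. 1 \<le> l \<and> l \<le> top_cost \<longrightarrow> S \<in> borel_measurable samples \<and>
    (\<forall>X I I' w. (I, I', w) \<in> joins l \<longrightarrow> ennreal ((sqrt (vol w (I \<inter> I')) * \<bar>dev K (I \<inter> I') w X\<bar>) ^ (A * l)) \<le> S X) \<and>
    (\<integral>\<^sup>+X. S X \<partial>samples) \<le> ennreal (cell_count \<zz> d l * (t l / 3) ^ (A * l))"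
    proof (cases "1 \<le> l \<and> l \<le> top_cost")
      case True
      then have l: "1 \<le> l" "l \<le> top_cost" by auto
      have G: "abs_mean I I' w \<le> Gs" if "(I, I', w) \<in> joins l" for I I' w using Gs_ge[OF that l(2)] by simp
      have l2: "real l \<le> 2 * ln (real n)" using l(2) top_cost(3) by linarith
      show ?thesis
        using uniform_moment[OF K_like Gs1 G l(1) l2] unfolding uniform_thr[OF l(1)] t_def by simp
    qed auto
  qed
  from choice[OF this] obtain S where S: "\<And>l. 1 \<le> l \<Longrightarrow> l \<le> top_cost \<Longrightarrow> S l \<in> borel_measurable samples"
    "\<And>l X I I' w. 1 \<le> l \<Longrightarrow> l \<le> top_cost \<Longrightarrow> (I, I', w) \<in> joins l \<Longrightarrow>
       ennreal ((sqrt (vol w (I \<inter> I')) * \<bar>dev K (I \<inter> I') w X\<bar>) ^ (A * l)) \<le> S l X"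
    "\<And>l. 1 \<le> l \<Longrightarrow> l \<le> top_cost \<Longrightarrow> (\<integral>\<^sup>+X. S l X \<partial>samples) \<le> ennreal (cell_count \<zz> d l * (t l / 3) ^ (A * l))"
    by blast
  \<comment> \<open>The weight joins the factor t^(q - A l) of \<open>excess_le\<close> to the
    largest value of vol^(-q/2) that \<open>joins_bounds\<close> permits at level l; the latter
    undoes the normalisation by sqrt (vol w).\<close>
  define c where "c l = (V_max * exp (- 2 * real l)) powr (- q / 2) * t l powr (q - real (A * l))" for l :: nat
  have c0: "0 \<le> c l" for l unfolding c_def by simp
  have qA: "q \<le> real (A * l)" if "1 \<le> l" for l
  proof -
    have "1 * q \<le> (real d + 3) * q" using q by (intro mult_right_mono) auto
    then have "q \<le> real A * 1" using A_ge by linarith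
    also have "\<dots> \<le> real A * real l" using that by (intro mult_left_mono) auto
    finally show ?thesis by simp
  qed
  let ?Z = "\<lambda>X. \<Sum>l\<in>{1..top_cost}. ennreal (c l) * S l X"
  define Cz where "Cz = thr powr q * GF powr q * sum_const \<zz> q d"
  define r where "r = (real n * V_max) powr (- q / 2)"
  have Cz0: "0 \<le> Cz" unfolding Cz_def sum_const_def by simp
  have Zm: "(\<lambda>X. ennreal (c l) * S l X) \<in> borel_measurable samples" if "l \<in> {1..top_cost}" for l
  proof -
    have "S l \<in> borel_measurable samples" using that by (intro S(1)) auto
    then show ?thesis by measurable
  qed
  show ?thesis unfolding Cz_def[symmetric] r_def[symmetric]
  proof (intro exI[of _ ?Z] conjI allI impI)
    show "?Z \<in> borel_measurable samples" by (intro borel_measurable_sum Zm)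
    fix X I I' w l assume l: "1 \<le> l" "l \<le> top_cost" and w: "(I, I', w) \<in> joins l"
    let ?J = "I \<inter> I'" and ?x = "\<bar>dev K (I \<inter> I') w X\<bar>"
    have v0: "0 < vol w ?J" using joins_bounds(1)[OF w] by (intro vol_pos) auto
    have Tw: "thr * sqrt (Gs * real l / (real n * vol w ?J)) = t l / sqrt (vol w ?J)"
      unfolding t_def using v0 n0 by (simp add: real_sqrt_divide real_sqrt_mult mult_ac)
    have "max 0 (?x - t l / sqrt (vol w ?J)) = max 0 (sqrt (vol w ?J) * ?x - t l) / sqrt (vol w ?J)"
      using v0 by (simp add: max_def field_simps)
    then have "max 0 (?x - t l / sqrt (vol w ?J)) powr q = max 0 (sqrt (vol w ?J) * ?x - t l) powr q * sqrt (vol w ?J) powr (- q)"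
      using v0 by (simp add: powr_divide powr_minus_divide)
    also have "sqrt (vol w ?J) powr (- q) = vol w ?J powr (- q / 2)"
      using v0 by (simp add: powr_half_sqrt[symmetric] powr_powr)
    also have "max 0 (sqrt (vol w ?J) * ?x - t l) powr q * vol w ?J powr (- q / 2)
       \<le> ((sqrt (vol w ?J) * ?x) ^ (A * l) * t l powr (q - real (A * l))) * (V_max * exp (- 2 * real l)) powr (- q / 2)"
    proof (rule mult_mono)
      show "max 0 (sqrt (vol w ?J) * ?x - t l) powr q \<le> (sqrt (vol w ?J) * ?x) ^ (A * l) * t l powr (q - real (A * l))"
        using q v0 by (intro excess_le t0 l(1) qA) auto
      show "vol w ?J powr (- q / 2) \<le> (V_max * exp (- 2 * real l)) powr (- q / 2)"
        using joins_bounds(2)[OF w] V_max_pos q by (intro powr_mono2') auto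
    qed (use v0 in auto)
    finally have "max 0 (?x - thr * sqrt (Gs * real l / (real n * vol w ?J))) powr q \<le> c l * (sqrt (vol w ?J) * ?x) ^ (A * l)"
      unfolding Tw c_def by (simp add: mult_ac)
    then have "ennreal (max 0 (?x - thr * sqrt (Gs * real l / (real n * vol w ?J))) powr q)
        \<le> ennreal (c l) * ennreal ((sqrt (vol w ?J) * ?x) ^ (A * l))"
      using c0 v0 by (subst ennreal_mult[symmetric]) (auto intro: ennreal_leI)
    also have "\<dots> \<le> ennreal (c l) * S l X" by (intro mult_left_mono S(2)[OF l w]) simp
    also have "\<dots> \<le> ?Z X" by (rule member_le_sum) (use l in auto)
    finally show "ennreal (max 0 (?x - thr * sqrt (Gs * real l / (real n * vol w ?J))) powr q) \<le> ?Z X" .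
  next
    \<comment> \<open>As \<open>A \<ge> q + 2\<close>, the factor (1 / 3)^(A l) supplies three
      parts: exp (- q l) cancels the loss in replacing the volume by \<open>V_max\<close>, one exp
      (- l) absorbs \<open>cell_count\<close> times l^q, and the last one makes the sum over l
      converge.\<close>
    have one_term: "c l * (cell_count \<zz> d l * (t l / 3) ^ (A * l)) \<le> Cz * r * exp (- 1) ^ l" if l: "1 \<le> l" for l
    proof -
      have l0: "0 < real l" using l by simp
      have "t l powr (q - real (A * l)) * (t l / 3) ^ (A * l) = t l powr q * (1 / 3) ^ (A * l)"
      proof -
        have "t l ^ (A * l) = t l powr real (A * l)" by (rule powr_realpow[OF t0[OF l], symmetric])
        then have "t l powr (q - real (A * l)) * t l ^ (A * l) = t l powr q" by (simp add: powr_add[symmetric])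
        then show ?thesis by (simp add: power_divide power_one_over)
      qed
      then have e1: "c l * (cell_count \<zz> d l * (t l / 3) ^ (A * l))
          = cell_count \<zz> d l * (V_max * exp (- 2 * real l)) powr (- q / 2) * (t l powr q * (1 / 3) ^ (A * l))"
        by (simp add: c_def mult_ac)
      have e2: "(V_max * exp (- 2 * real l)) powr (- q / 2) = V_max powr (- q / 2) * exp (q * real l)"
        using V_max_pos by (simp add: powr_mult exp_powr_real)
      have "t l powr q = thr powr q * (real l * Gs / real n) powr (q / 2)"
        unfolding t_def using thr_pos Gs1 n0 l0 by (simp add: powr_mult powr_half_sqrt[symmetric] powr_powr)
      also have "(real l * Gs / real n) powr (q / 2) = real l powr (q / 2) * Gs powr (q / 2) * real n powr (- q / 2)"
      proof -
        have "(real l * Gs / real n) powr (q / 2) = (real l * Gs) powr (q / 2) / real n powr (q / 2)"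
          by (rule powr_divide)
        then show ?thesis by (simp add: powr_mult powr_minus_divide)
      qed
      also have "real l powr (q / 2) * Gs powr (q / 2) * real n powr (- q / 2) \<le> real l powr q * GF powr q * real n powr (- q / 2)"
      proof (intro mult_right_mono mult_mono)
        show "real l powr (q / 2) \<le> real l powr q" using l q by (intro powr_mono) auto
        have "Gs powr (q / 2) \<le> GF powr (q / 2)" using Gs1 Gs_le q by (intro powr_mono2) auto
        also have "\<dots> \<le> GF powr q" using Gs1 Gs_le q by (intro powr_mono) auto
        finally show "Gs powr (q / 2) \<le> GF powr q" .
      qed auto
      finally have e3: "t l powr q \<le> thr powr q * (real l powr q * GF powr q * real n powr (- q / 2))"
        by (simp add: mult_left_mono)
      have e4: "(1 / 3) ^ (A * l) \<le> exp (- (q * real l)) * (exp (- real l) * exp (- 1) ^ l)"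
      proof -
        have "(1 / 3) ^ (A * l) \<le> exp (- real (A * l))" by (rule three_pow)
        also have "\<dots> \<le> exp (- ((q + 2) * real l))"
        proof -
          have "1 * q \<le> (real d + 3) * q" using q by (intro mult_right_mono) auto
          then have "(q + 2) * real l \<le> real A * real l" using A_ge by (intro mult_right_mono) auto
          then show ?thesis by simp
        qed
        also have "\<dots> = exp (- (q * real l)) * (exp (- real l) * exp (- 1) ^ l)"
          by (simp add: exp_add[symmetric] exp_of_nat_mult[symmetric] algebra_simps)
        finally show ?thesis .
      qed
      have "c l * (cell_count \<zz> d l * (t l / 3) ^ (A * l))
         \<le> cell_count \<zz> d l * (V_max powr (- q / 2) * exp (q * real l)) *
           ((thr powr q * (real l powr q * GF powr q * real n powr (- q / 2))) * (exp (- (q * real l)) * (exp (- real l) * exp (- 1) ^ l)))"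
        unfolding e1 e2 using e3 e4 by (intro mult_left_mono mult_mono) (auto simp: cell_count_def)
      also have "\<dots> = (exp (q * real l) * exp (- (q * real l))) * (cell_count \<zz> d l * real l powr q * exp (- real l)) *
           (thr powr q * GF powr q * (real n powr (- q / 2) * V_max powr (- q / 2)) * exp (- 1) ^ l)"
        by (simp only: mult_ac)
      also have "exp (q * real l) * exp (- (q * real l)) = 1" by (simp add: exp_minus)
      also have "real n powr (- q / 2) * V_max powr (- q / 2) = r"
        unfolding r_def using n0 V_max_pos by (simp add: powr_mult)
      also have "1 * (cell_count \<zz> d l * real l powr q * exp (- real l)) * (thr powr q * GF powr q * r * exp (- 1) ^ l)
         \<le> sum_const \<zz> q d * (thr powr q * GF powr q * r * exp (- 1) ^ l)"
        using cell_count_bound[OF q l, of \<zz> d] unfolding r_def by (intro mult_right_mono) auto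
      finally show ?thesis by (simp add: Cz_def mult_ac)
    qed
    have "(\<integral>\<^sup>+X. ?Z X \<partial>samples) = (\<Sum>l\<in>{1..top_cost}. ennreal (c l) * (\<integral>\<^sup>+X. S l X \<partial>samples))"
    proof (subst nn_integral_sum[OF Zm], assumption, rule sum.cong[OF refl])
      fix l assume "l \<in> {1..top_cost}"
      then show "(\<integral>\<^sup>+X. ennreal (c l) * S l X \<partial>samples) = ennreal (c l) * (\<integral>\<^sup>+X. S l X \<partial>samples)"
        by (intro nn_integral_cmult S(1)) auto
    qed
    also have "\<dots> \<le> (\<Sum>l\<in>{1..top_cost}. ennreal (Cz * r * exp (- 1) ^ l))"
    proof (rule sum_mono)
      fix l assume "l \<in> {1..top_cost}"
      then have l: "1 \<le> l" "l \<le> top_cost" by auto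
      have "ennreal (c l) * (\<integral>\<^sup>+X. S l X \<partial>samples) \<le> ennreal (c l) * ennreal (cell_count \<zz> d l * (t l / 3) ^ (A * l))"
        by (intro mult_left_mono S(3) l) simp
      also have "\<dots> = ennreal (c l * (cell_count \<zz> d l * (t l / 3) ^ (A * l)))"
        using c0 t0[OF l(1)] by (subst ennreal_mult) (auto simp: cell_count_def)
      also have "\<dots> \<le> ennreal (Cz * r * exp (- 1) ^ l)" by (rule ennreal_leI[OF one_term[OF l(1)]])
      finally show "ennreal (c l) * (\<integral>\<^sup>+X. S l X \<partial>samples) \<le> ennreal (Cz * r * exp (- 1) ^ l)" .
    qed
    also have "\<dots> = ennreal (\<Sum>l\<in>{1..top_cost}. Cz * r * exp (- 1) ^ l)"
      using Cz0 by (intro sum_ennreal) (auto simp: r_def)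
    also have "\<dots> \<le> ennreal (2 * Cz * r)"
    proof (rule ennreal_leI)
      have e: "exp (- 1) \<le> (1 / 2 :: real)"
      proof -
        have "2 \<le> exp (1::real)" using exp_ge_add_one_self[of 1] by simp
        then show ?thesis by (simp add: exp_minus field_simps)
      qed
      have "(\<Sum>l\<in>{1..top_cost}. exp (- 1) ^ l) \<le> (\<Sum>l\<in>{1..top_cost}. (1 / 2 :: real) ^ l)"
        using e by (intro sum_mono power_mono) auto
      also have "\<dots> \<le> (\<Sum>l. (1 / 2 :: real) ^ l)" by (rule sum_le_suminf) (auto simp: summable_geometric)
      also have "\<dots> = 2" by (subst suminf_geometric) auto
      finally have "Cz * r * (\<Sum>l\<in>{1..top_cost}. exp (- 1) ^ l) \<le> Cz * r * 2"
        using Cz0 by (intro mult_left_mono) (auto simp: r_def)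
      then show "(\<Sum>l\<in>{1..top_cost}. Cz * r * exp (- 1) ^ l) \<le> 2 * Cz * r"
        by (simp add: sum_distrib_left)
    qed
    finally show "(\<integral>\<^sup>+X. ?Z X \<partial>samples) \<le> ennreal (2 * Cz * r)" .
  qed
qed

text \<open>Markov's inequality for the majorant at the single level \<open>top_cost\<close>, which
  already contains every admissible join, because no cost exceeds ln n.\<close>

lemma bad_event_exists:
  "\<exists>E. E \<in> sets samples \<and> emeasure samples E \<le> ennreal (cell_count \<zz> d top_cost * (1 / 3) ^ (A * top_cost)) \<and>
     (\<forall>X\<in>space samples - E. \<forall>I I' w. (I, I', w) \<in> joins top_cost \<longrightarrow> \<bar>dev (\<lambda>x. \<bar>K x\<bar>) (I \<inter> I') w X\<bar> \<le> Gs / 4)"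
proof -
  have n0: "0 < real n" using n by simp
  let ?k = "\<lambda>x. \<bar>K x\<bar>" and ?p = "A * top_cost"
  have k: "kernel_like ?k B L" by (rule kernel_like_abs[OF K_like])
  have G: "(\<integral>x. \<bar>kernel_at ?k (I \<inter> I') w x\<bar> \<partial>law f) \<le> Gs" if w: "(I, I', w) \<in> joins top_cost" for I I' w
  proof -
    have "\<bar>kernel_at ?k (I \<inter> I') w x\<bar> = \<bar>kernel_at K (I \<inter> I') w x\<bar>" for x
      unfolding kernel_at_def using joins_bounds(1)[OF w] by (subst scaled_kernel_abs) auto
    then show ?thesis using Gs_ge[OF w order_refl] by simp
  qed
  obtain S where S: "S \<in> borel_measurable samples"
    "\<And>X I I' w. (I, I', w) \<in> joins top_cost \<Longrightarrow> ennreal ((sqrt (vol w (I \<inter> I')) * \<bar>dev ?k (I \<inter> I') w X\<bar>) ^ ?p) \<le> S X"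
    "(\<integral>\<^sup>+X. S X \<partial>samples) \<le> ennreal (cell_count \<zz> d top_cost * (thr * sqrt (real top_cost * Gs / real n) / 3) ^ ?p)"
    using uniform_moment[OF k Gs1 G top_cost(1,3)] unfolding uniform_thr[OF top_cost(1)] by blast
  \<comment> \<open>Off the event, sqrt (vol w) times the deviation is below \<open>s\<close>; since
    vol w is at least ln n / (a n), the deviation itself is then below Gs / 4.\<close>
  define s where "s = sqrt (ln (real n) / (a * real n)) * (Gs / 4)"
  have lnp: "0 < ln (real n)" using ln_n by linarith
  have s0: "0 < s" unfolding s_def using lnp a_pos n0 Gs1 by auto
  define E where "E = {X\<in>space samples. ennreal (s ^ ?p) \<le> S X}"
  have E: "E \<in> sets samples" unfolding E_def using S(1) by measurable
  have p0: "0 < ?p" using A8(2) top_cost(1) by simp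
  \<comment> \<open>Here the smallness of \<open>a\<close> enters, as 32 thr^2 a \<le> 1: the 32 is
    2 from \<open>top_cost \<le> 2 * ln n\<close> times 16 from squaring Gs / 4.\<close>
  have ratio: "thr * sqrt (real top_cost * Gs / real n) / 3 \<le> s / 3"
  proof -
    have "(thr * sqrt (real top_cost * Gs / real n))\<^sup>2 = thr\<^sup>2 * (real top_cost * Gs / real n)"
      using Gs1 by (simp add: power_mult_distrib)
    also have "\<dots> \<le> thr\<^sup>2 * (2 * ln (real n) * (Gs * Gs) / real n)"
    proof (intro mult_left_mono divide_right_mono mult_mono)
      show "Gs \<le> Gs * Gs" using Gs1 by (simp add: mult_left_le)
    qed (use top_cost(3) Gs1 lnp in auto)
    also have "\<dots> = (32 * thr\<^sup>2 * a) * (ln (real n) / (a * real n) * (Gs / 4)\<^sup>2)"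
      using a_pos by (simp add: power2_eq_square field_simps)
    also have "\<dots> \<le> 1 * (ln (real n) / (a * real n) * (Gs / 4)\<^sup>2)"
    proof (rule mult_right_mono)
      have "0 \<le> thr\<^sup>2 * a" using a_pos by simp
      then show "32 * thr\<^sup>2 * a \<le> 1" using a_thr unfolding thr_def by linarith
    qed (use lnp a_pos in auto)
    also have "\<dots> = s\<^sup>2"
      unfolding s_def power_mult_distrib using lnp a_pos by (subst real_sqrt_pow2) auto
    finally have "thr * sqrt (real top_cost * Gs / real n) \<le> s" using s0 by (rule power2_le_imp_le[OF _ less_imp_le])
    then show ?thesis by simp
  qed
  show ?thesis
  proof (intro exI[of _ E] conjI ballI allI impI E)
    have "ennreal (s ^ ?p) * emeasure samples E \<le> (\<integral>\<^sup>+X. S X \<partial>samples)"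
    proof -
      have "ennreal (s ^ ?p) * emeasure samples E = (\<integral>\<^sup>+X. ennreal (s ^ ?p) * indicator E X \<partial>samples)"
        using E by (simp add: nn_integral_cmult_indicator)
      also have "\<dots> \<le> (\<integral>\<^sup>+X. S X \<partial>samples)" by (intro nn_integral_mono) (auto simp: E_def indicator_def)
      finally show ?thesis .
    qed
    also have "\<dots> \<le> ennreal (cell_count \<zz> d top_cost * (s / 3) ^ ?p)"
    proof (rule order_trans[OF S(3)], rule ennreal_leI)
      show "cell_count \<zz> d top_cost * (thr * sqrt (real top_cost * Gs / real n) / 3) ^ ?p \<le> cell_count \<zz> d top_cost * (s / 3) ^ ?p"
        using ratio thr_pos Gs1 by (intro mult_left_mono power_mono) (auto simp: cell_count_def)
    qed
    also have "\<dots> = ennreal (s ^ ?p) * ennreal (cell_count \<zz> d top_cost * (1 / 3) ^ ?p)"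
      using s0 by (subst ennreal_mult[symmetric]) (auto simp: cell_count_def power_divide)
    finally show "emeasure samples E \<le> ennreal (cell_count \<zz> d top_cost * (1 / 3) ^ ?p)"
      using s0 by (subst (asm) ennreal_mult_le_mult_iff) auto
    fix X I I' w assume X: "X \<in> space samples - E" and w: "(I, I', w) \<in> joins top_cost"
    let ?x = "\<bar>dev ?k (I \<inter> I') w X\<bar>" and ?v = "vol w (I \<inter> I')"
    have "S X < ennreal (s ^ ?p)" using X by (auto simp: E_def)
    then have "ennreal ((sqrt ?v * ?x) ^ ?p) < ennreal (s ^ ?p)" using S(2)[OF w, of X] by (rule le_less_trans[rotated])
    moreover have "0 < ?v" using joins_bounds(1)[OF w] by (intro vol_pos) auto
    ultimately have "(sqrt ?v * ?x) ^ ?p < s ^ ?p" by (subst (asm) ennreal_less_iff) auto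
    then have "sqrt ?v * ?x < s" by (rule power_less_imp_less_base) (use s0 in simp)
    moreover have "sqrt (ln (real n) / (a * real n)) * ?x \<le> sqrt ?v * ?x"
      using joins_bounds(3)[OF w] by (intro mult_right_mono real_sqrt_le_mono) auto
    ultimately have "sqrt (ln (real n) / (a * real n)) * ?x < sqrt (ln (real n) / (a * real n)) * (Gs / 4)"
      unfolding s_def by linarith
    moreover have "0 < sqrt (ln (real n) / (a * real n))" using lnp a_pos n0 by auto
    ultimately show "?x \<le> Gs / 4" by (simp add: mult_less_cancel_left_pos)
  qed
qed

end

section \<open>The selection argument\<close>

lemma card_partition_le:
  fixes P :: "'d::finite set set"
  assumes "partition_on UNIV P"
  shows "card P \<le> CARD('d)"
proof -
  have ne: "(SOME x. x \<in> I) \<in> I" if "I \<in> P" for I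
    using partition_on_part[OF assms that] by (simp add: some_in_eq)
  have "inj_on (\<lambda>I. SOME x. x \<in> I) P"
  proof (rule inj_onI)
    fix I J assume IJ: "I \<in> P" "J \<in> P" "(SOME x. x \<in> I) = (SOME x. x \<in> J)"
    then have "(SOME x. x \<in> I) \<in> I \<inter> J" using ne[OF IJ(1)] ne[OF IJ(2)] by simp
    then show "I = J" using assms IJ(1,2) disjointD[of P I J] by (auto simp: partition_on_def)
  qed
  then show ?thesis by (rule card_inj_on_le) auto
qed

lemma partition_on_meet:
  assumes P: "partition_on UNIV P" and P': "partition_on UNIV P'"
  shows "partition_on UNIV (meet P P')"
proof (rule partition_onI)
  show "\<Union> (meet P P') = UNIV"
  proof (intro equalityI subset_UNIV subsetI)
    fix x :: 'a
    obtain I I' where "I \<in> P" "x \<in> I" "I' \<in> P'" "x \<in> I'"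
      using P P' unfolding partition_on_def by blast
    then show "x \<in> \<Union> (meet P P')" unfolding meet_def by blast
  qed
  fix J J' assume J: "J \<in> meet P P'" "J' \<in> meet P P'" "J \<noteq> J'"
  then obtain I1 I1' I2 I2' where "J = I1 \<inter> I1'" "I1 \<in> P" "I1' \<in> P'" "J' = I2 \<inter> I2'" "I2 \<in> P" "I2' \<in> P'"
    unfolding meet_def by blast
  note I = this
  show "disjnt J J'"
  proof (cases "I1 = I2")
    case True
    then have "I1' \<noteq> I2'" using I J(3) by auto
    then have "I1' \<inter> I2' = {}" using P' I by (intro disjointD[of P']) (auto simp: partition_on_def)
    then show ?thesis using I by (auto simp: disjnt_def)
  next
    case False
    then have "I1 \<inter> I2 = {}" using P I by (intro disjointD[of P]) (auto simp: partition_on_def)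
    then show ?thesis using I by (auto simp: disjnt_def)
  qed
qed (auto simp: meet_def)

lemma meet_commute: "meet P P' = meet P' P"
  unfolding meet_def by blast

lemma meet_self:
  assumes "partition_on UNIV P"
  shows "meet P P = P"
proof (intro equalityI subsetI)
  fix J assume "J \<in> meet P P"
  then obtain I I' where I: "I \<in> P" "I' \<in> P" "J = I \<inter> I'" "I \<inter> I' \<noteq> {}" unfolding meet_def by blast
  then have "I = I'" using assms disjointD[of P I I'] by (auto simp: partition_on_def)
  then show "J \<in> P" using I by simp
next
  fix J assume J: "J \<in> P"
  then have "J \<noteq> {}" by (rule partition_on_part[OF assms])
  then show "J \<in> meet P P" unfolding meet_def using J by (intro CollectI exI[of _ J]) auto
qed

text \<open>A nonempty intersection determines its pair of blocks, so the meet is reindexed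
  injectively. Grouping by the blocks of \<open>P'\<close> is the form to which
  \<open>sm_factor\<close> applies.\<close>

lemma prod_meet:
  fixes \<phi> :: "'d::finite set \<Rightarrow> real"
  assumes P: "partition_on UNIV P" and P': "partition_on UNIV P'"
  shows "(\<Prod>J\<in>meet P P'. \<phi> J) = (\<Prod>I'\<in>P'. \<Prod>I\<in>{I\<in>P. I \<inter> I' \<noteq> {}}. \<phi> (I \<inter> I'))"
proof -
  define T where "T = Sigma P' (\<lambda>I'. {I\<in>P. I \<inter> I' \<noteq> {}})"
  have img: "meet P P' = (\<lambda>(I', I). I \<inter> I') ` T" unfolding meet_def T_def by auto
  have inj: "inj_on (\<lambda>(I', I). I \<inter> I') T"
  proof (rule inj_onI, clarify)
    fix I I' J J' assume a: "(I', I) \<in> T" "(J', J) \<in> T" "I \<inter> I' = J \<inter> J'"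
    then have "I \<inter> J \<noteq> {}" "I' \<inter> J' \<noteq> {}" unfolding T_def by auto
    then show "I' = J' \<and> I = J"
      using a(1,2) P P' disjointD[of P I J] disjointD[of P' I' J'] by (auto simp: T_def partition_on_def)
  qed
  have "(\<Prod>J\<in>meet P P'. \<phi> J) = (\<Prod>(I', I)\<in>T. \<phi> (I \<inter> I'))"
    unfolding img prod.reindex[OF inj] by (simp add: case_prod_beta comp_def)
  also have "\<dots> = (\<Prod>I'\<in>P'. \<Prod>I\<in>{I\<in>P. I \<inter> I' \<noteq> {}}. \<phi> (I \<inter> I'))"
    unfolding T_def by (rule prod.Sigma[symmetric]) auto
  finally show ?thesis .
qed

lemma prod_diff_le:
  fixes x y :: "'i \<Rightarrow> real"
  assumes g: "1 \<le> g" and x: "\<And>i. i \<in> I \<Longrightarrow> \<bar>x i\<bar> \<le> g" and y: "\<And>i. i \<in> I \<Longrightarrow> \<bar>y i\<bar> \<le> g"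
    and D: "\<And>i. i \<in> I \<Longrightarrow> \<bar>x i - y i\<bar> \<le> D" and I: "card I \<le> d" "1 \<le> d" and D0: "0 \<le> D"
  shows "\<bar>(\<Prod>i\<in>I. x i) - (\<Prod>i\<in>I. y i)\<bar> \<le> real d * g ^ (d - 1) * D"
proof -
  have "\<bar>(\<Prod>i\<in>I. x i) - (\<Prod>i\<in>I. y i)\<bar> \<le> g ^ card I * ((\<Sum>i\<in>I. \<bar>x i - y i\<bar>) / g)"
    using g by (intro prod_diff_bound x y) auto
  also have "\<dots> \<le> g ^ d * ((real d * D) / g)"
  proof (intro mult_mono divide_right_mono power_increasing)
    have "(\<Sum>i\<in>I. \<bar>x i - y i\<bar>) \<le> real (card I) * D" using sum_bounded_above[of I "\<lambda>i. \<bar>x i - y i\<bar>" D] D by simp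
    also have "\<dots> \<le> real d * D" using I D0 by (intro mult_right_mono) auto
    finally show "(\<Sum>i\<in>I. \<bar>x i - y i\<bar>) \<le> real d * D" .
  qed (use g I in \<open>auto intro!: sum_nonneg divide_nonneg_nonneg\<close>)
  also have "g ^ d * ((real d * D) / g) = real d * g ^ (d - 1) * D"
    using g I(2) by (simp add: power_eq_if)
  finally show ?thesis .
qed

context adaptive
begin

section \<open>Elementary bounds for the estimators and factorisation of their expectations\<close>

definition sm :: "'d set \<Rightarrow> real ^ 'd \<Rightarrow> real" where
  "sm J w = smoothed K f x0 J w"

lemma kde_eq: "kde J w X = dev K J w X + sm J w"
  by (simp add: kde_def dev_def emp_dev_def sm_def smoothed_def kernel_at_def)

lemma sup_unit: "(h, P) \<in> params \<Longrightarrow> (\<eta>, P') \<in> params \<Longrightarrow> 0 < sup h \<eta> $ i \<and> sup h \<eta> $ i \<le> 1"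
  using paramsD(6)[of h P i] paramsD(6)[of \<eta> P' i] by (simp add: sup_vec_nth less_max_iff_disj)

lemma meetE:
  assumes "J \<in> meet P P'"
  obtains I I' where "I \<in> P" "I' \<in> P'" "J = I \<inter> I'" "I \<inter> I' \<noteq> {}"
  using assms unfolding meet_def by blast

lemma joins_top:
  assumes "(h, P) \<in> params" "(\<eta>, P') \<in> params" "I \<in> P" "I' \<in> P'" "I \<inter> I' \<noteq> {}"
  shows "(I, I', sup h \<eta>) \<in> joins (nat \<lceil>cost h P \<eta> P'\<rceil>)" "nat \<lceil>cost h P \<eta> P'\<rceil> \<le> top_cost"
    "1 \<le> nat \<lceil>cost h P \<eta> P'\<rceil>" "real (nat \<lceil>cost h P \<eta> P'\<rceil>) \<le> 2 * cost h P \<eta> P'" "(I, I', sup h \<eta>) \<in> joins top_cost"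
proof -
  have c: "1 \<le> cost h P \<eta> P'" by (simp add: cost_def)
  show 1: "(I, I', sup h \<eta>) \<in> joins (nat \<lceil>cost h P \<eta> P'\<rceil>)"
  proof -
    have "cost h P \<eta> P' \<le> real (nat \<lceil>cost h P \<eta> P'\<rceil>)" by linarith
    then show ?thesis using assms unfolding joins_def by blast
  qed
  show 2: "nat \<lceil>cost h P \<eta> P'\<rceil> \<le> top_cost"
    unfolding top_cost_def using cost_le[OF assms(1,2)] by (intro nat_mono ceiling_mono)
  show "1 \<le> nat \<lceil>cost h P \<eta> P'\<rceil>" "real (nat \<lceil>cost h P \<eta> P'\<rceil>) \<le> 2 * cost h P \<eta> P'" using c by linarith+
  show "(I, I', sup h \<eta>) \<in> joins top_cost" using joins_mono[OF 2] 1 by auto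
qed

lemma kernel_at_le:
  assumes w: "\<And>i. 0 < w $ i \<and> w $ i \<le> 1" and v: "1 / real n \<le> vol w J"
  shows "\<bar>kernel_at K J w x\<bar> \<le> B ^ d * real n"
proof -
  have "\<bar>kernel_at K J w x\<bar> \<le> B ^ card J / vol w J"
    unfolding kernel_at_def using w by (intro scaled_kernel_bound[OF K_like]) auto
  also have "\<dots> \<le> B ^ d / (1 / real n)"
    using v n B1 by (intro frac_le power_increasing) (auto simp: d_eq intro!: card_mono)
  finally show ?thesis by simp
qed

lemma vol_join_ge: "(I, I', w) \<in> joins l \<Longrightarrow> 1 / real n \<le> vol w (I \<inter> I')"
  using joins_bounds(3) inv_n_le by fastforce

definition crude :: real where "crude = B ^ d * real n"

lemma crude1: "1 \<le> crude"
proof -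
  have "1 * 1 \<le> B ^ d * real n" using B1 n by (intro mult_mono one_le_power) auto
  then show ?thesis by (simp add: crude_def)
qed

lemma mean_abs_le:
  assumes "(h, P) \<in> params" "(\<eta>, P') \<in> params" "J \<in> meet P P'"
  shows "(\<Sum>i=1..n. \<bar>kernel_at K J (sup h \<eta>) (X i)\<bar>) / real n \<le> crude"
proof -
  obtain I I' where I: "I \<in> P" "I' \<in> P'" "J = I \<inter> I'" "I \<inter> I' \<noteq> {}" using meetE[OF assms(3)] .
  have v: "1 / real n \<le> vol (sup h \<eta>) J" unfolding I(3) by (rule vol_join_ge[OF joins_top(5)[OF assms(1,2) I(1,2,4)]])
  have "\<bar>kernel_at K J (sup h \<eta>) x\<bar> \<le> crude" for x
    unfolding crude_def by (rule kernel_at_le[OF sup_unit[OF assms(1,2)] v])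
  then have "(\<Sum>i=1..n. \<bar>kernel_at K J (sup h \<eta>) (X i)\<bar>) \<le> (\<Sum>i=1..n. crude)" by (intro sum_mono)
  then show ?thesis using n by (simp add: pos_divide_le_eq mult.commute)
qed

lemma G_tilde_eq: "G_tilde J w X = max 1 ((\<Sum>i=1..n. \<bar>kernel_at K J w (X i)\<bar>) / real n)"
  by (simp add: G_tilde_def kernel_at_def)

lemma kde_le_G_tilde: "\<bar>kde J w X\<bar> \<le> G_tilde J w X"
proof -
  have "\<bar>kde J w X\<bar> \<le> (\<Sum>i=1..n. \<bar>kernel_at K J w (X i)\<bar>) / real n"
    unfolding kde_def kernel_at_def abs_divide by (simp add: divide_right_mono sum_abs)
  then show ?thesis by (simp add: G_tilde_eq)
qed

lemma G_tilde_le_crude: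
  assumes "(h, P) \<in> params" "(\<eta>, P') \<in> params" "J \<in> meet P P'"
  shows "G_tilde J (sup h \<eta>) X \<le> crude"
  using mean_abs_le[OF assms] crude1 by (simp add: G_tilde_eq)

lemma meet_ne: "(h, P) \<in> params \<Longrightarrow> (\<eta>, P') \<in> params \<Longrightarrow> meet P P' \<noteq> {}"
proof -
  assume "(h, P) \<in> params" "(\<eta>, P') \<in> params"
  then have "\<Union> (meet P P') = UNIV"
    using partition_on_meet[OF paramsD(2) paramsD(2)] by (simp add: partition_on_def)
  then show "meet P P' \<noteq> {}" by auto
qed

lemma G_bar_least:
  assumes C: "\<And>h P \<eta> P' J. (h, P) \<in> params \<Longrightarrow> (\<eta>, P') \<in> params \<Longrightarrow> J \<in> meet P P' \<Longrightarrow> 2 * G_tilde J (sup h \<eta>) X \<le> C"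
  shows "G_bar X \<le> C"
  unfolding G_bar_def using params_ne meet_ne C
  by (intro cSUP_least) (auto intro!: cSUP_least split: prod.splits)

text \<open>Members of a real supremum are known to lie below it only for bounded families;
  \<open>crude\<close> is the sample-independent bound that secures this for the three nested
  suprema.\<close>

lemma G_bar_upper:
  assumes hP: "(h, P) \<in> params" and eP: "(\<eta>, P') \<in> params" and J: "J \<in> meet P P'"
  shows "2 * G_tilde J (sup h \<eta>) X \<le> G_bar X"
proof -
  let ?g1 = "\<lambda>h P \<eta> P'. SUP I\<in>meet P P'. 2 * G_tilde I (sup h \<eta>) X"
  let ?g2 = "\<lambda>h P. SUP (\<eta>, P')\<in>params. ?g1 h P \<eta> P'"
  have b1: "?g1 h P \<eta> P' \<le> 2 * crude" if "(h, P) \<in> params" "(\<eta>, P') \<in> params" for h P \<eta> P'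
    using meet_ne[OF that] G_tilde_le_crude[OF that] by (intro cSUP_least) auto
  have b2: "?g2 h P \<le> 2 * crude" if "(h, P) \<in> params" for h P
    using params_ne b1[OF that] by (intro cSUP_least) auto
  have "2 * G_tilde J (sup h \<eta>) X \<le> ?g1 h P \<eta> P'" by (rule cSUP_upper[OF J]) simp
  also have "\<dots> \<le> ?g2 h P"
    by (rule cSUP_upper2[where x = "(\<eta>, P')"]) (use eP b1[OF hP] in \<open>auto intro!: bdd_aboveI2[where M = "2 * crude"]\<close>)
  also have "\<dots> \<le> G_bar X"
    unfolding G_bar_def by (rule cSUP_upper2[where x = "(h, P)"]) (use hP b2 in \<open>auto intro!: bdd_aboveI2[where M = "2 * crude"]\<close>)
  finally show ?thesis .
qed

lemma G_bar2: "2 \<le> G_bar X"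
proof -
  obtain h P where hP: "(h, P) \<in> params" using params_ne by auto
  obtain J where J: "J \<in> meet P P" using meet_ne[OF hP hP] by auto
  have "2 \<le> 2 * G_tilde J (sup h h) X" by (simp add: G_tilde_eq)
  then show ?thesis using G_bar_upper[OF hP hP J, of X] by linarith
qed

lemma kde_le_G_bar:
  assumes "(h, P) \<in> params" "(\<eta>, P') \<in> params" "J \<in> meet P P'"
  shows "\<bar>kde J (sup h \<eta>) X\<bar> \<le> G_bar X"
  using kde_le_G_tilde[of J "sup h \<eta>" X] G_bar_upper[OF assms, of X] G_bar2[of X] by linarith

definition u :: "real ^ 'd \<Rightarrow> 'd set set \<Rightarrow> real" where
  "u h P = sqrt (max 1 (ln (delta h P)) / (real n * V h P))"

lemma U_hat_eq: "U_hat h P X = G_bar X * u h P"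
proof -
  have "U_hat h P X = sqrt ((G_bar X)\<^sup>2 * (max 1 (ln (delta h P)) / (real n * V h P)))"
    by (simp add: U_hat_def)
  then show ?thesis using G_bar2[of X] by (simp only: real_sqrt_mult real_sqrt_abs u_def)
qed

lemma u0: "(h, P) \<in> params \<Longrightarrow> 0 \<le> u h P"
  unfolding u_def using V_pos[of h P] by simp

text \<open>Passing to a sub-block and enlarging the bandwidth both increase the volume, which
  therefore dominates \<open>V h P\<close> and \<open>V \<eta> P'\<close>, while the cost equals the
  logarithmic factor of one of the two parameters. So the two penalties together pay for the
  deviation at a join.\<close>

lemma cost_u:
  assumes hP: "(h, P) \<in> params" and eP: "(\<eta>, P') \<in> params" and I: "I \<in> P" "I' \<in> P'"
  shows "sqrt (cost h P \<eta> P' / (real n * vol (sup h \<eta>) (I \<inter> I'))) \<le> u h P + u \<eta> P'"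
proof -
  let ?v = "vol (sup h \<eta>) (I \<inter> I')"
  have n0: "0 < real n" using n by simp
  have vh: "V h P \<le> ?v"
  proof -
    have "vol h I \<le> vol h (I \<inter> I')" using paramsD(6)[OF hP] by (intro vol_subset) auto
    also have "\<dots> \<le> ?v" using paramsD(6)[OF hP] by (intro vol_mono) (auto simp: sup_vec_nth)
    finally show ?thesis using V_le[OF hP I(1)] by linarith
  qed
  have ve: "V \<eta> P' \<le> ?v"
  proof -
    have "vol \<eta> I' \<le> vol \<eta> (I \<inter> I')" using paramsD(6)[OF eP] by (intro vol_subset) auto
    also have "\<dots> \<le> ?v" using paramsD(6)[OF eP] by (intro vol_mono) (auto simp: sup_vec_nth)
    finally show ?thesis using V_le[OF eP I(2)] by linarith
  qed
  have mono: "sqrt (max 1 (ln x) / (real n * ?v)) \<le> sqrt (max 1 (ln x) / (real n * W))" if "0 < W" "W \<le> ?v" for x W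
    using that n0 by (intro real_sqrt_le_mono divide_left_mono mult_left_mono mult_pos_pos) auto
  have 1: "sqrt (max 1 (ln (delta h P)) / (real n * ?v)) \<le> u h P" unfolding u_def by (rule mono[OF V_pos[OF hP] vh])
  have 2: "sqrt (max 1 (ln (delta \<eta> P')) / (real n * ?v)) \<le> u \<eta> P'" unfolding u_def by (rule mono[OF V_pos[OF eP] ve])
  have "cost h P \<eta> P' = max 1 (ln (delta h P)) \<or> cost h P \<eta> P' = max 1 (ln (delta \<eta> P'))"
    by (auto simp: cost_def)
  then show ?thesis using 1 2 u0[OF hP] u0[OF eP] by auto
qed

text \<open>\<open>d * G_bar ^ (d - 1)\<close> is the Lipschitz factor of a product of at most d
  kernel estimators, and the 10 covers the multiples of \<open>thr\<close> collected in
  \<open>oracle_pointwise\<close>.\<close>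

lemma Lambda_ge: "10 * thr * real d * G_bar X ^ (d - 1) \<le> Lambda X"
proof -
  let ?g = "G_bar X"
  have g: "2 \<le> ?g" by (rule G_bar2)
  have "d \<le> d\<^sup>2" using d1 by (simp add: power2_eq_square)
  then have dd: "d - 1 \<le> d\<^sup>2 - 1" by (rule diff_le_mono)
  have "?g ^ (d - 1) \<le> (2 * ?g) ^ (d\<^sup>2 - 1)"
  proof -
    have "?g ^ (d - 1) \<le> (2 * ?g) ^ (d - 1)" using g by (intro power_mono) auto
    also have "\<dots> \<le> (2 * ?g) ^ (d\<^sup>2 - 1)" using g dd by (intro power_increasing) auto
    finally show ?thesis .
  qed
  moreover have "10 * thr * real d \<le> 3 * lm * (real d)\<^sup>2"
  proof -
    have "1 * real d \<le> real d * real d" using d1 by (intro mult_right_mono) auto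
    then have "10 * thr * real d \<le> lm * (real d)\<^sup>2"
      unfolding power2_eq_square using lm_ge lm_ge(2)[folded thr_def] by (intro mult_mono) auto
    moreover have "lm * (real d)\<^sup>2 \<le> 3 * lm * (real d)\<^sup>2" using lm_ge(1) by simp
    ultimately show ?thesis by linarith
  qed
  ultimately have "(10 * thr * real d) * ?g ^ (d - 1) \<le> (3 * lm * (real d)\<^sup>2) * (2 * ?g) ^ (d\<^sup>2 - 1)"
    using lm_ge(1) g by (intro mult_mono[of "10 * thr * real d"]) auto
  then show ?thesis unfolding Lambda_def lm_eq d_eq by simp
qed

lemma Lambda0: "0 \<le> Lambda X"
  using Lambda_ge[of X] thr_pos G_bar2[of X] by (intro order_trans[OF _ Lambda_ge]) auto

text \<open>The product kernel over \<open>I'\<close> splits along the blocks of \<open>P\<close>,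
  which are independent under f; blocks disjoint from \<open>I'\<close> contribute the integral of
  1. Hence, at a common bandwidth, passing from \<open>P'\<close> to the meet with a valid partition
  does not change the product of expectations.\<close>

lemma sm_factor:
  assumes P: "P \<in> indep_partitions f" and w: "\<And>i. 0 < w $ i \<and> w $ i \<le> 1"
  shows "sm I' w = (\<Prod>I\<in>{I\<in>P. I \<inter> I' \<noteq> {}}. sm (I \<inter> I') w)"
proof -
  have part: "partition_on UNIV P" using P by (simp add: indep_partitions_def)
  have split: "(\<Prod>i\<in>I'. \<phi> i) = (\<Prod>I\<in>P. \<Prod>i\<in>I \<inter> I'. \<phi> i)" for \<phi> :: "'d \<Rightarrow> real"
  proof -
    have "I' = (\<Union>I\<in>P. I \<inter> I')" using part unfolding partition_on_def by blast
    then have "(\<Prod>i\<in>I'. \<phi> i) = (\<Prod>i\<in>(\<Union>I\<in>P. I \<inter> I'). \<phi> i)" by (rule arg_cong)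
    also have "\<dots> = (\<Prod>I\<in>P. \<Prod>i\<in>I \<inter> I'. \<phi> i)"
      using part unfolding partition_on_def disjoint_def by (intro prod.UNION_disjoint) auto
    finally show ?thesis .
  qed
  have "kernel_at K I' w x = (\<Prod>I\<in>P. kernel_at K (I \<inter> I') w x)" for x
    unfolding kernel_at_def scaled_kernel_def vol_def 
    by (simp only: prod_dividef) (simp only: split[of "\<lambda>i. K ((x - x0) $ i / w $ i)"] split[of "\<lambda>i. w $ i"])
  then have "sm I' w = (\<integral>x. (\<Prod>I\<in>P. kernel_at K (I \<inter> I') w x) \<partial>law f)"
    by (simp add: sm_def smoothed_def kernel_at_def)
  also have "\<dots> = (\<Prod>I\<in>P. \<integral>x. kernel_at K (I \<inter> I') w x \<partial>law f)"
  proof (rule integral_law_prod[OF fD(1) P, where b = "B ^ d / vol w UNIV"])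
    fix I assume "I \<in> P"
    show "kernel_at K (I \<inter> I') w \<in> borel_measurable borel"
      using kernel_at_measurable[OF K_like] by (simp add: measurable_cong_sets[OF law_sets refl])
    have "depends_on (I \<inter> I') (kernel_at K (I \<inter> I') w)"
      unfolding kernel_at_def[abs_def] by (rule scaled_kernel_depends)
    then show "depends_on I (kernel_at K (I \<inter> I') w)" unfolding depends_on_def by blast
    show "\<bar>kernel_at K (I \<inter> I') w x\<bar> \<le> B ^ d / vol w UNIV" for x
    proof -
      have "\<bar>kernel_at K (I \<inter> I') w x\<bar> \<le> B ^ card (I \<inter> I') / vol w (I \<inter> I')"
        unfolding kernel_at_def using w by (intro scaled_kernel_bound[OF K_like]) auto
      also have "\<dots> \<le> B ^ d / vol w UNIV"
        using w B1 vol_subset[of "I \<inter> I'" UNIV w] vol_pos[of UNIV w]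
        by (intro frac_le power_increasing) (auto simp: d_eq intro!: card_mono)
      finally show ?thesis .
    qed
  qed
  also have "\<dots> = (\<Prod>I\<in>P. sm (I \<inter> I') w)" by (simp add: sm_def smoothed_def kernel_at_def)
  also have "\<dots> = (\<Prod>I\<in>{I\<in>P. I \<inter> I' \<noteq> {}}. sm (I \<inter> I') w)"
  proof (rule prod.mono_neutral_right)
    interpret prob_space "law f" by (rule fD(2))
    show "\<forall>I\<in>P - {I\<in>P. I \<inter> I' \<noteq> {}}. sm (I \<inter> I') w = 1"
      using prob_space by (auto simp: sm_def smoothed_def scaled_kernel_def vol_def)
  qed auto
  finally show ?thesis .
qed

lemma sm_le_GF:
  assumes J: "P \<in> \<PP>" "P' \<in> \<PP>" "J \<in> meet P P'" and w: "\<And>i. 0 < w $ i \<and> w $ i \<le> 1"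
  shows "\<bar>sm J w\<bar> \<le> GF"
proof -
  have "\<bar>sm J w\<bar> \<le> F * B ^ card J"
    unfolding sm_def using F w by (intro smoothed_abs_le[OF fD(1) K_like _ marginal_le[OF J]]) auto
  also have "\<dots> \<le> F * B ^ d"
    using F B1 by (intro mult_left_mono power_increasing) (auto simp: d_eq intro!: card_mono)
  finally show ?thesis by (simp add: GF_def)
qed

lemma GF1: "1 \<le> GF" by (simp add: GF_def)

end

context adaptive
begin

section \<open>Comparison with the oracle on favourable samples\<close>

definition good :: "(nat \<Rightarrow> real ^ 'd) \<Rightarrow> bool" where
  "good X \<longleftrightarrow> (\<forall>I I' w. (I, I', w) \<in> joins top_cost \<longrightarrow> \<bar>dev (\<lambda>x. \<bar>K x\<bar>) (I \<inter> I') w X\<bar> \<le> Gs / 4)"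

lemma good_mean:
  assumes g: "good X" and w: "(I, I', w) \<in> joins top_cost"
  shows "\<bar>(\<Sum>i=1..n. \<bar>kernel_at K (I \<inter> I') w (X i)\<bar>) / real n - abs_mean I I' w\<bar> \<le> Gs / 4"
proof -
  have eq: "kernel_at (\<lambda>x. \<bar>K x\<bar>) (I \<inter> I') w x = \<bar>kernel_at K (I \<inter> I') w x\<bar>" for x
    unfolding kernel_at_def by (rule scaled_kernel_abs) (use joins_bounds(1)[OF w] in blast)
  have "\<bar>dev (\<lambda>x. \<bar>K x\<bar>) (I \<inter> I') w X\<bar> \<le> Gs / 4" using g w unfolding good_def by blast
  then show ?thesis unfolding dev_def emp_dev_def eq .
qed

text \<open>The allowance Gs / 4 is absorbed on both sides: Gs \<le> G_bar / 2 + Gs / 4 gives the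
  first bound, and G_bar \<le> 2 (Gs + Gs / 4) \<le> 3 Gs leads to the second.\<close>

lemma good_G_bar:
  assumes g: "good X"
  shows "Gs \<le> G_bar X" "G_bar X \<le> 3 * GF"
proof -
  have "Gs \<le> G_bar X / 2 + Gs / 4"
  proof (subst (1) Gs_def, rule cSUP_least[OF joins_ne], clarify)
    fix I I' w assume w: "(I, I', w) \<in> joins top_cost"
    obtain h \<eta> P P' where h: "w = sup h \<eta>" "(h, P) \<in> params" "(\<eta>, P') \<in> params" "I \<in> P" "I' \<in> P'" "I \<inter> I' \<noteq> {}"
      using w unfolding joins_def by blast
    have J: "I \<inter> I' \<in> meet P P'" using h by (auto simp: meet_def)
    have "abs_mean I I' w \<le> (\<Sum>i=1..n. \<bar>kernel_at K (I \<inter> I') w (X i)\<bar>) / real n + Gs / 4"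
      using good_mean[OF g w] by linarith
    moreover have "max 1 ((\<Sum>i=1..n. \<bar>kernel_at K (I \<inter> I') w (X i)\<bar>) / real n) \<le> G_bar X / 2"
      using G_bar_upper[OF h(2,3) J, of X] by (simp add: G_tilde_eq h(1))
    ultimately show "max 1 (abs_mean I I' w) \<le> G_bar X / 2 + Gs / 4" using Gs1 by auto
  qed
  then show "Gs \<le> G_bar X" using Gs1 by linarith
  have "G_bar X \<le> 3 * Gs"
  proof (rule G_bar_least)
    fix h P \<eta> P' J assume hP: "(h, P) \<in> params" "(\<eta>, P') \<in> params" and J: "J \<in> meet P P'"
    obtain I I' where I: "I \<in> P" "I' \<in> P'" "J = I \<inter> I'" "I \<inter> I' \<noteq> {}" using meetE[OF J] .
    note w = joins_top(5)[OF hP I(1,2,4)]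
    have "(\<Sum>i=1..n. \<bar>kernel_at K J (sup h \<eta>) (X i)\<bar>) / real n \<le> abs_mean I I' (sup h \<eta>) + Gs / 4"
      using good_mean[OF g w] unfolding I(3) by linarith
    then show "2 * G_tilde J (sup h \<eta>) X \<le> 3 * Gs"
      using Gs_ge[OF w order_refl] Gs1 unfolding G_tilde_eq by auto
  qed
  then show "G_bar X \<le> 3 * GF" using Gs_le by linarith
qed

text \<open>In the application \<zeta> is the q-th root of the majorant from
  \<open>remainder_exists\<close>, so that the argument on a fixed sample is purely
  deterministic.\<close>

definition remainder_le :: "real \<Rightarrow> (nat \<Rightarrow> real ^ 'd) \<Rightarrow> bool" where
  "remainder_le \<zeta> X \<longleftrightarrow> (\<forall>I I' w l. 1 \<le> l \<longrightarrow> l \<le> top_cost \<longrightarrow> (I, I', w) \<in> joins l \<longrightarrow>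
     \<bar>dev K (I \<inter> I') w X\<bar> \<le> thr * sqrt (Gs * real l / (real n * vol w (I \<inter> I'))) + \<zeta>)"

text \<open>The unknown Gs in the threshold is exchanged for the observable \<open>G_bar\<close>,
  and rounding the cost up to an integer loses at most a factor 2; both fit under the square of
  \<open>2 * G_bar\<close>.\<close>

lemma dev_bound:
  assumes g: "good X" and r: "remainder_le \<zeta> X" and hP: "(h, P) \<in> params" and eP: "(\<eta>, P') \<in> params" and J: "J \<in> meet P P'"
  shows "\<bar>kde J (sup h \<eta>) X - sm J (sup h \<eta>)\<bar> \<le> 2 * thr * (U_hat h P X + U_hat \<eta> P' X) + \<zeta>"
proof -
  obtain I I' where I: "I \<in> P" "I' \<in> P'" "J = I \<inter> I'" "I \<inter> I' \<noteq> {}" using meetE[OF J] .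
  let ?w = "sup h \<eta>" and ?c = "cost h P \<eta> P'"
  define l where "l = nat \<lceil>?c\<rceil>"
  note w = joins_top[OF hP eP I(1,2,4), folded l_def]
  have v0: "0 < vol ?w J" using sup_unit[OF hP eP] by (intro vol_pos) auto
  have n0: "0 < real n" using n by simp
  have c1: "1 \<le> ?c" by (simp add: cost_def)
  have G2: "2 \<le> G_bar X" by (rule G_bar2)
  have "sqrt (Gs * real l / (real n * vol ?w J)) \<le> sqrt ((2 * G_bar X)\<^sup>2 * (?c / (real n * vol ?w J)))"
  proof (rule real_sqrt_le_mono)
    have "Gs * real l \<le> G_bar X * (2 * ?c)" using good_G_bar(1)[OF g] w(4) Gs1 c1 G2 by (intro mult_mono) auto
    also have "\<dots> \<le> (2 * G_bar X)\<^sup>2 * ?c"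
    proof -
      have "G_bar X * 2 \<le> (2 * G_bar X)\<^sup>2" using G2 by (simp add: power2_eq_square)
      then show ?thesis using c1 by (simp add: mult.assoc[symmetric] mult_right_mono)
    qed
    finally have "Gs * real l / (real n * vol ?w J) \<le> (2 * G_bar X)\<^sup>2 * ?c / (real n * vol ?w J)"
      using n0 v0 by (intro divide_right_mono) auto
    then show "Gs * real l / (real n * vol ?w J) \<le> (2 * G_bar X)\<^sup>2 * (?c / (real n * vol ?w J))" by simp
  qed
  also have "\<dots> = 2 * G_bar X * sqrt (?c / (real n * vol ?w J))"
    using G2 by (simp only: real_sqrt_mult real_sqrt_abs)
  also have "\<dots> \<le> 2 * G_bar X * (u h P + u \<eta> P')"
    using cost_u[OF hP eP I(1,2)] G2 unfolding I(3) by (intro mult_left_mono) auto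
  also have "\<dots> = 2 * (U_hat h P X + U_hat \<eta> P' X)" by (simp add: U_hat_eq algebra_simps)
  finally have "thr * sqrt (Gs * real l / (real n * vol ?w J)) \<le> thr * (2 * (U_hat h P X + U_hat \<eta> P' X))"
    using thr_pos by (intro mult_left_mono) auto
  moreover have "\<bar>dev K J ?w X\<bar> \<le> thr * sqrt (Gs * real l / (real n * vol ?w J)) + \<zeta>"
    using r w(1,2,3) unfolding remainder_le_def I(3) by blast
  ultimately show ?thesis by (simp add: kde_eq algebra_simps)
qed

lemma kde_crude:
  assumes "(h, P) \<in> params" "(\<eta>, P') \<in> params" "J \<in> meet P P'"
  shows "\<bar>kde J (sup h \<eta>) X\<bar> \<le> crude"
  by (rule order_trans[OF kde_le_G_tilde G_tilde_le_crude[OF assms]])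

lemma sm_le:
  assumes g: "good X" and hP: "(h, P) \<in> params" and eP: "(\<eta>, P') \<in> params" and J: "J \<in> meet P P'"
  shows "\<bar>sm J (sup h \<eta>)\<bar> \<le> G_bar X"
proof -
  obtain I I' where I: "I \<in> P" "I' \<in> P'" "J = I \<inter> I'" "I \<inter> I' \<noteq> {}" using meetE[OF J] .
  note w = joins_top(5)[OF hP eP I(1,2,4)]
  have "\<bar>sm J (sup h \<eta>)\<bar> \<le> abs_mean I I' (sup h \<eta>)"
    unfolding sm_def smoothed_def kernel_at_def I(3) by (rule integral_abs_bound)
  also have "\<dots> \<le> Gs" using Gs_ge[OF w order_refl] by simp
  finally show ?thesis using good_G_bar(1)[OF g] by linarith
qed

lemma U_hat0: "(h, P) \<in> params \<Longrightarrow> 0 \<le> U_hat h P X"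
  using u0[of h P] G_bar2[of X] by (simp add: U_hat_eq)

lemma prod_dev:
  assumes g: "good X" and r: "remainder_le \<zeta> X" "0 \<le> \<zeta>" and hP: "(h, P) \<in> params" and eP: "(\<eta>, P') \<in> params"
  shows "\<bar>(\<Prod>J\<in>meet P P'. kde J (sup h \<eta>) X) - (\<Prod>J\<in>meet P P'. sm J (sup h \<eta>))\<bar>
    \<le> real d * G_bar X ^ (d - 1) * (2 * thr * (U_hat h P X + U_hat \<eta> P' X) + \<zeta>)"
proof (rule prod_diff_le)
  show "card (meet P P') \<le> d"
    unfolding d_eq by (rule card_partition_le[OF partition_on_meet[OF paramsD(2)[OF hP] paramsD(2)[OF eP]]])
  show "0 \<le> 2 * thr * (U_hat h P X + U_hat \<eta> P' X) + \<zeta>"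
    using thr_pos U_hat0[OF hP] U_hat0[OF eP] r(2) by simp
qed (use G_bar2[of X] d1 kde_le_G_bar[OF hP eP] sm_le[OF g hP eP] dev_bound[OF g r(1) hP eP] in auto)

lemma estimator_self:
  assumes "(h, P) \<in> params"
  shows "estimator h P X = (\<Prod>J\<in>meet P P. kde J (sup h h) X)"
  by (simp add: estimator_def meet_self[OF paramsD(2)[OF assms]])

lemma estimator_aux_eq: "estimator_aux h P \<eta> P' X = (\<Prod>J\<in>meet P P'. kde J (sup h \<eta>) X)"
  by (simp add: estimator_aux_def)

lemma aux_crude:
  assumes hP: "(h, P) \<in> params" and eP: "(\<eta>, P') \<in> params"
  shows "\<bar>estimator_aux h P \<eta> P' X\<bar> \<le> crude ^ d"
proof -
  have "\<bar>estimator_aux h P \<eta> P' X\<bar> = (\<Prod>J\<in>meet P P'. \<bar>kde J (sup h \<eta>) X\<bar>)"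
    by (simp add: estimator_aux_eq abs_prod)
  also have "\<dots> \<le> (\<Prod>J\<in>meet P P'. crude)"
    by (intro prod_mono conjI abs_ge_zero kde_crude[OF hP eP])
  also have "\<dots> = crude ^ card (meet P P')" by simp
  also have "\<dots> \<le> crude ^ d"
    using crude1 card_partition_le[OF partition_on_meet[OF paramsD(2)[OF hP] paramsD(2)[OF eP]]]
    by (intro power_increasing) (auto simp: d_eq)
  finally show ?thesis .
qed

lemma estimator_crude: "(h, P) \<in> params \<Longrightarrow> \<bar>estimator h P X\<bar> \<le> crude ^ d"
  using aux_crude[of h P h P X] by (simp add: estimator_self estimator_aux_eq)

lemma Delta_hat_upper:
  assumes hP: "(h, P) \<in> params" and eP: "(\<eta>, P') \<in> params"
  shows "\<bar>estimator_aux h P \<eta> P' X - estimator \<eta> P' X\<bar> \<le> Delta_hat h P X + Lambda X * (U_hat \<eta> P' X + U_hat h P X)"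
proof -
  have b: "max 0 (\<bar>estimator_aux h P \<eta> P' X - estimator \<eta> P' X\<bar> - Lambda X * (U_hat \<eta> P' X + U_hat h P X)) \<le> 2 * crude ^ d"
    if eP: "(\<eta>, P') \<in> params" for \<eta> P'
  proof -
    have "0 \<le> Lambda X * (U_hat \<eta> P' X + U_hat h P X)"
      using Lambda0 U_hat0[OF hP] U_hat0[OF eP] by simp
    moreover have "0 \<le> crude ^ d" using crude1 by simp
    ultimately show ?thesis using aux_crude[OF hP eP, of X] estimator_crude[OF eP, of X] by linarith
  qed
  have "max 0 (\<bar>estimator_aux h P \<eta> P' X - estimator \<eta> P' X\<bar> - Lambda X * (U_hat \<eta> P' X + U_hat h P X)) \<le> Delta_hat h P X"
    unfolding Delta_hat_def
    by (rule cSUP_upper2[where x = "(\<eta>, P')"]) (use eP b in \<open>auto intro!: bdd_aboveI2[where M = "2 * crude ^ d"]\<close>)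
  then show ?thesis by linarith
qed

lemma Delta_hat_least:
  assumes "0 \<le> C" "\<And>\<eta> P'. (\<eta>, P') \<in> params \<Longrightarrow>
      \<bar>estimator_aux h P \<eta> P' X - estimator \<eta> P' X\<bar> \<le> C + Lambda X * (U_hat \<eta> P' X + U_hat h P X)"
  shows "Delta_hat h P X \<le> C"
  unfolding Delta_hat_def
proof (rule cSUP_least[OF params_ne], clarify)
  fix \<eta> P' assume "(\<eta>, P') \<in> params"
  from assms(2)[OF this] assms(1)
  show "max 0 (\<bar>estimator_aux h P \<eta> P' X - estimator \<eta> P' X\<bar> - Lambda X * (U_hat \<eta> P' X + U_hat h P X)) \<le> C" by linarith
qed

lemma bias_le:
  assumes b: "bias_sup f h P = ennreal b" "0 \<le> b" and "P' \<in> \<PP>" "J \<in> meet P P'" "\<eta> \<in> closed_unit_box"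
  shows "\<bar>bias f J h \<eta>\<bar> \<le> b"
proof -
  have "ennreal \<bar>bias f J h \<eta>\<bar> \<le> (SUP \<eta>\<in>closed_unit_box. ennreal \<bar>bias f J h \<eta>\<bar>)" by (rule SUP_upper) (rule assms)
  also have "\<dots> \<le> (SUP J\<in>meet P P'. SUP \<eta>\<in>closed_unit_box. ennreal \<bar>bias f J h \<eta>\<bar>)" by (rule SUP_upper) (rule assms)
  also have "\<dots> \<le> bias_sup f h P" unfolding bias_sup_def by (rule SUP_upper) (rule assms)
  finally show ?thesis using b by (simp add: ennreal_le_iff)
qed

lemma density_eq:
  assumes P: "P \<in> indep_partitions f" "P \<in> \<PP>"
  shows "f x0 = (\<Prod>J\<in>meet P P. enn2real (marginal f J x0))" "J \<in> meet P P \<Longrightarrow> 0 \<le> enn2real (marginal f J x0) \<and> enn2real (marginal f J x0) \<le> F"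
proof -
  have m: "marginal f J x0 \<le> ennreal F" if "J \<in> meet P P" for J by (rule marginal_le[OF P(2,2) that])
  show "0 \<le> enn2real (marginal f J x0) \<and> enn2real (marginal f J x0) \<le> F" if "J \<in> meet P P" for J
    using enn2real_mono[OF m[OF that]] F by simp
  have "ennreal (f x0) = (\<Prod>J\<in>meet P P. marginal f J x0)"
    using P(1) by (simp add: meet_self[OF PP_part[OF P(2)]] indep_partitions_def)
  also have "\<dots> = (\<Prod>J\<in>meet P P. ennreal (enn2real (marginal f J x0)))"
    using m by (intro prod.cong refl) (metis ennreal_enn2real ennreal_less_top order_le_less_trans)
  also have "\<dots> = ennreal (\<Prod>J\<in>meet P P. enn2real (marginal f J x0))" by (rule prod_ennreal) simp
  finally show "f x0 = (\<Prod>J\<in>meet P P. enn2real (marginal f J x0))"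
    using fD(1) by (subst (asm) ennreal_inj) (auto simp: is_density_def intro!: prod_nonneg)
qed

text \<open>The coefficients 3 and 5 are collected in \<open>oracle_pointwise\<close>;
  \<open>6 * GF\<close> bounds \<open>2 * G_bar\<close> inside \<open>Lambda\<close>, and
  \<open>3 * GF\<close> bounds \<open>G_bar\<close> inside \<open>U_hat\<close>.\<close>

definition C_osc :: real where
  "C_osc = 3 * (real d * GF ^ (d - 1)) + 5 * (3 * lm * (real d)\<^sup>2 * (6 * GF) ^ (d\<^sup>2 - 1)) * (3 * GF)"

definition C_rem :: real where
  "C_rem = 5 * (real d * (3 * GF) ^ (d - 1))"

lemma oracle_pointwise:
  assumes g: "good X" and r: "remainder_le \<zeta> X" "0 \<le> \<zeta>"
    and hP: "(h, P) \<in> params" and Pf: "P \<in> indep_partitions f"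
    and b: "bias_sup f h P = ennreal b" "0 \<le> b"
    and sP: "(h', Q) \<in> params" and crit: "criterion h' Q X \<le> criterion h P X"
  shows "\<bar>estimator h' Q X - f x0\<bar> \<le> C_osc * (b + u h P) + C_rem * \<zeta>"
proof -
  define gd where "gd = real d * G_bar X ^ (d - 1)"
  define Fd where "Fd = real d * GF ^ (d - 1)"
  let ?U = "\<lambda>h P. U_hat h P X" and ?L = "Lambda X"
  have gd0: "0 \<le> gd" unfolding gd_def using G_bar2[of X] by simp
  have Fd0: "0 \<le> Fd" unfolding Fd_def using GF1 by simp
  have Lgd: "10 * thr * gd \<le> ?L" using Lambda_ge[of X] by (simp add: gd_def mult_ac)
  have PP: "P \<in> \<PP>" by (rule paramsD(1)[OF hP])
  have est_dev: "\<bar>estimator \<eta> P' X - (\<Prod>J\<in>P'. sm J \<eta>)\<bar> \<le> gd * (4 * thr * ?U \<eta> P' + \<zeta>)" if eP: "(\<eta>, P') \<in> params" for \<eta> P'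
    using prod_dev[OF g r eP eP] by (simp add: estimator_self[OF eP] meet_self[OF paramsD(2)[OF eP]] gd_def mult.assoc)
  have comp: "\<bar>estimator_aux h P \<eta> P' X - estimator \<eta> P' X\<bar> \<le> (2 * gd * \<zeta> + Fd * b) + ?L * (?U \<eta> P' + ?U h P)"
    if eP: "(\<eta>, P') \<in> params" for \<eta> P'
  proof -
    have P': "P' \<in> \<PP>" by (rule paramsD(1)[OF eP])
    have 1: "\<bar>estimator_aux h P \<eta> P' X - (\<Prod>J\<in>meet P P'. sm J (sup h \<eta>))\<bar> \<le> gd * (2 * thr * (?U h P + ?U \<eta> P') + \<zeta>)"
      unfolding estimator_aux_eq gd_def by (rule prod_dev[OF g r hP eP])
    have fac: "(\<Prod>J\<in>P'. sm J \<eta>) = (\<Prod>J\<in>meet P P'. sm J \<eta>)"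
      unfolding prod_meet[OF paramsD(2)[OF hP] paramsD(2)[OF eP]]
      by (intro prod.cong refl sm_factor[OF Pf] paramsD(6)[OF eP])
    have 2: "\<bar>(\<Prod>J\<in>meet P P'. sm J (sup h \<eta>)) - (\<Prod>J\<in>meet P P'. sm J \<eta>)\<bar> \<le> real d * GF ^ (d - 1) * b"
    proof (rule prod_diff_le)
      show "card (meet P P') \<le> d"
        unfolding d_eq by (rule card_partition_le[OF partition_on_meet[OF paramsD(2)[OF hP] paramsD(2)[OF eP]]])
      fix J assume J: "J \<in> meet P P'"
      show "\<bar>sm J (sup h \<eta>)\<bar> \<le> GF" by (rule sm_le_GF[OF PP P' J sup_unit[OF hP eP]])
      show "\<bar>sm J \<eta>\<bar> \<le> GF" by (rule sm_le_GF[OF PP P' J paramsD(6)[OF eP]])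
      have "bias f J h \<eta> = sm J (sup h \<eta>) - sm J \<eta>"
        unfolding sm_def
        by (rule bias_eq(1)[OF fD(1) K]) (use paramsD(6)[OF hP] paramsD(6)[OF eP] marginal_le[OF PP P' J] F in auto)
      moreover have "\<eta> \<in> closed_unit_box"
        using paramsD(6)[OF eP] by (auto simp: closed_unit_box_def less_imp_le)
      ultimately show "\<bar>sm J (sup h \<eta>) - sm J \<eta>\<bar> \<le> b" using bias_le[OF b P' J] by metis
    qed (use GF1 d1 b(2) in auto)
    have "\<bar>estimator_aux h P \<eta> P' X - estimator \<eta> P' X\<bar>
        \<le> gd * (2 * thr * (?U h P + ?U \<eta> P') + \<zeta>) + Fd * b + gd * (4 * thr * ?U \<eta> P' + \<zeta>)"
      using 1 2 est_dev[OF eP] unfolding fac Fd_def by linarith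
    also have "\<dots> = (2 * gd * \<zeta> + Fd * b) + (thr * gd) * (2 * ?U h P + 6 * ?U \<eta> P')" by (simp add: algebra_simps)
    \<comment> \<open>The deviations cost 2 units for h and 2 + 4 for \<eta>, within the 10 of
      \<open>Lambda_ge\<close>. The penalty in \<open>Delta_hat\<close> thus removes the whole
      stochastic part and leaves only the bias and \<zeta>.\<close>
    also have "(thr * gd) * (2 * ?U h P + 6 * ?U \<eta> P') \<le> (thr * gd) * (10 * (?U \<eta> P' + ?U h P))"
      using thr_pos gd0 U_hat0[OF hP, of X] U_hat0[OF eP, of X] by (intro mult_left_mono) auto
    also have "\<dots> = (10 * thr * gd) * (?U \<eta> P' + ?U h P)" by simp
    also have "\<dots> \<le> ?L * (?U \<eta> P' + ?U h P)"
      using Lgd U_hat0[OF hP, of X] U_hat0[OF eP, of X] by (intro mult_right_mono) auto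
    finally show ?thesis by simp
  qed
  have Del: "Delta_hat h P X \<le> 2 * gd * \<zeta> + Fd * b"
    using gd0 Fd0 b(2) r(2) by (intro Delta_hat_least comp) auto
  \<comment> \<open>Each distance to the common auxiliary estimator is bounded by one
    \<open>Delta_hat\<close> plus one copy of both penalties. Regrouped, these are exactly the two
    criteria, and minimality replaces that of the selected parameter by that of the
    competitor.\<close>
  have sel: "\<bar>estimator h' Q X - estimator h P X\<bar> \<le> 2 * (Delta_hat h P X + 2 * ?L * ?U h P)"
  proof -
    have sym: "estimator_aux h' Q h P X = estimator_aux h P h' Q X"
      unfolding estimator_aux_eq by (simp add: meet_commute[of Q P] sup_commute)
    have 1: "\<bar>estimator_aux h P h' Q X - estimator h' Q X\<bar> \<le> Delta_hat h P X + ?L * (?U h' Q + ?U h P)"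
      by (rule Delta_hat_upper[OF hP sP])
    have 2: "\<bar>estimator_aux h P h' Q X - estimator h P X\<bar> \<le> Delta_hat h' Q X + ?L * (?U h P + ?U h' Q)"
      using Delta_hat_upper[OF sP hP, of X] unfolding sym .
    have "\<bar>estimator h' Q X - estimator h P X\<bar> \<le> criterion h P X + criterion h' Q X"
      using 1 2 unfolding criterion_def by (simp add: algebra_simps)
    then have "\<bar>estimator h' Q X - estimator h P X\<bar> \<le> 2 * criterion h P X" using crit by linarith
    then show ?thesis by (simp only: criterion_def)
  qed
  \<comment> \<open>The bias is now taken at \<eta> = 0, where the marginal density at x0 replaces
    its smoothed version.\<close>
  have ora: "\<bar>estimator h P X - f x0\<bar> \<le> gd * (4 * thr * ?U h P + \<zeta>) + Fd * b"
  proof -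
    have "\<bar>(\<Prod>J\<in>meet P P. sm J h) - (\<Prod>J\<in>meet P P. enn2real (marginal f J x0))\<bar> \<le> real d * GF ^ (d - 1) * b"
    proof (rule prod_diff_le)
      show "card (meet P P) \<le> d"
        unfolding d_eq by (rule card_partition_le[OF partition_on_meet[OF paramsD(2)[OF hP] paramsD(2)[OF hP]]])
      fix J assume J: "J \<in> meet P P"
      show "\<bar>sm J h\<bar> \<le> GF" by (rule sm_le_GF[OF PP PP J paramsD(6)[OF hP]])
      have "F * 1 \<le> F * B ^ d" using B1 F by (intro mult_left_mono one_le_power) auto
      then show "\<bar>enn2real (marginal f J x0)\<bar> \<le> GF" using density_eq(2)[OF Pf PP J] by (simp add: GF_def)
      have "bias f J h 0 = sm J h - enn2real (marginal f J x0)"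
        unfolding sm_def
        by (rule bias_eq(2)[OF fD(1) K]) (use paramsD(3,6)[OF hP] marginal_le[OF PP PP J] F in auto)
      moreover have "(0 :: real ^ 'd) \<in> closed_unit_box" by (simp add: closed_unit_box_def)
      ultimately show "\<bar>sm J h - enn2real (marginal f J x0)\<bar> \<le> b" using bias_le[OF b PP J] by metis
    qed (use GF1 d1 b(2) in auto)
    then show ?thesis
      using est_dev[OF hP] unfolding density_eq(1)[OF Pf PP] meet_self[OF paramsD(2)[OF hP]] Fd_def by linarith
  qed
  \<comment> \<open>The term gd \<zeta> occurs 2 * 2 + 1 times, Fd b occurs 2 + 1 times, and the
    penalty of h 4 times plus once more for the deviation of the competitor: the 5, 3 and 5 in
    \<open>C_rem\<close> and \<open>C_osc\<close>.\<close>
  have "\<bar>estimator h' Q X - f x0\<bar> \<le> 2 * (2 * gd * \<zeta> + Fd * b + 2 * ?L * ?U h P) + (gd * (4 * thr * ?U h P + \<zeta>) + Fd * b)"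
    using sel ora Del by argo
  also have "\<dots> = 5 * gd * \<zeta> + 3 * Fd * b + 4 * ?L * ?U h P + 4 * (thr * gd) * ?U h P" by (simp add: algebra_simps)
  also have "4 * (thr * gd) * ?U h P \<le> ?L * ?U h P"
  proof (rule mult_right_mono)
    have "0 \<le> thr * gd" using thr_pos gd0 by simp
    then show "4 * (thr * gd) \<le> ?L" using Lgd by linarith
  qed (rule U_hat0[OF hP])
  finally have main: "\<bar>estimator h' Q X - f x0\<bar> \<le> 5 * gd * \<zeta> + 3 * Fd * b + 5 * ?L * ?U h P" by simp
  have G3: "G_bar X \<le> 3 * GF" by (rule good_G_bar(2)[OF g])
  have "5 * gd * \<zeta> \<le> C_rem * \<zeta>"
    unfolding gd_def C_rem_def using G3 G_bar2[of X] r(2) by (intro mult_right_mono mult_left_mono power_mono) auto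
  moreover have "3 * Fd * b \<le> C_osc * b"
    unfolding C_osc_def Fd_def[symmetric] using GF1 lm_ge b(2) by (intro mult_right_mono) auto
  moreover have "5 * ?L * ?U h P \<le> C_osc * u h P"
  proof -
    have "?L \<le> 3 * lm * (real d)\<^sup>2 * (6 * GF) ^ (d\<^sup>2 - 1)"
      unfolding Lambda_def d_eq[symmetric] lm_eq[symmetric] using G3 G_bar2[of X] lm_ge
      by (intro mult_left_mono power_mono) auto
    then have "5 * ?L * ?U h P \<le> 5 * (3 * lm * (real d)\<^sup>2 * (6 * GF) ^ (d\<^sup>2 - 1)) * (3 * GF * u h P)"
      unfolding U_hat_eq using G3 G_bar2[of X] u0[OF hP] lm_ge GF1
      by (intro mult_mono mult_left_mono mult_right_mono) auto
    also have "\<dots> \<le> C_osc * u h P"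
      unfolding C_osc_def Fd_def[symmetric] using Fd0 u0[OF hP] by (simp add: algebra_simps)
    finally show ?thesis .
  qed
  ultimately show ?thesis using main by (simp add: algebra_simps)
qed

end

section \<open>The oracle inequality\<close>

text \<open>Subtracting the finite \<open>c\<close> and multiplying by 1 / a turns the bounds into a
  common lower bound of the \<open>x i\<close>. An empty index set is included, the infimum then
  being infinite.\<close>

lemma le_INF_affine:
  fixes r c :: ennreal
  assumes a: "0 < a" and c: "c < \<top>" and le: "\<And>i. i \<in> I \<Longrightarrow> r \<le> ennreal a * x i + c"
  shows "r \<le> ennreal a * (INF i\<in>I. x i) + c"
proof -
  have inv: "ennreal (1 / a) * (ennreal a * y) = y" "ennreal a * (ennreal (1 / a) * y) = y" for y
    using a by (simp_all add: mult.assoc[symmetric] ennreal_mult[symmetric])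
  have "ennreal (1 / a) * (r - c) \<le> (INF i\<in>I. x i)"
  proof (rule INF_greatest)
    fix i assume i: "i \<in> I"
    have "r - c \<le> ennreal a * x i" using le[OF i] c by (auto simp: ennreal_minus_le_iff add.commute)
    then have "ennreal (1 / a) * (r - c) \<le> ennreal (1 / a) * (ennreal a * x i)" by (rule mult_left_mono) simp
    then show "ennreal (1 / a) * (r - c) \<le> x i" by (simp only: inv)
  qed
  then have "ennreal a * (ennreal (1 / a) * (r - c)) \<le> ennreal a * (INF i\<in>I. x i)" by (rule mult_left_mono) simp
  then have "r - c \<le> ennreal a * (INF i\<in>I. x i)" by (simp only: inv)
  then show ?thesis using c by (auto simp: ennreal_minus_le_iff add.commute)
qed

lemma powr_add_le_two_powr:
  fixes x y q :: real
  assumes "0 \<le> x" "0 \<le> y" "0 \<le> q"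
  shows "(x + y) powr q \<le> 2 powr q * (x powr q + y powr q)"
proof -
  have "(x + y) powr q \<le> (2 * max x y) powr q" using assms by (intro powr_mono2) auto
  also have "\<dots> = 2 powr q * max x y powr q" using assms by (simp add: powr_mult)
  also have "\<dots> \<le> 2 powr q * (x powr q + y powr q)" by (intro mult_left_mono) (auto simp: max_def)
  finally show ?thesis .
qed

context adaptive
begin

text \<open>The trivial error in units of n^d: the estimator has at most d factors, each at most
  \<open>B ^ d * n\<close>, and f at x0 is a product of at most d marginals bounded by
  \<open>F\<close>.\<close>

definition C_crude :: real where
  "C_crude = B ^ (d * d) + max 1 F ^ d"

definition C_tail :: real where
  "C_tail = (2 * C_rem) powr q * (2 * (thr powr q * GF powr q * sum_const \<zz> q d)) + C_crude powr q * sum_const \<zz> q d"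

text \<open>One factor 2 stems from separating the oracle term and the remainder inside the q-th
  power, the other from taking the q-th root of the resulting sum.\<close>

definition alpha1 :: real where "alpha1 = 4 * C_osc"
definition alpha2 :: real where "alpha2 = 2 * C_tail powr (1 / q)"

lemma sum_const_pos: "0 < sum_const \<zz> q d"
proof -
  have "0 < d" using d1 by simp
  then show ?thesis unfolding sum_const_def by (intro mult_pos_pos zero_less_power) (auto intro: add_nonneg_pos)
qed

lemma consts_pos: "0 < C_osc" "0 < C_rem" "0 < C_crude" "0 < C_tail" "0 < alpha1" "0 < alpha2"
proof -
  have d0: "0 < real d" using d1 by simp
  have GF0: "0 < GF" using GF1 by simp
  have lm0: "0 < lm" using lm_ge by simp
  show 1: "0 < C_osc" unfolding C_osc_def using d0 GF0 lm0 by (intro add_pos_pos mult_pos_pos) auto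
  show 2: "0 < C_rem" unfolding C_rem_def using d0 GF0 by simp
  show 3: "0 < C_crude" unfolding C_crude_def using B1 by (intro add_pos_nonneg) auto
  show 4: "0 < C_tail" unfolding C_tail_def using 2 3 thr_pos GF0 sum_const_pos by (intro add_pos_pos mult_pos_pos) auto
  show "0 < alpha1" using 1 by (simp add: alpha1_def)
  show "0 < alpha2" using 4 by (simp add: alpha2_def)
qed

lemma crude_error:
  assumes hP: "(h, P) \<in> params"
  shows "\<bar>estimator h P X - f x0\<bar> \<le> C_crude * real n ^ d"
proof -
  have n1: "1 \<le> real n" using n by simp
  obtain Q where Q: "Q \<in> indep_partitions f" "Q \<in> \<PP>" using fD(3) by auto
  have "\<bar>f x0\<bar> = (\<Prod>J\<in>meet Q Q. \<bar>enn2real (marginal f J x0)\<bar>)"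
    by (simp add: density_eq(1)[OF Q] abs_prod)
  also have "\<dots> \<le> (\<Prod>J\<in>meet Q Q. max 1 F)"
    using density_eq(2)[OF Q] by (intro prod_mono) (auto simp: max.coboundedI2)
  also have "\<dots> = max 1 F ^ card (meet Q Q)" by simp
  also have "\<dots> \<le> max 1 F ^ d"
    using card_partition_le[OF partition_on_meet[OF PP_part[OF Q(2)] PP_part[OF Q(2)]]]
    by (intro power_increasing) (auto simp: d_eq)
  also have "\<dots> * 1 \<le> max 1 F ^ d * real n ^ d" using n1 by (intro mult_left_mono one_le_power) auto
  finally have "\<bar>f x0\<bar> \<le> max 1 F ^ d * real n ^ d" by simp
  moreover have "\<bar>estimator h P X\<bar> \<le> B ^ (d * d) * real n ^ d"
    using estimator_crude[OF hP, of X] by (simp add: crude_def power_mult_distrib power_mult)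
  ultimately show ?thesis unfolding C_crude_def by (simp add: distrib_right)
qed

text \<open>At l = \<open>top_cost\<close> one has n \<le> exp l, so the exponent A l pays for
  everything: d q for the power n^(d q) of the crude error, q / 2 for the rate (n V_max)^(-q/2),
  using V_max \<le> 1, and 1 for the number of cells.\<close>

lemma bad_event_cost:
  "(C_crude * real n ^ d) powr q * (cell_count \<zz> d top_cost * (1 / 3) ^ (A * top_cost))
    \<le> C_crude powr q * sum_const \<zz> q d * (real n * V_max) powr (- q / 2)"
proof -
  let ?l = "real top_cost"
  have n0: "0 < real n" using n by simp
  have l1: "1 \<le> ?l" using top_cost(1) by simp
  have nexp: "real n \<le> exp ?l"
  proof -
    have "real n = exp (ln (real n))" using n0 by simp
    also have "\<dots> \<le> exp ?l" using top_cost(2) by (subst exp_le_cancel_iff)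
    finally show ?thesis .
  qed
  have e1: "(real n ^ d) powr q \<le> exp (real d * q * ?l)"
  proof -
    have "(real n ^ d) powr q = real n powr (real d * q)" using n0 by (simp add: powr_realpow[symmetric] powr_powr)
    also have "\<dots> \<le> exp ?l powr (real d * q)" using nexp n0 q by (intro powr_mono2) auto
    also have "\<dots> = exp (real d * q * ?l)" by (simp add: exp_powr_real mult_ac)
    finally show ?thesis .
  qed
  have e2: "(1 / 3) ^ (A * top_cost) \<le> exp (- (real d * q * ?l)) * (exp (- (q / 2 * ?l)) * exp (- ?l))"
  proof -
    have "(1 / 3) ^ (A * top_cost) \<le> exp (- real (A * top_cost))" by (rule three_pow)
    also have "\<dots> \<le> exp (- ((real d * q + q / 2 + 1) * ?l))"
    proof -
      have "real d * q + q / 2 + 1 \<le> (real d + 3) * q + 2" using q by (simp add: algebra_simps)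
      then have "(real d * q + q / 2 + 1) * ?l \<le> real A * ?l" using A_ge by (intro mult_right_mono) auto
      then show ?thesis by simp
    qed
    also have "\<dots> = exp (- (real d * q * ?l)) * (exp (- (q / 2 * ?l)) * exp (- ?l))"
      by (simp add: exp_add[symmetric] algebra_simps)
    finally show ?thesis .
  qed
  have e3: "exp (- (q / 2 * ?l)) \<le> (real n * V_max) powr (- q / 2)"
  proof -
    have "exp (- (q / 2 * ?l)) = exp ?l powr (- q / 2)" by (simp add: exp_powr_real mult_ac)
    also have "\<dots> \<le> (real n * V_max) powr (- q / 2)"
    proof (rule powr_mono2')
      have "real n * V_max \<le> real n * 1" using V_max_le1 by (intro mult_left_mono) auto
      then show "real n * V_max \<le> exp ?l" using nexp by linarith
    qed (use n0 V_max_pos q in auto)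
    finally show ?thesis .
  qed
  have e4: "cell_count \<zz> d top_cost * exp (- ?l) \<le> sum_const \<zz> q d"
  proof -
    have "cell_count \<zz> d top_cost * 1 * exp (- ?l) \<le> cell_count \<zz> d top_cost * ?l powr q * exp (- ?l)"
      using l1 q by (intro mult_right_mono mult_left_mono ge_one_powr_ge_zero) (auto simp: cell_count_def)
    then show ?thesis using cell_count_bound[OF q top_cost(1), of \<zz> d] by simp
  qed
  have cc: "0 \<le> cell_count \<zz> d top_cost" by (simp add: cell_count_def)
  have "(C_crude * real n ^ d) powr q * (cell_count \<zz> d top_cost * (1 / 3) ^ (A * top_cost))
     = C_crude powr q * (cell_count \<zz> d top_cost * ((real n ^ d) powr q * (1 / 3) ^ (A * top_cost)))"
    using consts_pos(3) by (simp add: powr_mult mult_ac)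
  also have "\<dots> \<le> C_crude powr q * (cell_count \<zz> d top_cost *
      (exp (real d * q * ?l) * (exp (- (real d * q * ?l)) * (exp (- (q / 2 * ?l)) * exp (- ?l)))))"
    using e1 e2 cc by (intro mult_left_mono mult_mono) auto
  also have "\<dots> = C_crude powr q * ((cell_count \<zz> d top_cost * exp (- ?l)) * exp (- (q / 2 * ?l)) * (exp (real d * q * ?l) * exp (- (real d * q * ?l))))"
    by (simp only: mult_ac)
  also have "exp (real d * q * ?l) * exp (- (real d * q * ?l)) = 1" by (simp add: exp_minus)
  also have "C_crude powr q * ((cell_count \<zz> d top_cost * exp (- ?l)) * exp (- (q / 2 * ?l)) * 1)
     \<le> C_crude powr q * (sum_const \<zz> q d * (real n * V_max) powr (- q / 2) * 1)"
    using e3 e4 cc sum_const_pos by (intro mult_left_mono mult_right_mono mult_mono) auto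
  finally show ?thesis by simp
qed

lemma samples_eq: "samples = sample_law f n"
  by (simp add: sample_law_def law_def)

lemma samples_sets: "sets samples = sets (\<Pi>\<^sub>M i\<in>{1..n}. (borel :: (real ^ 'd) measure))"
  by (intro sets_PiM_cong) auto

text \<open>The partition takes only finitely many values, so it suffices to treat a fixed partition
  with a measurable random bandwidth.\<close>

lemma selected_measurable:
  assumes "selector sel"
  shows "selected_estimator sel \<in> borel_measurable samples"
proof -
  have K_meas[measurable]: "K \<in> borel_measurable borel" by (rule kernel_like_measurable[OF K_like])
  have "sel \<in> samples \<rightarrow>\<^sub>M borel \<Otimes>\<^sub>M count_space UNIV"
    using assms unfolding selector_def measurable_cong_sets[OF samples_sets refl] by blast
  then have s1[measurable]: "(\<lambda>X. fst (sel X)) \<in> samples \<rightarrow>\<^sub>M borel"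
    and s2: "(\<lambda>X. snd (sel X)) \<in> samples \<rightarrow>\<^sub>M count_space UNIV"
    by (auto intro: measurable_compose[OF _ measurable_fst] measurable_compose[OF _ measurable_snd])
  have nth: "(\<lambda>X. fst (sel X) $ j) \<in> borel_measurable samples" for j
    by (rule measurable_compose[OF s1 borel_measurable_nth])
  have Xi: "(\<lambda>X. X i $ j) \<in> borel_measurable samples" if "i \<in> {1..n}" for i j
  proof -
    have "(\<lambda>X. X i) \<in> samples \<rightarrow>\<^sub>M law f" by (rule measurable_component_singleton[OF that])
    then have "(\<lambda>X. X i) \<in> samples \<rightarrow>\<^sub>M borel" by (simp add: measurable_cong_sets[OF refl law_sets])
    then show ?thesis by (rule measurable_compose[OF _ borel_measurable_nth])
  qed
  have ker: "(\<lambda>X. kernel_scaled I (fst (sel X)) (X i - x0)) \<in> borel_measurable samples" if "i \<in> {1..n}" for I i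
  proof -
    have "(\<lambda>X. K ((X i - x0) $ j / fst (sel X) $ j)) \<in> borel_measurable samples" for j
      unfolding vector_minus_component
      by (rule measurable_compose[OF _ K_meas])
        (intro borel_measurable_divide borel_measurable_diff borel_measurable_const Xi[OF that] nth)
    moreover have "(\<lambda>X. vol (fst (sel X)) I) \<in> borel_measurable samples"
      unfolding vol_def by (intro borel_measurable_prod nth)
    ultimately show ?thesis unfolding kernel_scaled_def by (intro borel_measurable_divide borel_measurable_prod)
  qed
  have est: "(\<lambda>X. estimator (fst (sel X)) P X) \<in> borel_measurable samples" for P
    unfolding estimator_def kde_def
    by (intro borel_measurable_prod borel_measurable_divide borel_measurable_sum ker borel_measurable_const)
  have "(\<lambda>X. estimator (fst (sel X)) (snd (sel X)) X) \<in> borel_measurable samples"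
    by (rule measurable_compose_countable[OF est s2])
  then show ?thesis by (simp add: selected_estimator_def[abs_def])
qed

text \<open>For a fixed competitor. An infinite bias makes the claim trivial; otherwise the oracle
  term, the remainder and the exceptional event are integrated separately.\<close>

lemma risk_le:
  assumes sel: "selector sel" and hP: "(h, P) \<in> params" and Pf: "P \<in> indep_partitions f"
  shows "risk q n x0 f (selected_estimator sel)
    \<le> ennreal alpha1 * (bias_sup f h P + ennreal (u h P)) + ennreal (alpha2 * (real n * V_max) powr (- 1 / 2))"
proof (cases "bias_sup f h P")
  case top
  then show ?thesis using consts_pos(5) by (simp add: ennreal_mult_top)
next
  case (real b)
  let ?e = "\<lambda>X. \<bar>selected_estimator sel X - f x0\<bar> powr q"
  define r where "r = (real n * V_max) powr (- q / 2)"
  define y where "y = 2 * (C_osc * (b + u h P))"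
  have b0: "0 \<le> b + u h P" using real u0[OF hP] by simp
  have y0: "0 \<le> y" unfolding y_def using consts_pos(1) b0 by simp
  have r0: "0 \<le> r" by (simp add: r_def)
  obtain Z where Z: "Z \<in> borel_measurable samples"
    "\<And>X I I' w l. 1 \<le> l \<Longrightarrow> l \<le> top_cost \<Longrightarrow> (I, I', w) \<in> joins l \<Longrightarrow>
        ennreal (max 0 (\<bar>dev K (I \<inter> I') w X\<bar> - thr * sqrt (Gs * real l / (real n * vol w (I \<inter> I')))) powr q) \<le> Z X"
    "(\<integral>\<^sup>+X. Z X \<partial>samples) \<le> ennreal (2 * (thr powr q * GF powr q * sum_const \<zz> q d) * r)"
    using remainder_exists unfolding r_def by blast
  obtain E where E: "E \<in> sets samples" "emeasure samples E \<le> ennreal (cell_count \<zz> d top_cost * (1 / 3) ^ (A * top_cost))"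
    "\<And>X. X \<in> space samples - E \<Longrightarrow> good X"
    using bad_event_exists unfolding good_def by blast
  define cE where "cE = (C_crude * real n ^ d) powr q"
  have cE0: "0 \<le> cE" by (simp add: cE_def)
  have space: "space samples = space (\<Pi>\<^sub>M i\<in>{1..n}. (borel :: (real ^ 'd) measure))"
    by (rule sets_eq_imp_space_eq[OF samples_sets])
  have pt: "ennreal (?e X) \<le> ennreal (y powr q) + ennreal ((2 * C_rem) powr q) * Z X + ennreal cE * indicator E X"
    if X: "X \<in> space samples" for X
  proof -
    have sX: "sel X \<in> params" "\<And>h P. (h, P) \<in> params \<Longrightarrow> criterion (fst (sel X)) (snd (sel X)) X \<le> criterion h P X"
      using sel X unfolding selector_def space by auto
    then have sP: "(fst (sel X), snd (sel X)) \<in> params" by simp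
    show ?thesis
    proof (cases "X \<in> E")
      case True
      have "?e X \<le> cE"
        unfolding cE_def selected_estimator_def using crude_error[OF sP, of X] q by (intro powr_mono2) auto
      then have "ennreal (?e X) \<le> ennreal cE * indicator E X" using True by (simp add: ennreal_leI)
      then show ?thesis by (rule order_trans) simp
    next
      case False
      then have g: "good X" using E(3) X by simp
      show ?thesis
      proof (cases "Z X")
        case top
        have "0 < (2 * C_rem) powr q" using consts_pos(2) by simp
        then show ?thesis using top by (simp add: ennreal_mult_top)
      next
        case (real \<xi>)
        \<comment> \<open>With this choice \<open>remainder_le\<close> is the q-th root of the
          defining property of \<open>Z\<close>.\<close>
        define \<zeta> where "\<zeta> = \<xi> powr (1 / q)"
        have \<zeta>q: "\<zeta> powr q = \<xi>" using real q by (simp add: \<zeta>_def powr_powr)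
        have rem: "remainder_le \<zeta> X"
          unfolding remainder_le_def
        proof (intro allI impI)
          fix I I' w l assume l: "1 \<le> l" "l \<le> top_cost" "(I, I', w) \<in> joins l"
          let ?t = "\<bar>dev K (I \<inter> I') w X\<bar> - thr * sqrt (Gs * real l / (real n * vol w (I \<inter> I')))"
          have "max 0 ?t powr q \<le> \<xi>" using Z(2)[OF l, of X] real by (simp add: ennreal_le_iff)
          then have "(max 0 ?t powr q) powr (1 / q) \<le> \<zeta>" unfolding \<zeta>_def using q by (intro powr_mono2) auto
          then have "max 0 ?t \<le> \<zeta>" using q by (simp add: powr_powr)
          then show "\<bar>dev K (I \<inter> I') w X\<bar> \<le> thr * sqrt (Gs * real l / (real n * vol w (I \<inter> I'))) + \<zeta>" by linarith
        qed
        have \<zeta>0: "0 \<le> \<zeta>" by (simp add: \<zeta>_def)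
        have "\<bar>selected_estimator sel X - f x0\<bar> \<le> C_osc * (b + u h P) + C_rem * \<zeta>"
          unfolding selected_estimator_def
          by (rule oracle_pointwise[OF g rem \<zeta>0 hP Pf _ _ sP sX(2)[OF hP]]) (use \<open>bias_sup f h P = ennreal b\<close> \<open>0 \<le> b\<close> in auto)
        then have "?e X \<le> (C_osc * (b + u h P) + C_rem * \<zeta>) powr q" using q by (intro powr_mono2) auto
        also have "\<dots> \<le> 2 powr q * ((C_osc * (b + u h P)) powr q + (C_rem * \<zeta>) powr q)"
          using consts_pos b0 \<zeta>0 q by (intro powr_add_le_two_powr) auto
        also have "\<dots> = y powr q + (2 * C_rem) powr q * \<xi>"
          unfolding y_def \<zeta>q[symmetric] powr_mult by (simp add: distrib_left mult.assoc)
        finally have "ennreal (?e X) \<le> ennreal (y powr q + (2 * C_rem) powr q * \<xi>)" by (rule ennreal_leI)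
        also have "\<dots> = ennreal (y powr q) + ennreal ((2 * C_rem) powr q) * Z X"
          using real by (simp add: ennreal_plus ennreal_mult)
        finally show ?thesis by (rule order_trans) simp
      qed
    qed
  qed
  interpret samples: prob_space samples
    by (rule prob_space_PiM) (rule fD(2))
  have int: "(\<integral>\<^sup>+X. ennreal (?e X) \<partial>samples) \<le> ennreal (y powr q + C_tail * r)"
  proof -
    have "(\<integral>\<^sup>+X. ennreal (?e X) \<partial>samples)
       \<le> (\<integral>\<^sup>+X. ennreal (y powr q) + ennreal ((2 * C_rem) powr q) * Z X + ennreal cE * indicator E X \<partial>samples)"
      by (rule nn_integral_mono) (rule pt)
    also have "\<dots> = ennreal (y powr q) + ennreal ((2 * C_rem) powr q) * (\<integral>\<^sup>+X. Z X \<partial>samples) + ennreal cE * emeasure samples E"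
    proof -
      have m1: "(\<lambda>X. ennreal ((2 * C_rem) powr q) * Z X) \<in> borel_measurable samples" using Z(1) by measurable
      have m2: "(\<lambda>X. ennreal cE * indicator E X) \<in> borel_measurable samples" using E(1) by measurable
      have "(\<integral>\<^sup>+X. ennreal (y powr q) + ennreal ((2 * C_rem) powr q) * Z X + ennreal cE * indicator E X \<partial>samples)
         = (\<integral>\<^sup>+X. ennreal (y powr q) \<partial>samples) + (\<integral>\<^sup>+X. ennreal ((2 * C_rem) powr q) * Z X \<partial>samples) + (\<integral>\<^sup>+X. ennreal cE * indicator E X \<partial>samples)"
      proof -
        have c: "(\<lambda>X. ennreal (y powr q)) \<in> borel_measurable samples" by (rule borel_measurable_const)
        show ?thesis
          unfolding nn_integral_add[OF borel_measurable_add[OF c m1] m2] nn_integral_add[OF c m1] ..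
      qed
      moreover have "(\<integral>\<^sup>+X. ennreal (y powr q) \<partial>samples) = ennreal (y powr q)"
        by (simp only: nn_integral_const samples.emeasure_space_1 mult_1_right)
      ultimately show ?thesis
        by (simp only: nn_integral_cmult[OF Z(1)] nn_integral_cmult_indicator[OF E(1)])
    qed
    also have "\<dots> \<le> ennreal (y powr q) + ennreal ((2 * C_rem) powr q) * ennreal (2 * (thr powr q * GF powr q * sum_const \<zz> q d) * r)
         + ennreal cE * ennreal (cell_count \<zz> d top_cost * (1 / 3) ^ (A * top_cost))"
      by (intro add_mono mult_left_mono Z(3) E(2)) auto
    also have "\<dots> = ennreal (y powr q + (2 * C_rem) powr q * (2 * (thr powr q * GF powr q * sum_const \<zz> q d) * r)
         + cE * (cell_count \<zz> d top_cost * (1 / 3) ^ (A * top_cost)))"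
    proof -
      have "0 \<le> 2 * (thr powr q * GF powr q * sum_const \<zz> q d) * r" using sum_const_pos r0 by simp
      moreover have "0 \<le> cell_count \<zz> d top_cost * (1 / 3) ^ (A * top_cost)" by (simp add: cell_count_def)
      ultimately show ?thesis using cE0 by (simp add: ennreal_plus ennreal_mult del: ennreal_plus[symmetric])
    qed
    also have "\<dots> \<le> ennreal (y powr q + C_tail * r)"
      using bad_event_cost unfolding cE_def[symmetric] r_def[symmetric] C_tail_def
      by (intro ennreal_leI) (simp add: algebra_simps)
    finally show ?thesis .
  qed
  have meas: "?e \<in> borel_measurable samples"
    using selected_measurable[OF sel] by measurable
  \<comment> \<open>\<open>risk\<close> is infinite by definition when the error is not integrable,
    so finiteness has to precede any bound.\<close>
  have integ: "integrable samples ?e"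
  proof (rule integrableI_nonneg[OF meas])
    show "(\<integral>\<^sup>+X. ennreal (?e X) \<partial>samples) < \<infinity>" using int by (rule le_less_trans) simp
  qed auto
  have T0: "0 \<le> C_tail * r" using consts_pos(4) r0 by simp
  have I0: "0 \<le> (\<integral>X. ?e X \<partial>samples)" by simp
  have "ennreal (\<integral>X. ?e X \<partial>samples) \<le> ennreal (y powr q + C_tail * r)"
    using int by (subst nn_integral_eq_integral[OF integ, symmetric]) auto
  then have "(\<integral>X. ?e X \<partial>samples) \<le> y powr q + C_tail * r" using T0 by (subst (asm) ennreal_le_iff) auto
  then have "(\<integral>X. ?e X \<partial>samples) powr (1 / q) \<le> (y powr q + C_tail * r) powr (1 / q)"
    using q I0 by (intro powr_mono2) auto
  also have "\<dots> \<le> 2 powr (1 / q) * ((y powr q) powr (1 / q) + (C_tail * r) powr (1 / q))"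
    using T0 q by (intro powr_add_le_two_powr) auto
  also have "\<dots> \<le> 2 * ((y powr q) powr (1 / q) + (C_tail * r) powr (1 / q))"
  proof (rule mult_right_mono)
    have "2 powr (1 / q) \<le> (2::real) powr 1" using q by (intro powr_mono) auto
    then show "2 powr (1 / q) \<le> (2::real)" by simp
  qed auto
  also have "(y powr q) powr (1 / q) = y" using y0 q by (simp add: powr_powr)
  also have "(C_tail * r) powr (1 / q) = C_tail powr (1 / q) * (real n * V_max) powr (- 1 / 2)"
    using consts_pos(4) r0 q by (simp add: powr_mult r_def powr_powr)
  also have "2 * (y + C_tail powr (1 / q) * (real n * V_max) powr (- 1 / 2)) = alpha1 * (b + u h P) + alpha2 * (real n * V_max) powr (- 1 / 2)"
    by (simp add: y_def alpha1_def alpha2_def algebra_simps)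
  finally have fin: "(\<integral>X. ?e X \<partial>samples) powr (1 / q) \<le> alpha1 * (b + u h P) + alpha2 * (real n * V_max) powr (- 1 / 2)" .
  have "risk q n x0 f (selected_estimator sel) = ennreal ((\<integral>X. ?e X \<partial>samples) powr (1 / q))"
    unfolding risk_def samples_eq[symmetric] using integ by simp
  also have "\<dots> \<le> ennreal (alpha1 * (b + u h P) + alpha2 * (real n * V_max) powr (- 1 / 2))"
    by (rule ennreal_leI[OF fin])
  also have "\<dots> = ennreal alpha1 * (bias_sup f h P + ennreal (u h P)) + ennreal (alpha2 * (real n * V_max) powr (- 1 / 2))"
  proof -
    have "0 \<le> alpha1 * (b + u h P)" "0 \<le> alpha2 * (real n * V_max) powr (- 1 / 2)" using consts_pos b0 by auto
    then have "ennreal (alpha1 * (b + u h P) + alpha2 * (real n * V_max) powr (- 1 / 2))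
      = ennreal (alpha1 * (b + u h P)) + ennreal (alpha2 * (real n * V_max) powr (- 1 / 2))" by (rule ennreal_plus)
    also have "ennreal (alpha1 * (b + u h P)) = ennreal alpha1 * ennreal (b + u h P)"
      using consts_pos b0 by (intro ennreal_mult) auto
    also have "ennreal (b + u h P) = bias_sup f h P + ennreal (u h P)"
      using real u0[OF hP] by simp
    finally show ?thesis .
  qed
  finally show ?thesis .
qed

lemma oracle_inequality:
  assumes sel: "selector sel"
  shows "risk q n x0 f (selected_estimator sel)
    \<le> ennreal alpha1 * oracle_risk f + ennreal (alpha2 * (real n * V_max) powr (- 1 / 2))"
  unfolding oracle_risk_def
proof (rule le_INF_affine[OF consts_pos(5)])
  fix t assume "t \<in> {(h, P) \<in> params. P \<in> indep_partitions f}"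
  then obtain h P where t: "t = (h, P)" and hP: "(h, P) \<in> params" "P \<in> indep_partitions f" by auto
  from risk_le[OF sel hP]
  show "risk q n x0 f (selected_estimator sel)
    \<le> ennreal alpha1 * (case t of (h, P) \<Rightarrow> bias_sup f h P + ennreal (sqrt (max 1 (ln (delta h P)) / (real n * V h P))))
      + ennreal (alpha2 * (real n * V_max) powr (- 1 / 2))"
    by (simp add: t u_def)
qed simp

end

theorem theorem1:
  fixes K :: "real \<Rightarrow> real" and L \<zz> q F :: real and \<tau> :: "nat \<Rightarrow> real"
  assumes "kde_kernel K L"
    and "0 < \<zz>"
    and "\<forall>s\<in>{1..CARD('d::finite)}. 0 < \<tau> s \<and> \<tau> s \<le> 1"
    and "1 \<le> q"
    and "0 < F"
  shows "\<exists>\<alpha>1 \<alpha>2 :: real. 0 < \<alpha>1 \<and> 0 < \<alpha>2 \<and>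
    (\<forall>(\<hh> :: 'd set \<Rightarrow> real ^ 'd) (x0 :: real ^ 'd) (n :: nat) (\<HH> :: (real ^ 'd) set)
       (\<PP> :: 'd set set set) (sel :: (nat \<Rightarrow> real ^ 'd) \<Rightarrow> (real ^ 'd) \<times> 'd set set)
       (f :: real ^ 'd \<Rightarrow> real).
       (\<forall>I. I \<noteq> {} \<longrightarrow> (\<forall>i\<in>I. 0 < \<hh> I $ i \<and> \<hh> I $ i \<le> 1)) \<longrightarrow>
       3 \<le> n \<longrightarrow>
       \<HH> \<subseteq> unit_box \<longrightarrow>
       compact \<HH> \<or> finite \<HH> \<longrightarrow>
       \<PP> \<subseteq> {P. partition_on UNIV P} \<longrightarrow>
       selection_rule.params K L \<zz> \<tau> q \<hh> n \<HH> \<PP> \<noteq> {} \<longrightarrow>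
       selection_rule.selector K L \<zz> \<tau> q \<hh> x0 n \<HH> \<PP> sel \<longrightarrow>
       f \<in> density_class F \<PP> \<longrightarrow>
       risk q n x0 f (selection_rule.selected_estimator K x0 n sel)
         \<le> ennreal \<alpha>1 * selection_rule.oracle_risk K L \<zz> \<tau> q \<hh> x0 n \<HH> \<PP> f
           + ennreal (\<alpha>2 * (real n * selection_rule.V_max \<hh> \<PP>) powr (- 1 / 2)))"
proof -
  let ?d = "CARD('d)"
  let ?B = "kernel_sup K" and ?lm = "lam K L \<zz> \<tau> CARD('d) q"
  \<comment> \<open>Exported from the locale, the constants take only the displayed arguments. They
    are therefore fixed before the bandwidths, the sample size, the partitions and the density are
    chosen, which is the uniformity claimed.\<close>
  define \<beta>1 where "\<beta>1 = adaptive.alpha1 F ?B ?lm ?d"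
  define \<beta>2 where "\<beta>2 = adaptive.alpha2 L \<zz> q F ?B ?d"
  show ?thesis
  \<comment> \<open>Positivity of the constants is proved only inside an instance of the locale, and
    none is at hand yet; the maximum with 1 supplies it beforehand.\<close>
  proof (rule exI[of _ "max 1 \<beta>1"], rule exI[of _ "max 1 \<beta>2"], intro conjI allI impI)
    fix \<hh> :: "'d set \<Rightarrow> real ^ 'd" and x0 :: "real ^ 'd" and n :: nat and \<HH> :: "(real ^ 'd) set"
      and \<PP> :: "'d set set set" and sel :: "(nat \<Rightarrow> real ^ 'd) \<Rightarrow> (real ^ 'd) \<times> 'd set set"
      and f :: "real ^ 'd \<Rightarrow> real"
    assume hyps: "\<forall>I. I \<noteq> {} \<longrightarrow> (\<forall>i\<in>I. 0 < \<hh> I $ i \<and> \<hh> I $ i \<le> 1)" "3 \<le> n" "\<HH> \<subseteq> unit_box"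
      "\<PP> \<subseteq> {P. partition_on UNIV P}" "selection_rule.params K L \<zz> \<tau> q \<hh> n \<HH> \<PP> \<noteq> {}" "f \<in> density_class F \<PP>"
      and sel: "selection_rule.selector K L \<zz> \<tau> q \<hh> x0 n \<HH> \<PP> sel"
    interpret adaptive K L \<zz> \<tau> q \<hh> x0 n \<HH> \<PP> f F ?B ?lm "a_const K L \<zz> \<tau> ?d q" ?d "mom_exp ?d q"
      by unfold_locales (use assms hyps in auto)
    have "risk q n x0 f (selected_estimator sel) \<le> ennreal \<beta>1 * oracle_risk f + ennreal (\<beta>2 * (real n * V_max) powr (- 1 / 2))"
      unfolding \<beta>1_def \<beta>2_def by (rule oracle_inequality[OF sel])
    also have "\<dots> \<le> ennreal (max 1 \<beta>1) * oracle_risk f + ennreal (max 1 \<beta>2 * (real n * V_max) powr (- 1 / 2))"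
      by (intro add_mono mult_right_mono ennreal_leI) auto
    finally show "risk q n x0 f (selected_estimator sel)
      \<le> ennreal (max 1 \<beta>1) * oracle_risk f + ennreal (max 1 \<beta>2 * (real n * V_max) powr (- 1 / 2))" .
  qed auto
qed

end
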